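(* Let $\phi^n$ be generated from $\phi^0$ by the stabilized time-discrete semi-implicit scheme $$\Big(\frac1\tau+\frac\kappa\epsilon\Big)(\phi^{n+1}-\phi^n)=\epsilon\Delta\phi^{n+1}-\frac1\epsilon W'(\phi^n)-\gamma\big[(-\Delta)^{-1}(f(\phi^n)-\omega)\big]f'(\phi^n)-M\Big(\int_{\mathbb{T}^d}(f(\phi^n)-\omega)\,dx\Big)f'(\phi^n)$$ on $\mathbb{T}^d$ with periodic boundary conditions, and assume $0\le\phi^0\le1$. If $$\frac\kappa\epsilon\ \ge\ \frac{L_{W''}}{\epsilon}+(L_{f'}^2+\tilde\omega L_{f''})\Big(\gamma\|(-\Delta)^{-1}\|+M|\mathbb{T}^d|\Big),$$ then the scheme is unconditionally energy stable: for every time step size $\tau>0$ and every $n$, $$E^{\mathrm{pOK}}[\phi^{n+1}]\le E^{\mathrm{pOK}}[\phi^n].$$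
   Context: $\mathbb{T}^d=\prod_{i=1}^d[-X_i,X_i]\subset\mathbb{R}^d$, $d=2,3$, is a periodic box. The parameters are $\epsilon>0$, $\gamma>0$, $M>0$, $\kappa>0$, $\omega\in(0,1)$, $\tilde\omega=\max\{\omega,1-\omega\}$; $T>0$, $N>0$ is an integer, $\tau=T/N$, and $n$ ranges over $0,\dots,N-1$. $W(s)=18(s^2-s)^2$, $f(s)=3s^2-2s^3$ (not extended), $L_{W''}=\|W''\|_{L^\infty[0,1]}$, $L_{f'}=\|f'\|_{L^\infty[0,1]}$, $L_{f''}=\|f''\|_{L^\infty[0,1]}$. For $g$ on $\mathbb{T}^d$, $(-\Delta)^{-1}g$ is the periodic mean-zero function $u$ with $-\Delta u=g-\frac{1}{|\mathbb{T}^d|}\int_{\mathbb{T}^d}g\,dx$; $(-\Delta)^{-1/2}$ is its nonnegative square root on $L^2(\mathbb{T}^d)$; $\|(-\Delta)^{-1}\|$ is the operator norm of $(-\Delta)^{-1}$ from $L^\infty(\mathbb{T}^d)$ to itself. At each step $\phi^{n+1}$ is the unique periodic solution of the (linear in $\phi^{n+1}$) equation. The energy is $$E^{\mathrm{pOK}}[\phi]=\int_{\mathbb{T}^d}\Big(\frac\epsilon2|\nabla\phi|^2+\frac1\epsilon W(\phi)\Big)dx+\frac\gamma2\int_{\mathbb{T}^d}\big|(-\Delta)^{-1/2}(f(\phi)-\omega)\big|^2dx+\frac M2\Big[\int_{\mathbb{T}^d}(f(\phi)-\omega)\,dx\Big]^2,$$ understood as $+\infty$ if $\phi\notin H^1(\mathbb{T}^d)$.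 *)

theory Defs
  imports "HOL-Analysis.Analysis" "HOL-Probability.Essential_Supremum"
begin

text \<open>
  A function on the periodic box is a function on the whole space that has period 2 X_i in the
  i-th coordinate. It is integrated over the fundamental domain cbox (-X) X. Functions of
  Lebesgue type are not quotiented: equality in L2 is equality almost everywhere.
\<close>

definition periodic :: "real^'d \<Rightarrow> (real^'d \<Rightarrow> 'b) \<Rightarrow> bool" where
  "periodic X u \<longleftrightarrow> (\<forall>x i. u (x + axis i (2 * X $ i)) = u x)"

definition torus :: "real^'d \<Rightarrow> (real^'d) measure" where
  "torus X = lebesgue_on (cbox (- X) X)"

definition torus_vol :: "real^'d \<Rightarrow> real" where
  "torus_vol X = measure lebesgue (cbox (- X) X)"

definition Linf_norm :: "'a measure \<Rightarrow> ('a \<Rightarrow> real) \<Rightarrow> ereal" where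
  "Linf_norm \<mu> u = esssup \<mu> (\<lambda>x. ereal \<bar>u x\<bar>)"

definition L2 :: "real^'d \<Rightarrow> (real^'d \<Rightarrow> 'b::euclidean_space) set" where
  "L2 X = {u. periodic X u \<and> u \<in> borel_measurable (torus X)
              \<and> integrable (torus X) (\<lambda>x. (norm (u x))\<^sup>2)}"

definition L2_inner :: "real^'d \<Rightarrow> (real^'d \<Rightarrow> real) \<Rightarrow> (real^'d \<Rightarrow> real) \<Rightarrow> real" where
  "L2_inner X u v = (LINT x|torus X. u x * v x)"

definition partial :: "'d \<Rightarrow> (real^'d \<Rightarrow> real) \<Rightarrow> real^'d \<Rightarrow> real" where
  "partial i \<psi> x = frechet_derivative \<psi> (at x) (axis i 1)"

text \<open>
  The list runs over all iterated partial derivatives. Requiring every one of them to be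
  (Frechet) differentiable everywhere is the same as C-infinity.
\<close>

definition test_functions :: "real^'d \<Rightarrow> (real^'d \<Rightarrow> real) set" where
  "test_functions X = {\<psi>. periodic X \<psi> \<and> (\<forall>is x. foldr partial is \<psi> differentiable (at x))}"

definition laplacian :: "(real^'d \<Rightarrow> real) \<Rightarrow> real^'d \<Rightarrow> real" where
  "laplacian \<psi> x = (\<Sum>i\<in>UNIV. partial i (partial i \<psi>) x)"

text \<open>The test functions are periodic, so no boundary terms occur in the weak derivatives.\<close>

definition has_weak_gradient :: "real^'d \<Rightarrow> (real^'d \<Rightarrow> real) \<Rightarrow> (real^'d \<Rightarrow> real^'d) \<Rightarrow> bool" where
  "has_weak_gradient X u G \<longleftrightarrow> u \<in> L2 X \<and> G \<in> L2 X \<and>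
     (\<forall>\<psi>\<in>test_functions X. \<forall>i.
        (LINT x|torus X. u x * partial i \<psi> x) = - (LINT x|torus X. G x $ i * \<psi> x))"

definition H1 :: "real^'d \<Rightarrow> (real^'d \<Rightarrow> real) set" where
  "H1 X = {u. \<exists>G. has_weak_gradient X u G}"

definition weak_grad :: "real^'d \<Rightarrow> (real^'d \<Rightarrow> real) \<Rightarrow> real^'d \<Rightarrow> real^'d" where
  "weak_grad X u = (SOME G. has_weak_gradient X u G)"

definition has_weak_laplacian :: "real^'d \<Rightarrow> (real^'d \<Rightarrow> real) \<Rightarrow> (real^'d \<Rightarrow> real) \<Rightarrow> bool" where
  "has_weak_laplacian X u v \<longleftrightarrow> u \<in> L2 X \<and> v \<in> L2 X \<and>
     (\<forall>\<psi>\<in>test_functions X. L2_inner X u (laplacian \<psi>) = L2_inner X v \<psi>)"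

text \<open>The solution u of the Poisson problem is determined up to a null set.\<close>

definition inv_lap :: "real^'d \<Rightarrow> (real^'d \<Rightarrow> real) \<Rightarrow> real^'d \<Rightarrow> real" where
  "inv_lap X g = (SOME u. (LINT x|torus X. u x) = 0 \<and>
     has_weak_laplacian X u (\<lambda>x. - (g x - (LINT y|torus X. g y) / torus_vol X)))"

text \<open>
  S is a nonnegative self-adjoint operator on L2 with square A. Boundedness need not be stated:
  an everywhere defined symmetric operator is bounded.
\<close>

definition nonneg_sqrt_of :: "real^'d \<Rightarrow> ((real^'d \<Rightarrow> real) \<Rightarrow> real^'d \<Rightarrow> real)
    \<Rightarrow> ((real^'d \<Rightarrow> real) \<Rightarrow> real^'d \<Rightarrow> real) \<Rightarrow> bool" where
  "nonneg_sqrt_of X A S \<longleftrightarrow>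
     (\<forall>g\<in>L2 X. S g \<in> L2 X) \<and>
     (\<forall>g\<in>L2 X. \<forall>h\<in>L2 X. \<forall>a b.
        AE x in torus X. S (\<lambda>y. a * g y + b * h y) x = a * S g x + b * S h x) \<and>
     (\<forall>g\<in>L2 X. \<forall>h\<in>L2 X. L2_inner X (S g) h = L2_inner X g (S h)) \<and>
     (\<forall>g\<in>L2 X. 0 \<le> L2_inner X (S g) g) \<and>
     (\<forall>g\<in>L2 X. AE x in torus X. S (S g) x = A g x)"

definition inv_sqrt_lap :: "real^'d \<Rightarrow> (real^'d \<Rightarrow> real) \<Rightarrow> real^'d \<Rightarrow> real" where
  "inv_sqrt_lap X = (SOME S. nonneg_sqrt_of X (inv_lap X) S)"

definition inv_lap_opnorm :: "real^'d \<Rightarrow> ereal" where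
  "inv_lap_opnorm X =
     (SUP g\<in>{g. periodic X g \<and> g \<in> borel_measurable (torus X) \<and> Linf_norm (torus X) g \<le> 1}.
        Linf_norm (torus X) (inv_lap X g))"

definition W :: "real \<Rightarrow> real" where
  "W s = 18 * (s\<^sup>2 - s)\<^sup>2"

definition f :: "real \<Rightarrow> real" where
  "f s = 3 * s\<^sup>2 - 2 * s ^ 3"

definition L_W'' :: ereal where
  "L_W'' = Linf_norm (lebesgue_on {0..1}) (deriv (deriv W))"

definition L_f' :: ereal where
  "L_f' = Linf_norm (lebesgue_on {0..1}) (deriv f)"

definition L_f'' :: ereal where
  "L_f'' = Linf_norm (lebesgue_on {0..1}) (deriv (deriv f))"

text \<open>
  In dimension 2 and 3 the space H1 embeds into L6, so the integrals below all exist when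
  u is in H1.
\<close>

definition energy_pOK ::
    "real^'d \<Rightarrow> real \<Rightarrow> real \<Rightarrow> real \<Rightarrow> real \<Rightarrow> (real^'d \<Rightarrow> real) \<Rightarrow> ereal" where
  "energy_pOK X \<epsilon> \<gamma> M \<omega> u =
     (if u \<in> H1 X then ereal (
        (LINT x|torus X. \<epsilon> / 2 * (norm (weak_grad X u x))\<^sup>2 + 1 / \<epsilon> * W (u x))
        + \<gamma> / 2 * (LINT x|torus X. \<bar>inv_sqrt_lap X (\<lambda>y. f (u y) - \<omega>) x\<bar>\<^sup>2)
        + M / 2 * (LINT x|torus X. f (u x) - \<omega>)\<^sup>2)
      else \<infinity>)"

text \<open>
  v solves the scheme with previous iterate u. The Laplacian of v is the distributional one
  (an L2 function w), and the equation holds almost everywhere.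
\<close>

definition scheme_step :: "real^'d \<Rightarrow> real \<Rightarrow> real \<Rightarrow> real \<Rightarrow> real \<Rightarrow> real \<Rightarrow> real
    \<Rightarrow> (real^'d \<Rightarrow> real) \<Rightarrow> (real^'d \<Rightarrow> real) \<Rightarrow> bool" where
  "scheme_step X \<epsilon> \<gamma> M \<kappa> \<omega> \<tau> u v \<longleftrightarrow>
     (\<exists>w. has_weak_laplacian X v w \<and>
       (AE x in torus X.
          (1 / \<tau> + \<kappa> / \<epsilon>) * (v x - u x) =
            \<epsilon> * w x - 1 / \<epsilon> * deriv W (u x)
            - \<gamma> * inv_lap X (\<lambda>y. f (u y) - \<omega>) x * deriv f (u x)
            - M * (LINT y|torus X. f (u y) - \<omega>) * deriv f (u x)))"

end

theory Submission
  imports Defs "HOL-Real_Asymp.Real_Asymp"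
begin

text \<open>
  Everything is expanded in the real orthogonal basis of products of sines and cosines on the box,
  which is complete by the Stone--Weierstrass theorem. The inverse Laplacian, its square root and
  the weak gradient then act on Fourier coefficients, so that Parseval's identity gives Green's
  formula. The stabilization makes the explicit right-hand side of the scheme take values in
  \<open>[0, c]\<close>, \<open>c = 1 / \<tau> + \<kappa> / \<epsilon>\<close>, as long as \<open>\<phi>\<^sup>n\<close> takes values in \<open>[0, 1]\<close>; by the minimum
  principle for \<open>c - \<epsilon> \<Delta>\<close>, applied to \<open>\<phi>\<^sup>n\<^sup>+\<^sup>1\<close> and \<open>1 - \<phi>\<^sup>n\<^sup>+\<^sup>1\<close>, the same holds for \<open>\<phi>\<^sup>n\<^sup>+\<^sup>1\<close>. Testing the scheme with
  \<open>\<phi>\<^sup>n\<^sup>+\<^sup>1 - \<phi>\<^sup>n\<close> and expanding \<open>W\<close> and \<open>f\<close> to second order on \<open>[0, 1]\<close>, the quadratic remainders are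
  absorbed by the stabilization term. The nonlocal remainder needs the \<open>L\<^sup>2\<close> operator norm of the
  inverse Laplacian, which is at most its \<open>L\<^sup>\<infinity>\<close> operator norm because the eigenfunctions are bounded.
\<close>

section \<open>Trigonometric products on the box\<close>

text \<open>The obstacle is the polynomial growth of \<open>W\<close> and \<open>f\<close>, which
  are not cut off outside the unit interval: no nonlinear term is bounded until the range of the
  iterate is known. The induction over the time steps therefore carries the range alone, and the
  energy estimate follows for each step. The stability condition is used in two different ways.
  Invariance of the range needs the full slopes \<open>36 / \<epsilon>\<close> and
  \<open>6 * \<omega>' * K\<close> with \<open>K = \<gamma> * L + M * torus_vol X\<close>. The
  energy estimate needs half of the lower bound on \<open>\<kappa> / \<epsilon>\<close>, since
  second-order Taylor remainders carry the factor 1/2. The inverse Laplacian, its root and the weak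
  gradient are given by arbitrary choices, determined at most up to null sets. Fourier coefficients
  are insensitive to null sets and turn these operators into multipliers. Completeness is derived
  from a sign criterion, tested with nonnegative trigonometric polynomials, because the same
  criterion yields the minimum principle.\<close>

text \<open>Negative frequencies encode the sines, so that \<open>trig k\<close> has derivative \<open>- k * trig (- k)\<close> for
  every \<open>k\<close>.\<close>

definition trig :: "int \<Rightarrow> real \<Rightarrow> real" where
  "trig k t = (if 0 \<le> k then cos (of_int k * t) else sin (- of_int k * t))"

lemma trig_0 [simp]: "trig 0 t = 1"
  by (simp add: trig_def)

lemma trig_le_1: "\<bar>trig k t\<bar> \<le> 1"
  by (simp add: trig_def)

lemma trig_deriv: "(trig k has_real_derivative - of_int k * trig (- k) t) (at t within S)"
proof -
  consider "k = 0" | "k > 0" | "k < 0" by linarith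
  then show ?thesis
  proof cases
    case 1
    then show ?thesis by (simp add: trig_def[abs_def])
  next
    case 2
    then have "trig k = (\<lambda>t. cos (of_int k * t))" "trig (- k) t = sin (of_int k * t)"
      by (auto simp: trig_def fun_eq_iff)
    then show ?thesis by (auto intro!: derivative_eq_intros)
  next
    case 3
    then have "trig k = (\<lambda>t. sin (- of_int k * t))" "trig (- k) t = cos (of_int k * t)"
      by (auto simp: trig_def fun_eq_iff)
    then show ?thesis by (auto intro!: derivative_eq_intros)
  qed
qed

lemma trig_periodic: "trig k (t + 2 * pi) = trig k t"
proof -
  have "of_int k * (t + 2 * pi) = of_int k * t + 2 * pi * of_int k" by (simp add: algebra_simps)
  then have "cos (of_int k * (t + 2 * pi)) = cos (of_int k * t)"
    and "sin (of_int k * (t + 2 * pi)) = sin (of_int k * t)"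
    by (simp_all only: cos_add sin_add cos_int_2pin sin_int_2pin mult_1_right mult_zero_right diff_0_right add_0_right)
  then show ?thesis by (simp add: trig_def)
qed

lemma continuous_trig: "continuous_on S (trig k)"
  by (meson DERIV_continuous_on trig_deriv)

lemma cos_of_int_eq_trig: "cos (of_int j * t) = trig \<bar>j\<bar> t"
  by (auto simp: trig_def abs_if)

text \<open>Sum and difference frequencies come with either sign, while \<open>trig\<close> reads
  the sign as the choice between sine and cosine. The factor \<open>sgn j\<close> restores oddness
  and removes the term at \<open>j = 0\<close>, where \<open>trig\<close> would give 1 instead of
  0.\<close>

lemma sin_of_int_eq_trig: "sin (of_int j * t) = of_int (sgn j) * trig (- \<bar>j\<bar>) t"
  by (auto simp: trig_def sgn_if)

text \<open>Only closure of the span under products matters later, hence the existential form. The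
  witnesses are the product-to-sum formulas.\<close>

lemma trig_mult:
  "\<exists>p q c d. \<forall>t. trig j t * trig k t = c * trig p t + d * trig q t"
proof -
  have diff: "of_int (a - b) * t = of_int a * t - of_int b * t"
    and add: "of_int (a + b) * t = of_int a * t + of_int b * t" for a b :: int and t :: real
    by (simp_all add: algebra_simps)
  show ?thesis
  proof (cases "0 \<le> j"; cases "0 \<le> k")
    assume "0 \<le> j" "0 \<le> k"
    then have "trig j t * trig k t = 1/2 * trig \<bar>j - k\<bar> t + 1/2 * trig \<bar>j + k\<bar> t" for t
      unfolding cos_of_int_eq_trig[symmetric] diff add
      by (simp add: trig_def cos_times_cos add_divide_distrib)
    then show ?thesis by blast
  next
    assume "0 \<le> j" "\<not> 0 \<le> k"
    then have "trig j t * trig k t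
        = (1/2 * of_int (sgn (- k + j))) * trig (- \<bar>- k + j\<bar>) t
          + (1/2 * of_int (sgn (- k - j))) * trig (- \<bar>- k - j\<bar>) t" for t
      unfolding mult.assoc sin_of_int_eq_trig[symmetric] unfolding diff add
      by (simp only: trig_def if_True if_False cos_times_sin sin_times_cos of_int_minus mult.commute[of "cos _"])
        (simp add: add_divide_distrib)
    then show ?thesis by blast
  next
    assume "\<not> 0 \<le> j" "0 \<le> k"
    then have "trig j t * trig k t
        = (1/2 * of_int (sgn (- j + k))) * trig (- \<bar>- j + k\<bar>) t
          + (1/2 * of_int (sgn (- j - k))) * trig (- \<bar>- j - k\<bar>) t" for t
      unfolding mult.assoc sin_of_int_eq_trig[symmetric] unfolding diff add
      by (simp only: trig_def if_True if_False sin_times_cos of_int_minus)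
        (simp add: add_divide_distrib)
    then show ?thesis by blast
  next
    assume "\<not> 0 \<le> j" "\<not> 0 \<le> k"
    then have "trig j t * trig k t = 1/2 * trig \<bar>- j - - k\<bar> t + (- 1/2) * trig \<bar>- j + - k\<bar> t" for t
      unfolding cos_of_int_eq_trig[symmetric] diff add
      by (simp only: trig_def if_True if_False sin_times_sin of_int_minus) (simp add: diff_divide_distrib)
    then show ?thesis by blast
  qed
qed

section \<open>Partial derivatives as derivatives along coordinate lines\<close>

lemma partial_eqI:
  fixes h :: "real^'d \<Rightarrow> real"
  assumes "h differentiable at x"
    and "((\<lambda>s. h (x + s *\<^sub>R axis i 1)) has_real_derivative D) (at 0)"
  shows "partial i h x = D"
proof -
  have "(h has_derivative frechet_derivative h (at x)) (at x)"
    using assms(1) frechet_derivative_works by blast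
  then have "((\<lambda>s. h (x + s *\<^sub>R axis i 1)) has_derivative
      (\<lambda>s. frechet_derivative h (at x) (s *\<^sub>R axis i 1))) (at 0)"
    by (intro has_derivative_compose[of "\<lambda>s. x + s *\<^sub>R axis i 1" _ 0 UNIV h, simplified])
      (auto intro!: derivative_eq_intros)
  moreover have "((\<lambda>s. h (x + s *\<^sub>R axis i 1)) has_derivative (\<lambda>s. D * s)) (at 0)"
    using assms(2) by (simp add: has_field_derivative_def)
  ultimately have "(\<lambda>s. frechet_derivative h (at x) (s *\<^sub>R axis i 1)) = (\<lambda>s. D * s)"
    by (rule has_derivative_unique)
  from fun_cong[OF this, of 1] show ?thesis by (simp add: partial_def)
qed

lemma partial_line:
  fixes h :: "real^'d \<Rightarrow> real"
  assumes "\<And>x. h differentiable at x"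
  shows "((\<lambda>s. h (x + s *\<^sub>R axis i 1)) has_real_derivative partial i h (x + s *\<^sub>R axis i 1)) (at s)"
proof -
  have "(h has_derivative frechet_derivative h (at (x + s *\<^sub>R axis i 1))) (at (x + s *\<^sub>R axis i 1))"
    using assms frechet_derivative_works by blast
  then have D: "((\<lambda>s. h (x + s *\<^sub>R axis i 1)) has_derivative
      (\<lambda>r. frechet_derivative h (at (x + s *\<^sub>R axis i 1)) (r *\<^sub>R axis i 1))) (at s)"
    by (intro has_derivative_compose[of "\<lambda>s. x + s *\<^sub>R axis i 1" _ s UNIV h, simplified])
      (auto intro!: derivative_eq_intros)
  have "linear (frechet_derivative h (at (x + s *\<^sub>R axis i 1)))"
    by (simp add: assms linear_frechet_derivative)
  then have "(\<lambda>r. frechet_derivative h (at (x + s *\<^sub>R axis i 1)) (r *\<^sub>R axis i 1))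
      = (\<lambda>r. partial i h (x + s *\<^sub>R axis i 1) * r)"
    by (auto simp: linear_cmul partial_def)
  with D show ?thesis by (simp add: has_field_derivative_def)
qed

lemma partial_mult:
  fixes h g :: "real^'d \<Rightarrow> real"
  assumes "h differentiable at x" "g differentiable at x"
  shows "partial i (\<lambda>x. h x * g x) x = partial i h x * g x + h x * partial i g x"
proof -
  have "((\<lambda>x. h x * g x) has_derivative
      (\<lambda>d. h x * frechet_derivative g (at x) d + frechet_derivative h (at x) d * g x)) (at x)"
    using assms by (intro has_derivative_mult) (auto simp: frechet_derivative_works)
  then show ?thesis
    unfolding partial_def using frechet_derivative_at[symmetric] by fastforce
qed

lemma partial_add:
  fixes h g :: "real^'d \<Rightarrow> real"
  assumes "h differentiable at x" "g differentiable at x"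
  shows "partial i (\<lambda>x. h x + g x) x = partial i h x + partial i g x"
proof -
  have "((\<lambda>x. h x + g x) has_derivative
      (\<lambda>d. frechet_derivative h (at x) d + frechet_derivative g (at x) d)) (at x)"
    using assms by (intro has_derivative_add) (auto simp: frechet_derivative_works)
  then show ?thesis
    unfolding partial_def using frechet_derivative_at[symmetric] by fastforce
qed

lemma partial_cmult:
  fixes h :: "real^'d \<Rightarrow> real"
  assumes "h differentiable at x"
  shows "partial i (\<lambda>x. c * h x) x = c * partial i h x"
proof -
  have "((\<lambda>x. c * h x) has_derivative (\<lambda>d. c * frechet_derivative h (at x) d)) (at x)"
    using assms by (intro has_derivative_mult_right) (auto simp: frechet_derivative_works)
  then show ?thesis
    unfolding partial_def using frechet_derivative_at[symmetric] by fastforce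
qed

section \<open>Products of sines and cosines as eigenfunctions of the Laplacian\<close>

locale periodic_box =
  fixes X :: "real^'d"
  assumes X_pos: "0 < X $ i"
begin

definition wave :: "('d \<Rightarrow> int) \<Rightarrow> real^'d \<Rightarrow> real" where
  "wave m x = (\<Prod>i\<in>UNIV. trig (m i) (pi * x $ i / X $ i))"

definition freq :: "'d \<Rightarrow> ('d \<Rightarrow> int) \<Rightarrow> real" where
  "freq i m = pi * of_int (m i) / X $ i"

text \<open>Exchanges sine and cosine in coordinate \<open>i\<close>, which is what a derivative in
  that coordinate does to a wave, up to the factor \<open>- freq i m\<close>. Being an involution,
  it reindexes the Fourier series of derivatives.\<close>

definition flip :: "'d \<Rightarrow> ('d \<Rightarrow> int) \<Rightarrow> 'd \<Rightarrow> int" where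
  "flip i m = m(i := - m i)"

text \<open>The eigenvalue of the negative Laplacian on \<open>wave m\<close>.\<close>

definition lam :: "('d \<Rightarrow> int) \<Rightarrow> real" where
  "lam m = (\<Sum>i\<in>UNIV. (freq i m)\<^sup>2)"

lemma flip_flip [simp]: "flip i (flip i m) = m"
  by (simp add: flip_def)

lemma freq_flip [simp]: "freq i (flip i m) = - freq i m"
  by (simp add: flip_def freq_def)

lemma bij_flip: "bij (flip i)"
  by (metis bijI' flip_flip)

lemma lam_nonneg: "0 \<le> lam m"
  by (simp add: lam_def sum_nonneg)

lemma lam_eq_0_iff: "lam m = 0 \<longleftrightarrow> m = (\<lambda>_. 0)"
proof -
  have "freq i m = 0 \<longleftrightarrow> m i = 0" for i
    using X_pos[of i] by (simp add: freq_def)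
  then show ?thesis by (simp add: lam_def sum_nonneg_eq_0_iff fun_eq_iff)
qed

lemma wave_0: "wave (\<lambda>_. 0) x = 1"
  by (simp add: wave_def)

lemma wave_le_1: "\<bar>wave m x\<bar> \<le> 1"
  by (simp add: wave_def abs_prod prod_le_1 trig_le_1)

lemma wave_split:
  "wave m x = trig (m i) (pi * x $ i / X $ i) * (\<Prod>j\<in>UNIV - {i}. trig (m j) (pi * x $ j / X $ j))"
  unfolding wave_def by (simp add: prod.remove[of UNIV i])

lemma continuous_wave: "continuous_on S (wave m)"
proof -
  have "continuous_on S (\<lambda>x. trig (m i) (pi * x $ i / X $ i))" for i
    by (rule continuous_on_compose2[OF continuous_trig[of UNIV]])
      (use X_pos[of i] in \<open>auto intro!: continuous_intros\<close>)
  then show ?thesis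
    unfolding wave_def[abs_def] by (intro continuous_on_prod) auto
qed

lemma periodic_wave: "periodic X (wave m)"
  unfolding periodic_def
proof (intro allI)
  fix x i
  have "trig (m j) (pi * (x + axis i (2 * X $ i)) $ j / X $ j) = trig (m j) (pi * x $ j / X $ j)" for j
  proof (cases "j = i")
    case True
    then have "pi * (x + axis i (2 * X $ i)) $ j / X $ j = pi * x $ j / X $ j + 2 * pi"
      using X_pos[of i] by (simp add: field_simps)
    then show ?thesis by (simp add: trig_periodic)
  qed (simp add: axis_def)
  then show "wave m (x + axis i (2 * X $ i)) = wave m x"
    unfolding wave_def by simp
qed

lemma differentiable_wave: "wave m differentiable at x"
proof -
  have "((\<lambda>x. trig (m i) (pi * x $ i / X $ i)) has_derivative
      (\<lambda>d. - of_int (m i) * trig (- m i) (pi * x $ i / X $ i) * (pi * d $ i / X $ i))) (at x)" for i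
  proof (rule has_derivative_compose[of "\<lambda>x. pi * x $ i / X $ i" "\<lambda>d. pi * d $ i / X $ i" x UNIV "trig (m i)"])
    show "((\<lambda>x. pi * x $ i / X $ i) has_derivative (\<lambda>d. pi * d $ i / X $ i)) (at x)"
      using bounded_linear.has_derivative[OF bounded_linear_vec_nth[of i] has_derivative_ident]
      by (auto intro!: has_derivative_mult_right simp: divide_inverse intro!: has_derivative_mult_left)
    show "(trig (m i) has_derivative (*) (- of_int (m i) * trig (- m i) (pi * x $ i / X $ i)))
        (at (pi * x $ i / X $ i))"
      using trig_deriv[of "m i" "pi * x $ i / X $ i" UNIV] by (simp add: has_field_derivative_def)
  qed
  then have "((\<lambda>x. \<Prod>i\<in>UNIV. trig (m i) (pi * x $ i / X $ i)) has_derivative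
    (\<lambda>y. \<Sum>i\<in>UNIV. (- of_int (m i) * trig (- m i) (pi * x $ i / X $ i) * (pi * y $ i / X $ i)) * (\<Prod>j\<in>UNIV - {i}. trig (m j) (pi * x $ j / X $ j)))) (at x)"
    by (intro has_derivative_prod) auto
  then show ?thesis
    unfolding wave_def[abs_def] differentiable_def by blast
qed

lemma partial_wave: "partial i (wave m) = (\<lambda>x. - freq i m * wave (flip i m) x)"
proof
  fix x
  let ?R = "\<Prod>j\<in>UNIV - {i}. trig (m j) (pi * x $ j / X $ j)"
  have "wave m (x + s *\<^sub>R axis i 1) = trig (m i) (pi * (x $ i + s) / X $ i) * ?R" for s
    unfolding wave_split[of m _ i] by (simp add: axis_def)
  moreover have "((\<lambda>s. trig (m i) (pi * (x $ i + s) / X $ i)) has_real_derivative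
      (- of_int (m i) * trig (- m i) (pi * (x $ i + 0) / X $ i)) * (pi / X $ i)) (at 0)"
    by (rule DERIV_chain2[OF trig_deriv]) (use X_pos[of i] in \<open>auto intro!: derivative_eq_intros\<close>)
  then have "((\<lambda>s. trig (m i) (pi * (x $ i + s) / X $ i) * ?R) has_real_derivative
      (- of_int (m i) * trig (- m i) (pi * (x $ i + 0) / X $ i)) * (pi / X $ i) * ?R) (at 0)"
    by (rule DERIV_cmult_right)
  moreover have "wave (flip i m) x = trig (- m i) (pi * x $ i / X $ i) * ?R"
    unfolding wave_split[of "flip i m" x i] by (auto simp: flip_def intro!: prod.cong)
  ultimately show "partial i (wave m) x = - freq i m * wave (flip i m) x"
    by (intro partial_eqI differentiable_wave) (simp add: freq_def mult_ac)
qed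

lemma foldr_partial_wave: "\<exists>c m'. foldr partial is (wave m) = (\<lambda>x. c * wave m' x)"
proof (induction "is")
  case Nil
  show ?case by (intro exI[of _ 1] exI[of _ m]) simp
next
  case (Cons i "is")
  then obtain c m' where "foldr partial is (wave m) = (\<lambda>x. c * wave m' x)" by blast
  moreover have "partial i (\<lambda>x. c * wave m' x) = (\<lambda>x. (- c * freq i m') * wave (flip i m') x)"
    by (simp add: fun_eq_iff partial_cmult differentiable_wave partial_wave)
  ultimately have "foldr partial (i # is) (wave m) = (\<lambda>x. (- c * freq i m') * wave (flip i m') x)"
    by simp
  then show ?case by blast
qed

lemma wave_test: "wave m \<in> test_functions X"
proof -
  have "foldr partial is (wave m) differentiable at x" for "is" x
  proof -
    obtain c m' where "foldr partial is (wave m) = (\<lambda>x. c * wave m' x)"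
      using foldr_partial_wave by blast
    then show ?thesis by (simp add: differentiable_wave)
  qed
  then show ?thesis by (simp add: test_functions_def periodic_wave)
qed

lemma laplacian_wave: "laplacian (wave m) x = - lam m * wave m x"
proof -
  have "partial i (partial i (wave m)) x = - (freq i m)\<^sup>2 * wave m x" for i
    unfolding partial_wave[of i m]
    by (subst partial_cmult) (auto simp: differentiable_wave partial_wave power2_eq_square)
  then show ?thesis by (simp add: laplacian_def lam_def sum_distrib_right sum_negf)
qed

lemma test_differentiable: "\<psi> \<in> test_functions X \<Longrightarrow> \<psi> differentiable at x"
  unfolding test_functions_def by (auto dest: spec[of _ "[]"])

lemma partial_periodic:
  assumes "periodic X h" "\<And>x. h differentiable at x"
  shows "periodic X (partial i h)"
  unfolding periodic_def
proof (intro allI)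
  fix x j
  have "((\<lambda>s. h (x + axis j (2 * X $ j) + s *\<^sub>R axis i 1)) has_real_derivative
      partial i h (x + axis j (2 * X $ j))) (at 0)"
    using partial_line[OF assms(2), of "x + axis j (2 * X $ j)" i 0] by simp
  moreover have "h (x + axis j (2 * X $ j) + s *\<^sub>R axis i 1) = h (x + s *\<^sub>R axis i 1)" for s
    using assms(1) unfolding periodic_def by (metis add.commute add.left_commute)
  ultimately have "partial i h x = partial i h (x + axis j (2 * X $ j))"
    by (intro partial_eqI assms) simp
  then show "partial i h (x + axis j (2 * X $ j)) = partial i h x" by simp
qed

lemma test_partial:
  assumes "\<psi> \<in> test_functions X"
  shows "partial i \<psi> \<in> test_functions X"
proof -
  have "foldr partial is (partial i \<psi>) = foldr partial (is @ [i]) \<psi>" for "is" by simp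
  moreover have "\<forall>is x. foldr partial is \<psi> differentiable (at x)"
    using assms by (auto simp: test_functions_def)
  ultimately show ?thesis
    using assms test_differentiable[OF assms] partial_periodic[of \<psi> i]
    by (simp add: test_functions_def del: foldr_append)
qed

lemma test_continuous: "\<psi> \<in> test_functions X \<Longrightarrow> continuous_on S \<psi>"
  by (meson continuous_at_imp_continuous_on differentiable_imp_continuous_within test_differentiable)

section \<open>Integration by parts and orthogonality\<close>

lemma integral_torus_eq:
  fixes h :: "real^'d \<Rightarrow> real"
  assumes "continuous_on UNIV h"
  shows "integrable (torus X) h" "(LINT x|torus X. h x) = integral (cbox (- X) X) h"
proof -
  show *: "integrable (torus X) h"
    unfolding torus_def by (rule continuous_imp_integrable) (use assms continuous_on_subset in blast)
  then show "(LINT x|torus X. h x) = integral (cbox (- X) X) h"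
    unfolding torus_def by (rule lebesgue_integral_eq_integral) simp
qed

text \<open>After a shift by at most one period the box sticks out only beyond the face
  \<open>x $ i = X $ i\<close>. The protruding slab, moved back by one period, fills the gap left at
  the opposite face.\<close>

lemma integral_translate:
  fixes h :: "real^'d \<Rightarrow> real"
  assumes cont: "continuous_on UNIV h" and per: "periodic X h" and s: "0 \<le> s" "s \<le> 2 * X $ i"
  shows "integral (cbox (- X) X) (\<lambda>x. h (x + s *\<^sub>R axis i 1)) = integral (cbox (- X) X) h"
proof -
  let ?e = "s *\<^sub>R axis i 1 :: real^'d"
  let ?u = "\<chi> j. if j = i then s - X $ i else X $ j"
  let ?l = "\<chi> j. if j = i then s - X $ i else - X $ j"
  let ?r = "\<chi> j. if j = i then X $ i else - X $ j"
  have int: "h integrable_on cbox a b" for a b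
    using cont by (meson continuous_on_subset integrable_continuous subset_UNIV)
  have ax: "(axis i 1 :: real^'d) \<in> Basis" "x \<bullet> axis i 1 = x $ i" for x :: "real^'d"
    by (auto simp: axis_in_Basis_iff inner_axis)
  have box: "x \<in> cbox a b \<longleftrightarrow> a $ i \<le> x $ i \<and> x $ i \<le> b $ i \<and> (\<forall>j. j \<noteq> i \<longrightarrow> a $ j \<le> x $ j \<and> x $ j \<le> b $ j)"
    for x a b :: "real^'d"
    unfolding mem_box_cart by metis
  have "integral (cbox (- X) X) (\<lambda>x. h (x + ?e)) = integral (cbox (- X) X) (h \<circ> (+) ?e)"
    by (simp add: o_def add.commute)
  also have "\<dots> = integral (cbox (- X + ?e) (X + ?e)) h"
    by (rule integral_shift_cbox_plus)
  also have "\<dots> = integral (cbox (- X + ?e) (X + ?e) \<inter> {x. x $ i \<le> X $ i}) h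
      + integral (cbox (- X + ?e) (X + ?e) \<inter> {x. x $ i \<ge> X $ i}) h"
    using integral_split[OF int ax(1), of "- X + ?e" "X + ?e" "X $ i"] by (simp add: ax(2))
  also have "cbox (- X + ?e) (X + ?e) \<inter> {x. x $ i \<le> X $ i} = cbox ?l X"
    by (rule set_eqI, unfold Int_iff mem_Collect_eq box) (use s X_pos[of i] in \<open>auto simp: axis_def\<close>)
  also have "cbox (- X + ?e) (X + ?e) \<inter> {x. x $ i \<ge> X $ i}
      = cbox (- X + axis i (2 * X $ i)) (?u + axis i (2 * X $ i))"
    by (rule set_eqI, unfold Int_iff mem_Collect_eq box) (use s X_pos[of i] in \<open>auto simp: axis_def\<close>)
  also have "integral \<dots> h = integral (cbox (- X) ?u) (h \<circ> (+) (axis i (2 * X $ i)))"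
    by (rule integral_shift_cbox_plus[symmetric])
  also have "h \<circ> (+) (axis i (2 * X $ i)) = h"
    using per by (auto simp: periodic_def fun_eq_iff add.commute)
  also have "cbox (- X) ?u = cbox (- X) X \<inter> {x. x $ i \<le> s - X $ i}"
    by (rule set_eqI, unfold Int_iff mem_Collect_eq box) (use s X_pos[of i] in \<open>auto simp: axis_def\<close>)
  also have "cbox ?l X = cbox (- X) X \<inter> {x. x $ i \<ge> s - X $ i}"
    by (rule set_eqI, unfold Int_iff mem_Collect_eq box) (use s X_pos[of i] in \<open>auto simp: axis_def\<close>)
  also have "integral (cbox (- X) X \<inter> {x. x $ i \<ge> s - X $ i}) h
      + integral (cbox (- X) X \<inter> {x. x $ i \<le> s - X $ i}) h = integral (cbox (- X) X) h"
    using integral_split[OF int ax(1), of "- X" X "s - X $ i"] by (simp add: ax(2))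
  finally show ?thesis .
qed

text \<open>The integral of a translate along one axis is constant, and its derivative is the integral of
  the partial derivative.\<close>

lemma integral_partial_eq_0:
  assumes per: "periodic X h" and diff: "\<And>x. h differentiable at x"
    and cont: "continuous_on UNIV (partial i h)"
  shows "(LINT x|torus X. partial i h x) = 0"
proof -
  \<comment> \<open>Translates are compared only for shifts in \<open>?U\<close>, so the derivative
    at 0 is one-sided; it is still unique because 0 is a limit point of \<open>?U\<close>.\<close>
  let ?B = "cbox (- X) X" and ?U = "{0..2 * X $ i}"
  have ch: "continuous_on UNIV h"
    using diff by (simp add: continuous_at_imp_continuous_on differentiable_imp_continuous_within)
  have "((\<lambda>s. integral ?B (\<lambda>x. h (x + s *\<^sub>R axis i 1))) has_field_derivative
      integral ?B (\<lambda>x. partial i h (x + 0 *\<^sub>R axis i 1))) (at 0 within ?U)"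
  proof (rule leibniz_rule_field_derivative)
    show "((\<lambda>s. h (x + s *\<^sub>R axis i 1)) has_field_derivative partial i h (x + s *\<^sub>R axis i 1))
        (at s within ?U)" for s x
      using partial_line[OF diff] has_field_derivative_at_within by blast
    show "(\<lambda>x. h (x + s *\<^sub>R axis i 1)) integrable_on ?B" for s
      by (intro integrable_continuous continuous_on_compose2[OF ch]) (auto intro!: continuous_intros)
    show "continuous_on (?U \<times> ?B) (\<lambda>(s, x). partial i h (x + s *\<^sub>R axis i 1))"
      unfolding case_prod_beta
      by (intro continuous_on_compose2[OF cont]) (auto intro!: continuous_intros)
  qed (use X_pos[of i] in auto)
  moreover have "((\<lambda>s. integral ?B (\<lambda>x. h (x + s *\<^sub>R axis i 1))) has_field_derivative 0) (at 0 within ?U)"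
    by (rule has_field_derivative_transform_within[OF DERIV_const[of "integral ?B h"], of 1])
      (use X_pos[of i] integral_translate[OF ch per, of _ i] in auto)
  moreover have "at (0::real) within ?U \<noteq> bot"
    using X_pos[of i] by (simp add: at_within_Icc_at_right trivial_limit_at_right_real)
  ultimately have "integral ?B (partial i h) = 0"
    unfolding has_field_derivative_iff by (auto dest: tendsto_unique)
  with integral_torus_eq(2)[OF cont] show ?thesis by simp
qed

lemma integral_by_parts:
  assumes "\<psi> \<in> test_functions X" "\<eta> \<in> test_functions X"
  shows "(LINT x|torus X. partial i \<psi> x * \<eta> x) = - (LINT x|torus X. \<psi> x * partial i \<eta> x)"
proof -
  let ?h = "\<lambda>x. \<psi> x * \<eta> x"
  note [continuous_intros] = assms[THEN test_continuous] assms[THEN test_partial, THEN test_continuous]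
  have eq: "partial i ?h = (\<lambda>x. partial i \<psi> x * \<eta> x + \<psi> x * partial i \<eta> x)"
    by (simp add: fun_eq_iff partial_mult assms test_differentiable)
  have "(LINT x|torus X. partial i ?h x) = 0"
  proof (rule integral_partial_eq_0)
    show "periodic X ?h"
      using assms by (simp add: test_functions_def periodic_def)
    show "?h differentiable at x" for x
      by (intro differentiable_mult assms[THEN test_differentiable])
    show "continuous_on UNIV (partial i ?h)"
      unfolding eq by (intro continuous_intros)
  qed
  moreover have "integrable (torus X) (\<lambda>x. partial i \<psi> x * \<eta> x)" "integrable (torus X) (\<lambda>x. \<psi> x * partial i \<eta> x)"
    by (auto intro!: integral_torus_eq(1) continuous_intros)
  ultimately show ?thesis unfolding eq by simp
qed

lemma freq_eq_iff: "freq i m = freq i n \<longleftrightarrow> m i = n i"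
  using X_pos[of i] by (simp add: freq_def)

lemma wave_relation:
  "freq i m * (LINT x|torus X. wave (flip i m) x * wave n x)
    = - freq i n * (LINT x|torus X. wave m x * wave (flip i n) x)"
  using integral_by_parts[OF wave_test wave_test, of i m n]
  by (simp add: partial_wave mult.assoc mult.left_commute[of "wave _ _" "freq _ _"])

text \<open>In a coordinate where the indices differ, moving the derivative across twice gives
  \<open>(freq i m)\<^sup>2 * ?P = (freq i n)\<^sup>2 * ?P\<close>. This decides nothing when
  \<open>n i = - m i\<close>, a sine against a cosine of the same frequency; flipping both then
  leaves the product unchanged, so \<open>?P = ?Q\<close>, and the first relation suffices.\<close>

lemma wave_orthogonal:
  assumes "m \<noteq> n"
  shows "(LINT x|torus X. wave m x * wave n x) = 0"
proof -
  obtain i where i: "m i \<noteq> n i" using assms by auto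
  let ?P = "LINT x|torus X. wave m x * wave n x"
  let ?Q = "LINT x|torus X. wave (flip i m) x * wave (flip i n) x"
  have P: "freq i m * ?P = freq i n * ?Q"
    using wave_relation[of i "flip i m" n] by simp
  have Q: "freq i m * ?Q = freq i n * ?P"
    using wave_relation[of i m "flip i n"] by simp
  show ?thesis
  proof (cases "n i = - m i")
    case True
    have "wave (flip i m) x * wave (flip i n) x = wave m x * wave n x" for x
      using True unfolding wave_def prod.distrib[symmetric]
      by (intro prod.cong) (auto simp: flip_def)
    then have "?P = ?Q" by simp
    then have "(freq i m - freq i n) * ?P = 0" using P by (simp add: algebra_simps)
    moreover have "freq i m \<noteq> freq i n" using i by (simp add: freq_eq_iff)
    ultimately show ?thesis by simp
  next
    case False
    have "(freq i m)\<^sup>2 * ?P = (freq i n)\<^sup>2 * ?P"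
proof -
      have "(freq i m)\<^sup>2 * ?P = freq i m * (freq i n * ?Q)"
        unfolding P[symmetric] by (simp only: power2_eq_square mult.assoc)
      also have "\<dots> = freq i n * (freq i n * ?P)" unfolding Q[symmetric] by (simp only: mult.left_commute)
      finally show ?thesis by (simp only: power2_eq_square mult.assoc)
    qed
    then have "((freq i m - freq i n) * (freq i m + freq i n)) * ?P = 0"
      by (simp add: algebra_simps power2_eq_square)
    moreover have "m i \<noteq> flip i n i" using False by (simp add: flip_def)
    then have "freq i m \<noteq> - freq i n" using freq_eq_iff[of i m "flip i n"] by simp
    moreover have "freq i m \<noteq> freq i n" using i by (simp add: freq_eq_iff)
    ultimately show ?thesis by auto
  qed
qed

section \<open>Normalization of the waves\<close>

lemma torus_finite_measure: "finite_measure (torus X)"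
  unfolding torus_def by (rule finite_measureI) (simp add: emeasure_restrict_space less_imp_neq[OF emeasure_lborel_cbox_finite, unfolded infinity_ennreal_def])

lemma torus_vol_eq: "torus_vol X = measure (torus X) (space (torus X))"
  by (simp add: torus_vol_def torus_def measure_restrict_space)

lemma torus_vol_pos: "0 < torus_vol X"
proof -
  have "torus_vol X = measure lborel (cbox (- X) X)"
    by (simp add: torus_vol_def)
  also have "\<dots> = (\<Prod>i\<in>UNIV. X $ i - (- X) $ i)"
    by (subst content_cbox_cart) (use X_pos in \<open>auto simp: interval_ne_empty_cart intro: less_imp_le\<close>)
  also have "\<dots> > 0" using X_pos by (intro prod_pos) (auto intro: add_pos_pos)
  finally show ?thesis .
qed

definition wave_sqnorm :: "('d \<Rightarrow> int) \<Rightarrow> real" where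
  "wave_sqnorm m = (LINT x|torus X. wave m x * wave m x)"

lemma wave_sqnorm_pos: "0 < wave_sqnorm m"
proof -
  have cont: "continuous_on UNIV (\<lambda>x. wave m x * wave m x)"
    by (intro continuous_intros continuous_wave)
  have nonneg: "0 \<le> wave_sqnorm m"
    unfolding wave_sqnorm_def by (rule integral_nonneg_AE) simp
  have "wave_sqnorm m \<noteq> 0"
  proof
    assume "wave_sqnorm m = 0"
    then have "integral (cbox (- X) X) (\<lambda>x. wave m x * wave m x) = 0"
      using integral_torus_eq(2)[OF cont] by (simp add: wave_sqnorm_def)
    then have "((\<lambda>x. wave m x * wave m x) has_integral 0) (cbox (- X) X)"
      using integrable_continuous[OF continuous_on_subset[OF cont subset_UNIV]] has_integral_integral by metis
    moreover have "box (- X) X \<noteq> {}"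
      using X_pos by (auto simp: interval_ne_empty_cart(2) intro: less_trans[of _ 0])
    ultimately have zero: "wave m x * wave m x = 0" if "x \<in> cbox (- X) X" for x
      using that
      by (intro has_integral_0_cbox_imp_0[where f = "\<lambda>x. wave m x * wave m x", OF continuous_on_subset[OF cont]])
        auto
    text \<open>A quarter period for the sine factors, the origin for the cosine factors.\<close>
    let ?x = "\<chi> i. if m i < 0 then X $ i / (2 * of_int (- m i)) else 0"
    have "?x \<in> cbox (- X) X"
      unfolding mem_box_cart
    proof (intro allI conjI)
      fix i
      show "(- X) $ i \<le> ?x $ i" using X_pos[of i] by (auto simp: divide_le_0_iff intro: order_trans[of _ 0])
      show "?x $ i \<le> X $ i"
      proof (cases "m i < 0")
        case True
        then have "X $ i / (2 * of_int (- m i)) \<le> X $ i / 1"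
          using X_pos[of i] by (intro divide_left_mono) auto
        then show ?thesis using True by simp
      qed (use X_pos[of i] in simp)
    qed
    moreover have "wave m ?x = 1"
      unfolding wave_def
    proof (rule prod.neutral, rule ballI)
      fix i
      show "trig (m i) (pi * ?x $ i / X $ i) = 1"
      proof (cases "m i < 0")
        case True
        then have "- of_int (m i) * (pi * ?x $ i / X $ i) = pi / 2"
          using X_pos[of i] by (simp add: field_simps)
        then show ?thesis using True by (simp only: trig_def) simp
      qed (simp add: trig_def)
    qed
    ultimately show False using zero[of ?x] by simp
  qed
  with nonneg show ?thesis by simp
qed

text \<open>Sine and cosine of the same nonzero frequency are multiples of each other's derivatives,
  so integration by parts equates their norms without computing them. This keeps the normalized
  basis closed under derivatives, up to factors.\<close>

lemma wave_sqnorm_flip: "freq i m \<noteq> 0 \<Longrightarrow> wave_sqnorm (flip i m) = wave_sqnorm m"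
  using wave_relation[of i m "flip i m"] by (simp add: wave_sqnorm_def)

definition basis :: "('d \<Rightarrow> int) \<Rightarrow> real^'d \<Rightarrow> real" where
  "basis m x = 1 / sqrt (wave_sqnorm m) * wave m x"

lemma basis_orthonormal: "L2_inner X (basis m) (basis n) = (if m = n then 1 else 0)"
proof -
  have "L2_inner X (basis m) (basis n)
      = 1 / (sqrt (wave_sqnorm m) * sqrt (wave_sqnorm n)) * (LINT x|torus X. wave m x * wave n x)"
    unfolding L2_inner_def basis_def
    by (subst integral_mult_right_zero[symmetric]) (simp add: mult_ac)
  then show ?thesis
    using wave_orthogonal[of m n] wave_sqnorm_pos[of m] by (auto simp: wave_sqnorm_def)
qed

lemma test_cmult:
  assumes "\<psi> \<in> test_functions X"
  shows "(\<lambda>x. c * \<psi> x) \<in> test_functions X"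
proof -
  have D: "foldr partial is \<psi> differentiable at x" for "is" x
    using assms by (simp add: test_functions_def)
  have "foldr partial is (\<lambda>x. c * \<psi> x) = (\<lambda>x. c * foldr partial is \<psi> x)" for "is"
  proof (induction "is")
    case (Cons i "is")
    have "partial i (\<lambda>x. c * foldr partial is \<psi> x) = (\<lambda>x. c * partial i (foldr partial is \<psi>) x)"
      by (rule ext) (simp add: partial_cmult D)
    then show ?case by (simp add: Cons.IH)
  qed simp
  then show ?thesis using assms D by (simp add: test_functions_def periodic_def)
qed

lemma basis_test: "basis m \<in> test_functions X"
  unfolding basis_def[abs_def] by (intro test_cmult wave_test)

lemma partial_basis: "partial i (basis m) x = - freq i m * basis (flip i m) x"
proof -
  have "partial i (basis m) x = - freq i m * (1 / sqrt (wave_sqnorm m) * wave (flip i m) x)"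
    unfolding basis_def[abs_def] by (subst partial_cmult) (auto simp: differentiable_wave partial_wave)
  then show ?thesis
    by (cases "freq i m = 0") (simp_all add: basis_def wave_sqnorm_flip)
qed

section \<open>Density of trigonometric polynomials\<close>

text \<open>Only the linear span, so that statements linear in the polynomial, such as vanishing
  integrals or the resolvent equation, reduce to single waves; closure under products is proved
  separately.\<close>

inductive_set trig_poly :: "(real^'d \<Rightarrow> real) set" where
  wave: "wave m \<in> trig_poly"
| add: "p \<in> trig_poly \<Longrightarrow> q \<in> trig_poly \<Longrightarrow> (\<lambda>x. p x + q x) \<in> trig_poly"
| cmult: "p \<in> trig_poly \<Longrightarrow> (\<lambda>x. c * p x) \<in> trig_poly"

lemma trig_poly_const: "(\<lambda>x. c) \<in> trig_poly"
  using trig_poly.cmult[OF trig_poly.wave[of "\<lambda>_. 0"], of c] by (simp add: wave_0)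

lemma trig_poly_sum:
  "finite A \<Longrightarrow> (\<And>a. a \<in> A \<Longrightarrow> p a \<in> trig_poly) \<Longrightarrow> (\<lambda>x. \<Sum>a\<in>A. p a x) \<in> trig_poly"
  by (induction A rule: finite_induct) (auto intro: trig_poly_const trig_poly.add)

lemma continuous_trig_poly: "p \<in> trig_poly \<Longrightarrow> continuous_on S p"
proof (induction rule: trig_poly.induct)
  case (wave m)
  show ?case by (rule continuous_wave)
next
  case (add p q)
  show ?case by (rule continuous_on_add[OF add.IH])
next
  case (cmult p c)
  show ?case by (rule continuous_on_mult_left[OF cmult.IH])
qed

text \<open>\<open>trig_mult\<close> alters one coordinate factor at a time, so closure under
  products is built up coordinate by coordinate.\<close>

lemma trig_poly_mult_trig:
  "p \<in> trig_poly \<Longrightarrow> (\<lambda>x. p x * trig k (pi * x $ i / X $ i)) \<in> trig_poly"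
proof (induction rule: trig_poly.induct)
  case (wave m)
  obtain a b c d where eq: "\<forall>t. trig (m i) t * trig k t = c * trig a t + d * trig b t"
    using trig_mult by blast
  have "wave m x * trig k (pi * x $ i / X $ i) = c * wave (m(i := a)) x + d * wave (m(i := b)) x" for x
  proof -
    have rest: "(\<Prod>j\<in>UNIV - {i}. trig ((m(i := a')) j) (pi * x $ j / X $ j))
        = (\<Prod>j\<in>UNIV - {i}. trig (m j) (pi * x $ j / X $ j))" for a'
      by (intro prod.cong) auto
    let ?t = "pi * x $ i / X $ i" and ?R = "\<Prod>j\<in>UNIV - {i}. trig (m j) (pi * x $ j / X $ j)"
    have "trig (m i) ?t * ?R * trig k ?t = (trig (m i) ?t * trig k ?t) * ?R" by simp
    also have "\<dots> = c * (trig a ?t * ?R) + d * (trig b ?t * ?R)" unfolding eq[rule_format] by (simp add: distrib_right)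
    finally show ?thesis unfolding wave_split[of _ x i] rest by simp
  qed
  then show ?case
    using trig_poly.add[OF trig_poly.cmult[OF trig_poly.wave] trig_poly.cmult[OF trig_poly.wave],
        of c "m(i := a)" d "m(i := b)"] by simp
next
  case (add p q)
  then show ?case by (simp add: distrib_right trig_poly.add)
next
  case (cmult p c)
  then show ?case using trig_poly.cmult[OF cmult.IH, of c] by (simp add: mult.assoc)
qed

lemma trig_poly_mult_wave:
  assumes "p \<in> trig_poly"
  shows "(\<lambda>x. p x * wave m x) \<in> trig_poly"
proof -
  have "finite A \<Longrightarrow> (\<lambda>x. p x * (\<Prod>i\<in>A. trig (m i) (pi * x $ i / X $ i))) \<in> trig_poly" for A :: "'d set"
  proof (induction A rule: finite_induct)
    case (insert i A)
    then show ?case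
      using trig_poly_mult_trig[OF insert.IH, of "m i" i] by (simp add: mult_ac)
  qed (use assms in simp)
  from this[of UNIV] show ?thesis by (simp add: wave_def[abs_def])
qed

lemma trig_poly_mult: "p \<in> trig_poly \<Longrightarrow> q \<in> trig_poly \<Longrightarrow> (\<lambda>x. q x * p x) \<in> trig_poly"
proof (induction rule: trig_poly.induct)
  case (wave m)
  then show ?case by (rule trig_poly_mult_wave)
next
  case (add p r)
  then show ?case by (simp add: distrib_left trig_poly.add)
next
  case (cmult p c)
  then show ?case using trig_poly.cmult[of "\<lambda>x. q x * p x" c] by (simp add: mult.left_commute)
qed

text \<open>The embedding of the flat torus as a product of circles. Its coordinates are
  trigonometric polynomials, hence so is every polynomial in them.\<close>

definition cos_sin :: "real^'d \<Rightarrow> (real^'d) \<times> (real^'d)" where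
  "cos_sin x = ((\<chi> i. cos (pi * x $ i / X $ i)), (\<chi> i. sin (pi * x $ i / X $ i)))"

lemma continuous_cos_sin: "continuous_on S cos_sin"
proof -
  have [simp]: "X $ i \<noteq> 0" for i using X_pos[of i] by simp
  show ?thesis unfolding cos_sin_def[abs_def] by (intro continuous_intros) auto
qed

text \<open>Equal sines and cosines make \<open>x $ i - y $ i\<close> a multiple of the period
  \<open>2 * X $ i\<close>, which is also the width of the box; a nonzero multiple leaves only
  opposite faces.\<close>

lemma cos_sin_eq:
  assumes "cos_sin x = cos_sin y" "x \<in> cbox (- X) X" "y \<in> cbox (- X) X"
  shows "x $ i = y $ i \<or> \<bar>x $ i\<bar> = X $ i \<and> \<bar>y $ i\<bar> = X $ i"
proof -
  have "sin (pi * x $ i / X $ i) = sin (pi * y $ i / X $ i) \<and> cos (pi * x $ i / X $ i) = cos (pi * y $ i / X $ i)"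
    using assms(1) by (simp add: cos_sin_def vec_eq_iff)
  then obtain n :: int where "pi * x $ i / X $ i = pi * y $ i / X $ i + 2 * pi * n"
    using sin_cos_eq_iff by blast
  then have "pi * x $ i = pi * (y $ i + 2 * n * X $ i)"
    using X_pos[of i] by (simp add: field_simps)
  then have eq: "x $ i = y $ i + 2 * n * X $ i" by simp
  have b: "- X $ i \<le> x $ i" "x $ i \<le> X $ i" "- X $ i \<le> y $ i" "y $ i \<le> X $ i"
    using assms(2,3) by (auto simp: mem_box_cart)
  consider "n = 0" | "n \<ge> 1" | "n \<le> -1" by linarith
  then show ?thesis
  proof cases
    case 2
    then have "1 * X $ i \<le> n * X $ i"
      using X_pos[of i] by (intro mult_right_mono) auto
    then show ?thesis using eq b by linarith
  next
    case 3
    then have "n * X $ i \<le> (-1) * X $ i"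
      using X_pos[of i] by (intro mult_right_mono) auto
    then show ?thesis using eq b by linarith
  qed (use eq in simp)
qed

lemma polynomial_cos_sin: "real_polynomial_function P \<Longrightarrow> (\<lambda>x. P (cos_sin x)) \<in> trig_poly"
proof (induction rule: real_polynomial_function.induct)
  case (linear P)
  have comp: "(\<lambda>x. cos_sin x \<bullet> b) \<in> trig_poly" if "b \<in> Basis" for b
  proof -
    have "(\<lambda>x. trig k (pi * x $ i / X $ i)) \<in> trig_poly" for k i
      using trig_poly_mult_trig[OF trig_poly_const, of 1 k i] by simp
    from this[of 1] this[of "- 1"]
    have "(\<lambda>x. cos (pi * x $ i / X $ i)) \<in> trig_poly" "(\<lambda>x. sin (pi * x $ i / X $ i)) \<in> trig_poly" for i
      by (simp_all add: trig_def)
    then show ?thesis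
      using that by (auto simp: cos_sin_def Basis_prod_def Basis_vec_def inner_axis)
  qed
  have "P y = (\<Sum>b\<in>Basis. P b * (y \<bullet> b))" for y
  proof -
    have "P y = P (\<Sum>b\<in>Basis. (y \<bullet> b) *\<^sub>R b)" by (simp add: euclidean_representation)
    also have "\<dots> = (\<Sum>b\<in>Basis. P ((y \<bullet> b) *\<^sub>R b))"
      using linear by (simp add: linear_sum bounded_linear.linear)
    also have "\<dots> = (\<Sum>b\<in>Basis. P b * (y \<bullet> b))"
      using linear by (intro sum.cong refl) (simp add: linear_cmul bounded_linear.linear)
    finally show ?thesis .
  qed
  then have "(\<lambda>x. P (cos_sin x)) = (\<lambda>x. \<Sum>b\<in>Basis. P b * (cos_sin x \<bullet> b))"
    by (intro ext)
  then show ?case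
    by (simp only:) (rule trig_poly_sum[OF finite_Basis], rule trig_poly.cmult, rule comp)
next
  case (const c)
  show ?case by (rule trig_poly_const)
next
  case (add p q)
  show ?case by (rule trig_poly.add[OF add.IH])
next
  case (mult p q)
  show ?case by (rule trig_poly_mult[OF mult.IH(2,1)])
qed

text \<open>A function that vanishes on the boundary of the box factors through the quotient map
  \<^term>\<open>cos_sin\<close>, whose image is compact.\<close>

lemma trig_poly_dense:
  assumes cont: "continuous_on (cbox (- X) X) g"
    and bdry: "\<And>x i. x \<in> cbox (- X) X \<Longrightarrow> \<bar>x $ i\<bar> = X $ i \<Longrightarrow> g x = 0"
    and "0 < e"
  obtains p where "p \<in> trig_poly" "\<And>x. x \<in> cbox (- X) X \<Longrightarrow> \<bar>g x - p x\<bar> < e"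
proof -
  let ?B = "cbox (- X) X" and ?K = "cos_sin ` cbox (- X) X"
  define G where "G y = g (SOME x. x \<in> ?B \<and> cos_sin x = y)" for y
  have G: "G (cos_sin x) = g x" if x: "x \<in> ?B" for x
  proof -
    let ?x = "SOME x'. x' \<in> ?B \<and> cos_sin x' = cos_sin x"
    have x': "?x \<in> ?B \<and> cos_sin ?x = cos_sin x"
      by (rule someI[of _ x]) (use x in simp)
    show ?thesis
    proof (cases "?x = x")
      case False
      then obtain i where "?x $ i \<noteq> x $ i" by (auto simp: vec_eq_iff)
      then have "\<bar>?x $ i\<bar> = X $ i" "\<bar>x $ i\<bar> = X $ i" using cos_sin_eq[of ?x x i] x x' by auto
      then show ?thesis using bdry[of ?x i] bdry[of x i] x x' by (simp add: G_def)
    qed (simp add: G_def)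
  qed
  \<comment> \<open>\<open>cos_sin\<close> maps compact sets to compact sets. The preimage of a
    closed set under \<open>G\<close> is the image of its preimage under \<open>g\<close>, and
    therefore closed.\<close>
  have "continuous_on ?K G"
    unfolding continuous_on_closed_invariant
  proof (intro allI impI)
    fix C :: "real set" assume "closed C"
    then have "closed (?B \<inter> g -` C)"
      by (intro continuous_closed_preimage cont) auto
    then have "compact (?B \<inter> g -` C)"
      by (metis Int_lower1 bounded_cbox bounded_subset compact_eq_bounded_closed)
    then have "compact (cos_sin ` (?B \<inter> g -` C))"
      by (intro compact_continuous_image continuous_cos_sin)
    moreover have "cos_sin ` (?B \<inter> g -` C) \<inter> ?K = G -` C \<inter> ?K"
      using G by auto
    ultimately show "\<exists>A. closed A \<and> A \<inter> ?K = G -` C \<inter> ?K"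
      using compact_imp_closed by blast
  qed
  moreover have "compact ?K" by (intro compact_continuous_image continuous_cos_sin) auto
  ultimately obtain P where P: "real_polynomial_function P" "\<And>y. y \<in> ?K \<Longrightarrow> \<bar>G y - P y\<bar> < e"
    using Stone_Weierstrass_real_polynomial_function[OF _ _ \<open>0 < e\<close>] by metis
  have "\<bar>g x - P (cos_sin x)\<bar> < e" if "x \<in> ?B" for x
    using P(2)[of "cos_sin x"] G[OF that] that by auto
  then show ?thesis using that polynomial_cos_sin[OF P(1)] by blast
qed

lemma AE_torus_interior: "AE x in torus X. x \<in> box (- X) X"
proof -
  have "AE x in lebesgue. x \<notin> cbox (- X) X - box (- X) X"
    using negligible_frontier_interval[of "- X" X]
    by (intro AE_not_in) (simp add: negligible_iff_null_sets)
  then show ?thesis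
    unfolding torus_def by (subst AE_restrict_space_iff) (simp, erule eventually_mono, simp)
qed

lemma space_torus: "space (torus X) = cbox (- X) X"
  by (simp add: torus_def)

text \<open>The approximants have to be nonnegative to serve as test functions in the sign
  criterion, and the common bound 2 allows dominated convergence there. They come from continuous
  approximations of the measurable \<open>F\<close>, made to vanish on the boundary so that
  \<open>trig_poly_dense\<close> applies.\<close>

lemma trig_poly_approx:
  assumes meas: "F \<in> borel_measurable (torus X)" and F: "\<And>x. 0 \<le> F x \<and> F x \<le> (1::real)"
  obtains p where "\<And>n. p n \<in> trig_poly"
    "\<And>n x. x \<in> cbox (- X) X \<Longrightarrow> 0 \<le> p n x \<and> p n x \<le> 2"
    "AE x in torus X. (\<lambda>n. p n x) \<longlonglongrightarrow> F x"
proof -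
  let ?B = "cbox (- X) X"
  have "F measurable_on ?B"
    using meas by (subst measurable_on_iff_borel_measurable) (auto simp: torus_def)
  then obtain N g where N: "negligible N" and g: "\<And>n. continuous_on UNIV (g n)"
    and lim: "\<And>x. x \<notin> N \<Longrightarrow> (\<lambda>n. g n x) \<longlonglongrightarrow> (if x \<in> ?B then F x else 0)"
    unfolding measurable_on_def by blast
  \<comment> \<open>\<open>d\<close> is positive inside the box and 0 on its boundary, so
    \<open>min 1 (real n * d x)\<close> is a cutoff that equals 1 at every interior point for large
    \<open>n\<close>. Clamping to the unit interval keeps the limit because \<open>F\<close> takes
    its values there.\<close>
  define d where "d x = (\<Prod>i\<in>UNIV. X $ i - \<bar>x $ i\<bar>)" for x :: "real^'d"
  define h where "h n x = max 0 (min 1 (g n x)) * min 1 (real n * d x)" for n x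
  have d_nonneg: "0 \<le> d x" if "x \<in> ?B" for x
    using that unfolding d_def by (intro prod_nonneg) (auto simp: mem_box_cart abs_le_iff minus_le_iff)
  have "\<exists>q. q \<in> trig_poly \<and> (\<forall>x\<in>?B. \<bar>h n x - q x\<bar> < 1 / (2 * Suc n))" for n
  proof -
    have "continuous_on ?B d"
      unfolding d_def[abs_def] by (intro continuous_intros)
    then have "continuous_on ?B (h n)"
      unfolding h_def[abs_def] by (intro continuous_intros continuous_on_subset[OF g]) auto
    moreover have "h n x = 0" if "\<bar>x $ i\<bar> = X $ i" for x i
    proof -
      have "d x = 0" unfolding d_def using that by (intro prod_zero) (simp, rule bexI[of _ i], simp_all)
      then show ?thesis by (simp add: h_def)
    qed
    ultimately obtain q where "q \<in> trig_poly" "\<And>x. x \<in> ?B \<Longrightarrow> \<bar>h n x - q x\<bar> < 1 / (2 * Suc n)"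
      using trig_poly_dense[of "h n" "1 / (2 * Suc n)"] by auto
    then show ?thesis by blast
  qed
  then obtain q where q: "\<And>n. q n \<in> trig_poly" "\<And>n x. x \<in> ?B \<Longrightarrow> \<bar>h n x - q n x\<bar> < 1 / (2 * Suc n)"
    by metis
  show ?thesis
  proof
    \<comment> \<open>The uniform error of \<open>q n\<close> is below
      \<open>1 / (2 * Suc n)\<close>; adding this number makes the approximant nonnegative and, with
      \<open>h n x \<le> 1\<close>, at most 2.\<close>
    let ?p = "\<lambda>n x. q n x + 1 / (2 * Suc n)"
    show "?p n \<in> trig_poly" for n by (intro trig_poly.add q trig_poly_const)
    show "0 \<le> ?p n x \<and> ?p n x \<le> 2" if x: "x \<in> ?B" for n x
    proof -
      have "0 \<le> h n x" using d_nonneg[OF x] by (simp add: h_def)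
      moreover have "h n x \<le> 1" using d_nonneg[OF x] by (auto simp: h_def intro!: mult_le_one)
      moreover have "1 / (2 * real (Suc n)) \<le> 1 / 2" by (simp add: divide_simps)
      ultimately show ?thesis using q(2)[OF x, of n] by linarith
    qed
    have "AE x in lebesgue. x \<notin> N"
      using N by (simp add: negligible_iff_null_sets AE_not_in)
    then have "AE x in torus X. x \<notin> N"
      unfolding torus_def by (subst AE_restrict_space_iff) (simp, erule eventually_mono, simp)
    then show "AE x in torus X. (\<lambda>n. ?p n x) \<longlonglongrightarrow> F x"
      using AE_torus_interior
    proof eventually_elim
      case (elim x)
      then have x: "x \<in> ?B" using box_subset_cbox by blast
      have "0 < d x"
        using elim(2) unfolding d_def by (intro prod_pos) (auto simp: mem_box_cart abs_less_iff minus_less_iff)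
      then have "eventually (\<lambda>n. 1 \<le> real n * d x) sequentially"
        by real_asymp
      then have "eventually (\<lambda>n. max 0 (min 1 (g n x)) = h n x) sequentially"
        by eventually_elim (simp add: h_def)
      moreover have "(\<lambda>n. max 0 (min 1 (g n x))) \<longlonglongrightarrow> max 0 (min 1 (F x))"
        using lim[OF elim(1)] x by (intro tendsto_intros) simp
      ultimately have "(\<lambda>n. h n x) \<longlonglongrightarrow> F x"
        using F[of x] by (simp add: tendsto_cong)
      moreover have "(\<lambda>n. 1 / (2 * real (Suc n))) \<longlonglongrightarrow> 0" by real_asymp
      moreover have "(\<lambda>n. q n x - h n x) \<longlonglongrightarrow> 0"
        by (rule Lim_null_comparison[OF _ \<open>(\<lambda>n. 1 / (2 * real (Suc n))) \<longlonglongrightarrow> 0\<close>])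
          (use q(2)[OF x] in \<open>auto intro!: always_eventually less_imp_le simp: abs_minus_commute\<close>)
      ultimately have "(\<lambda>n. (q n x - h n x) + h n x + 1 / (2 * real (Suc n))) \<longlonglongrightarrow> 0 + F x + 0"
        by (intro tendsto_add)
      then show ?case by simp
    qed
  qed
qed

text \<open>The test polynomials approximate the indicator of the set where \<open>u\<close> is
  negative. In the limit the integral of \<open>u\<close> over this set is nonnegative, which is
  possible only if the set is null.\<close>

lemma AE_nonneg_of_trig_poly:
  assumes u: "integrable (torus X) u"
    and pos: "\<And>p. p \<in> trig_poly \<Longrightarrow> (\<And>x. x \<in> cbox (- X) X \<Longrightarrow> 0 \<le> p x)
      \<Longrightarrow> 0 \<le> (LINT x|torus X. u x * p x)"
  shows "AE x in torus X. 0 \<le> u x"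
proof -
  have [measurable]: "u \<in> borel_measurable (torus X)" using u by auto
  let ?F = "\<lambda>x. if u x < 0 then 1 else 0 :: real"
  have meas: "?F \<in> borel_measurable (torus X)" by measurable
  have F01: "0 \<le> ?F x \<and> ?F x \<le> 1" for x by simp
  obtain p where p: "\<And>n. p n \<in> trig_poly"
    "\<And>n x. x \<in> cbox (- X) X \<Longrightarrow> 0 \<le> p n x \<and> p n x \<le> 2"
    "AE x in torus X. (\<lambda>n. p n x) \<longlonglongrightarrow> ?F x"
    using trig_poly_approx[OF meas F01] by blast
  have [measurable]: "p n \<in> borel_measurable (torus X)" for n
    using integral_torus_eq(1)[OF continuous_trig_poly[OF p(1)]] by auto
  have "(\<lambda>n. LINT x|torus X. u x * p n x) \<longlonglongrightarrow> (LINT x|torus X. u x * ?F x)"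
  proof (rule integral_dominated_convergence[where w = "\<lambda>x. 2 * \<bar>u x\<bar>"])
    show "AE x in torus X. (\<lambda>n. u x * p n x) \<longlonglongrightarrow> u x * ?F x"
      using p(3) by eventually_elim (intro tendsto_intros)
    show "AE x in torus X. norm (u x * p n x) \<le> 2 * \<bar>u x\<bar>" for n
    proof (rule AE_I2)
      fix x assume "x \<in> space (torus X)"
      then have "\<bar>u x\<bar> * \<bar>p n x\<bar> \<le> \<bar>u x\<bar> * 2"
        using p(2)[of x n] by (intro mult_left_mono) (auto simp: space_torus)
      then show "norm (u x * p n x) \<le> 2 * \<bar>u x\<bar>" by (simp add: abs_mult)
    qed
  qed (use u in auto)
  moreover have "0 \<le> (LINT x|torus X. u x * p n x)" for n
    using p by (intro pos) auto
  ultimately have ge: "0 \<le> (LINT x|torus X. u x * ?F x)"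
    by (intro LIMSEQ_le_const) auto
  have int: "integrable (torus X) (\<lambda>x. - (u x * ?F x))"
    by (rule Bochner_Integration.integrable_bound[OF u]) auto
  have "(LINT x|torus X. - (u x * ?F x)) = 0"
  proof (rule antisym)
    show "(LINT x|torus X. - (u x * ?F x)) \<le> 0" using ge by simp
    show "0 \<le> (LINT x|torus X. - (u x * ?F x))" by (rule integral_nonneg_AE) auto
  qed
  then have "AE x in torus X. - (u x * ?F x) = 0"
    by (subst (asm) integral_nonneg_eq_0_iff_AE[OF int]) auto
  then show ?thesis by eventually_elim (auto split: if_splits)
qed

text \<open>Completeness of the waves: by linearity \<open>u\<close> is orthogonal to all
  trigonometric polynomials, so both \<open>u\<close> and \<open>- u\<close> meet the sign
  criterion.\<close>

lemma AE_0_of_wave: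
  assumes u: "integrable (torus X) u"
    and zero: "\<And>m. (LINT x|torus X. u x * wave m x) = 0"
  shows "AE x in torus X. u x = 0"
proof -
  have [measurable]: "u \<in> borel_measurable (torus X)" using u by auto
  have int: "integrable (torus X) (\<lambda>x. u x * p x)" if p: "p \<in> trig_poly" for p
  proof -
    have "compact (p ` cbox (- X) X)"
      by (intro compact_continuous_image continuous_trig_poly p) auto
    then obtain C where "\<forall>y\<in>p ` cbox (- X) X. norm y \<le> C"
      using compact_imp_bounded bounded_iff by metis
    then have C: "\<And>x. x \<in> cbox (- X) X \<Longrightarrow> \<bar>p x\<bar> \<le> C" by simp
    have [measurable]: "p \<in> borel_measurable (torus X)"
      using integral_torus_eq(1)[OF continuous_trig_poly[OF p]] by auto
    have "integrable (torus X) (\<lambda>x. C * u x)" using u by simp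
    then show ?thesis
    proof (rule Bochner_Integration.integrable_bound)
      show "AE x in torus X. norm (u x * p x) \<le> norm (C * u x)"
      proof (rule AE_I2)
        fix x assume "x \<in> space (torus X)"
        then have "\<bar>p x\<bar> \<le> \<bar>C\<bar>" using C[of x] by (simp add: space_torus)
        then have "\<bar>u x\<bar> * \<bar>p x\<bar> \<le> \<bar>u x\<bar> * \<bar>C\<bar>" by (intro mult_left_mono) auto
        then show "norm (u x * p x) \<le> norm (C * u x)" by (simp add: abs_mult mult.commute)
      qed
    qed measurable
  qed
  have zero': "(LINT x|torus X. u x * p x) = 0" if "p \<in> trig_poly" for p
    using that
  proof (induction rule: trig_poly.induct)
    case (add p q)
    then show ?case using int by (simp add: distrib_left)
  next
    case (cmult p c)
    then show ?case by (simp add: mult.left_commute)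
  qed (rule zero)
  have "AE x in torus X. 0 \<le> u x"
    by (rule AE_nonneg_of_trig_poly[OF u]) (simp add: zero')
  moreover have "AE x in torus X. 0 \<le> - u x"
    by (rule AE_nonneg_of_trig_poly) (use u zero' in auto)
  ultimately show ?thesis by eventually_elim simp
qed

end

section \<open>Fourier series of square integrable functions\<close>

lemma abs_mult_le_sum_squares: "\<bar>a * b\<bar> \<le> a\<^sup>2 + b\<^sup>2" for a b :: real
proof -
  have "2 * (\<bar>a\<bar> * \<bar>b\<bar>) \<le> a\<^sup>2 + b\<^sup>2"
    using sum_squares_bound[of "\<bar>a\<bar>" "\<bar>b\<bar>"] by (simp add: mult.assoc)
  moreover have "0 \<le> \<bar>a\<bar> * \<bar>b\<bar>" by simp
  ultimately show ?thesis unfolding abs_mult by linarith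
qed

context periodic_box
begin

lemma L2_D:
  fixes u :: "real^'d \<Rightarrow> real"
  assumes "u \<in> L2 X"
  shows "periodic X u" "u \<in> borel_measurable (torus X)" "integrable (torus X) (\<lambda>x. (u x)\<^sup>2)"
  using assms by (auto simp: L2_def)

lemma L2_I:
  fixes u :: "real^'d \<Rightarrow> real"
  assumes "periodic X u" "u \<in> borel_measurable (torus X)" "integrable (torus X) (\<lambda>x. (u x)\<^sup>2)"
  shows "u \<in> L2 X"
  using assms by (auto simp: L2_def)

lemma L2_mult_integrable:
  fixes u v :: "real^'d \<Rightarrow> real"
  assumes "u \<in> L2 X" "v \<in> L2 X"
  shows "integrable (torus X) (\<lambda>x. u x * v x)"
proof (rule Bochner_Integration.integrable_bound[where f = "\<lambda>x. (u x)\<^sup>2 + (v x)\<^sup>2"])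
  have [measurable]: "u \<in> borel_measurable (torus X)" "v \<in> borel_measurable (torus X)"
    using assms L2_D by auto
  show "(\<lambda>x. u x * v x) \<in> borel_measurable (torus X)" by measurable
  show "AE x in torus X. norm (u x * v x) \<le> norm ((u x)\<^sup>2 + (v x)\<^sup>2)"
    by (simp add: abs_mult_le_sum_squares)
qed (use assms L2_D in auto)

lemma L2_bounded:
  fixes u :: "real^'d \<Rightarrow> real"
  assumes "periodic X u" "u \<in> borel_measurable (torus X)" "AE x in torus X. \<bar>u x\<bar> \<le> C"
  shows "u \<in> L2 X"
proof (intro L2_I assms)
  interpret finite_measure "torus X" by (rule torus_finite_measure)
  have [measurable]: "u \<in> borel_measurable (torus X)" by fact
  show "integrable (torus X) (\<lambda>x. (u x)\<^sup>2)"
  proof (rule integrable_const_bound)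
    show "AE x in torus X. norm ((u x)\<^sup>2) \<le> C\<^sup>2"
      using assms(3) by eventually_elim (simp add: abs_le_square_iff[symmetric])
  qed measurable
qed

lemma L2_const: "(\<lambda>x. c :: real) \<in> L2 X"
  by (rule L2_bounded[where C = "\<bar>c\<bar>"]) (auto simp: periodic_def)

lemma L2_integrable: "u \<in> L2 X \<Longrightarrow> integrable (torus X) (u :: real^'d \<Rightarrow> real)"
  using L2_mult_integrable[OF _ L2_const[of 1]] by simp

lemma L2_lincomb:
  fixes u v :: "real^'d \<Rightarrow> real"
  assumes "u \<in> L2 X" "v \<in> L2 X"
  shows "(\<lambda>x. a * u x + b * v x) \<in> L2 X"
proof (rule L2_I)
  show "periodic X (\<lambda>x. a * u x + b * v x)"
    using assms[THEN L2_D(1)] by (simp add: periodic_def)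
  show "(\<lambda>x. a * u x + b * v x) \<in> borel_measurable (torus X)"
    using assms[THEN L2_D(2)] by measurable
  have "(a * u x + b * v x)\<^sup>2 = a\<^sup>2 * (u x)\<^sup>2 + (2 * a * b) * (u x * v x) + b\<^sup>2 * (v x)\<^sup>2" for x
    by (simp add: power2_eq_square algebra_simps)
  then show "integrable (torus X) (\<lambda>x. (a * u x + b * v x)\<^sup>2)"
    using assms[THEN L2_D(3)] L2_mult_integrable[OF assms] by simp
qed

lemma L2_add: "u \<in> L2 X \<Longrightarrow> v \<in> L2 X \<Longrightarrow> (\<lambda>x. u x + v x :: real) \<in> L2 X"
  using L2_lincomb[of u v 1 1] by simp

lemma L2_diff: "u \<in> L2 X \<Longrightarrow> v \<in> L2 X \<Longrightarrow> (\<lambda>x. u x - v x :: real) \<in> L2 X"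
  using L2_lincomb[of u v 1 "- 1"] by simp

lemma L2_cmult: "u \<in> L2 X \<Longrightarrow> (\<lambda>x. c * u x :: real) \<in> L2 X"
  using L2_lincomb[of u u c 0] by simp

lemma L2_sum:
  "finite A \<Longrightarrow> (\<And>a. a \<in> A \<Longrightarrow> u a \<in> L2 X) \<Longrightarrow> (\<lambda>x. \<Sum>a\<in>A. u a x :: real) \<in> L2 X"
  by (induction A rule: finite_induct) (auto intro: L2_const L2_add)

lemma test_L2: "\<psi> \<in> test_functions X \<Longrightarrow> \<psi> \<in> L2 X"
proof (rule L2_I)
  assume t: "\<psi> \<in> test_functions X"
  then show "periodic X \<psi>" by (simp add: test_functions_def)
  have "continuous_on UNIV \<psi>" "continuous_on UNIV (\<lambda>x. (\<psi> x)\<^sup>2)"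
    by (intro continuous_intros test_continuous t)+
  then show "\<psi> \<in> borel_measurable (torus X)" "integrable (torus X) (\<lambda>x. (\<psi> x)\<^sup>2)"
    using integral_torus_eq(1) by blast+
qed

lemma basis_L2: "basis m \<in> L2 X"
  by (simp add: test_L2 basis_test)

lemma L2_inner_commute: "L2_inner X u v = L2_inner X v u"
  by (simp add: L2_inner_def mult.commute)

lemma L2_inner_lincomb_left:
  assumes "u \<in> L2 X" "v \<in> L2 X" "w \<in> L2 X"
  shows "L2_inner X (\<lambda>x. a * u x + b * v x) w = a * L2_inner X u w + b * L2_inner X v w"
proof -
  have "(a * u x + b * v x) * w x = a * (u x * w x) + b * (v x * w x)" for x
    by (simp add: algebra_simps)
  then show ?thesis
    unfolding L2_inner_def using assms by (simp add: L2_mult_integrable)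
qed

lemma L2_inner_diff_left:
  "u \<in> L2 X \<Longrightarrow> v \<in> L2 X \<Longrightarrow> w \<in> L2 X \<Longrightarrow>
    L2_inner X (\<lambda>x. u x - v x) w = L2_inner X u w - L2_inner X v w"
  using L2_inner_lincomb_left[of u v w 1 "- 1"] by simp

lemma L2_inner_cmult_left: "L2_inner X (\<lambda>x. c * u x) w = c * L2_inner X u w"
  unfolding L2_inner_def by (simp add: mult.assoc)

lemma L2_inner_sum_left:
  assumes "finite A" "\<And>a. a \<in> A \<Longrightarrow> u a \<in> L2 X" "w \<in> L2 X"
  shows "L2_inner X (\<lambda>x. \<Sum>a\<in>A. u a x) w = (\<Sum>a\<in>A. L2_inner X (u a) w)"
  unfolding L2_inner_def sum_distrib_right
  by (rule Bochner_Integration.integral_sum) (use assms in \<open>auto intro: L2_mult_integrable\<close>)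

lemma L2_inner_nonneg: "0 \<le> L2_inner X u u"
  unfolding L2_inner_def by (rule integral_nonneg_AE) simp

lemma L2_inner_diff_self:
  assumes "u \<in> L2 X" "v \<in> L2 X"
  shows "L2_inner X (\<lambda>x. u x - v x) (\<lambda>x. u x - v x) = L2_inner X u u - 2 * L2_inner X u v + L2_inner X v v"
proof -
  have "(u x - v x) * (u x - v x) = u x * u x - 2 * (u x * v x) + v x * v x" for x
    by (simp add: algebra_simps)
  then show ?thesis unfolding L2_inner_def using assms by (simp add: L2_mult_integrable)
qed

lemma L2_inner_cong_AE:
  assumes "u \<in> L2 X" "u' \<in> L2 X" "v \<in> L2 X" "AE x in torus X. u x = u' x"
  shows "L2_inner X u v = L2_inner X u' v"
  unfolding L2_inner_def
proof (rule integral_cong_AE)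
  show "AE x in torus X. u x * v x = u' x * v x" using assms(4) by eventually_elim simp
qed (use assms(1-3) L2_mult_integrable in blast)+

lemma Cauchy_Schwarz_L2:
  assumes "u \<in> L2 X" "v \<in> L2 X"
  shows "(L2_inner X u v)\<^sup>2 \<le> L2_inner X u u * L2_inner X v v"
proof -
  let ?A = "L2_inner X u u" and ?B = "L2_inner X u v" and ?C = "L2_inner X v v"
  have quad: "0 \<le> ?A - 2 * t * ?B + t\<^sup>2 * ?C" for t
    using L2_inner_nonneg[of "\<lambda>x. u x - t * v x"] L2_inner_diff_self[OF assms(1) L2_cmult[OF assms(2), of t]]
    by (simp add: L2_inner_cmult_left L2_inner_commute[of _ "\<lambda>x. t * v x"] L2_inner_commute[of v u] power2_eq_square)
  show ?thesis
  proof (cases "?C = 0")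
    case True
    have "?B = 0"
    proof (rule ccontr)
      assume "?B \<noteq> 0"
      then show False using quad[of "(?A + 1) / (2 * ?B)"] True by simp
    qed
    then show ?thesis using True by simp
  next
    case False
    then have "0 < ?C" using L2_inner_nonneg[of v] by simp
    then show ?thesis using quad[of "?B / ?C"] by (simp add: power2_eq_square field_simps)
  qed
qed

section \<open>Fourier coefficients, Riesz-Fischer and Parseval\<close>

definition coef :: "(real^'d \<Rightarrow> real) \<Rightarrow> ('d \<Rightarrow> int) \<Rightarrow> real" where
  "coef u m = L2_inner X u (basis m)"

lemma AE_eq_of_coef:
  assumes "u \<in> L2 X" "v \<in> L2 X" "\<And>m. coef u m = coef v m"
  shows "AE x in torus X. u x = v x"
proof -
  have "(LINT x|torus X. (u x - v x) * wave m x) = 0" for m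
  proof -
    have "wave m = (\<lambda>x. sqrt (wave_sqnorm m) * basis m x)"
      using wave_sqnorm_pos[of m] by (simp add: basis_def fun_eq_iff)
    then have "(LINT x|torus X. (u x - v x) * wave m x)
        = sqrt (wave_sqnorm m) * L2_inner X (\<lambda>x. u x - v x) (basis m)"
      unfolding L2_inner_def by (simp add: mult.left_commute)
    also have "L2_inner X (\<lambda>x. u x - v x) (basis m) = 0"
      using assms by (simp add: L2_inner_diff_left basis_L2 coef_def)
    finally show ?thesis by simp
  qed
  then have "AE x in torus X. u x - v x = 0"
    by (intro AE_0_of_wave L2_integrable L2_diff assms)
  then show ?thesis by eventually_elim simp
qed

definition fsum :: "(('d \<Rightarrow> int) \<Rightarrow> real) \<Rightarrow> ('d \<Rightarrow> int) set \<Rightarrow> real^'d \<Rightarrow> real" where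
  "fsum c A x = (\<Sum>m\<in>A. c m * basis m x)"

lemma fsum_L2: "finite A \<Longrightarrow> fsum c A \<in> L2 X"
  unfolding fsum_def[abs_def] by (intro L2_sum L2_cmult basis_L2)

lemma L2_inner_fsum: "finite A \<Longrightarrow> v \<in> L2 X \<Longrightarrow> L2_inner X (fsum c A) v = (\<Sum>m\<in>A. c m * coef v m)"
  unfolding fsum_def[abs_def]
  by (subst L2_inner_sum_left) (auto simp: L2_cmult basis_L2 L2_inner_cmult_left coef_def L2_inner_commute[of v])

lemma coef_fsum: "finite A \<Longrightarrow> coef (fsum c A) m = (if m \<in> A then c m else 0)"
proof -
  have "coef (basis m) m' = (if m' = m then 1 else 0)" for m'
    by (simp add: coef_def basis_orthonormal)
  then show "finite A \<Longrightarrow> ?thesis"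
    unfolding coef_def[of "fsum c A"] by (simp add: L2_inner_fsum basis_L2 if_distrib[of "(*) _"] cong: if_cong)
qed

lemma L2_inner_fsum_fsum:
  assumes "finite A" "finite B"
  shows "L2_inner X (fsum c A) (fsum c B) = (\<Sum>m\<in>A \<inter> B. (c m)\<^sup>2)"
proof -
  have "L2_inner X (fsum c A) (fsum c B) = (\<Sum>m\<in>A. if m \<in> B then (c m)\<^sup>2 else 0)"
    using assms by (auto simp: L2_inner_fsum fsum_L2 coef_fsum power2_eq_square intro!: sum.cong)
  then show ?thesis using assms by (simp add: sum.inter_restrict)
qed

lemma Bessel:
  assumes "u \<in> L2 X" "finite A"
  shows "(\<Sum>m\<in>A. (coef u m)\<^sup>2) \<le> L2_inner X u u"
proof -
  let ?s = "fsum (coef u) A"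
  have "L2_inner X u ?s = (\<Sum>m\<in>A. (coef u m)\<^sup>2)" "L2_inner X ?s ?s = (\<Sum>m\<in>A. (coef u m)\<^sup>2)"
    using assms by (simp_all add: L2_inner_commute[of u] L2_inner_fsum L2_inner_fsum_fsum power2_eq_square)
  then show ?thesis
    using L2_inner_nonneg[of "\<lambda>x. u x - ?s x"] L2_inner_diff_self[OF assms(1) fsum_L2[OF assms(2)], of "coef u"]
    by simp
qed

lemma coef_sq_summable:
  assumes "u \<in> L2 X"
  shows "(\<lambda>m. (coef u m)\<^sup>2) summable_on UNIV"
  by (rule nonneg_bdd_above_summable_on) (use Bessel[OF assms] in \<open>auto intro!: bdd_aboveI2\<close>)

text \<open>Orthogonality makes the partial sums Cauchy in the square norm, hence in the integral
  norm on a finite measure, so a subsequence converges almost everywhere; Fatou's lemma then bounds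
  the distance to the limit by the tail of \<open>c\<close>. Stated for arbitrary \<open>v\<close>,
  the conclusion is already Parseval's identity for \<open>U\<close>.\<close>

lemma Riesz_Fischer_has_sum:
  fixes c :: "('d \<Rightarrow> int) \<Rightarrow> real"
  assumes c: "(\<lambda>m. (c m)\<^sup>2) summable_on UNIV"
  obtains U where "U \<in> L2 X" "\<And>v. v \<in> L2 X \<Longrightarrow> ((\<lambda>m. c m * coef v m) has_sum L2_inner X U v) UNIV"
proof -
  interpret finite_measure "torus X" by (rule torus_finite_measure)
  \<comment> \<open>An exhaustion of the countable index set by finite sets. Every finite set is
    eventually contained in it, so unordered sums may be computed along a sequence, as the
    convergence theorems require.\<close>
  define F :: "nat \<Rightarrow> ('d \<Rightarrow> int) set" where "F n = {m. to_nat m < n}" for n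
  have finF: "finite (F n)" for n
    unfolding F_def using finite_vimageI[OF finite_lessThan inj_to_nat, of n] by (simp add: vimage_def)
  have F_lim: "filterlim F (finite_subsets_at_top UNIV) sequentially"
    unfolding filterlim_finite_subsets_at_top
  proof (intro allI impI)
    fix A :: "('d \<Rightarrow> int) set" assume "finite A \<and> A \<subseteq> UNIV"
    then have "\<And>m. m \<in> A \<Longrightarrow> to_nat m \<le> Max (to_nat ` A)" by simp
    then have "eventually (\<lambda>n. A \<subseteq> F n) sequentially"
      unfolding F_def by (intro eventually_sequentiallyI[of "Suc (Max (to_nat ` A))"]) force
    then show "eventually (\<lambda>n. finite (F n) \<and> A \<subseteq> F n \<and> F n \<subseteq> UNIV) sequentially"
      by eventually_elim (simp add: finF)
  qed
  define s where "s n = fsum c (F n)" for n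
  have sL2: "s n \<in> L2 X" for n by (simp add: s_def fsum_L2 finF)
  define T where "T n = (\<Sum>m\<in>F n. (c m)\<^sup>2)" for n
  have T_mono: "i \<le> j \<Longrightarrow> T i \<le> T j" for i j
    unfolding T_def by (rule sum_mono2[OF finF]) (auto simp: F_def)
  obtain S where S: "T \<longlonglongrightarrow> S"
    using c filterlim_compose[OF _ F_lim] unfolding summable_on_def has_sum_def T_def[abs_def] by blast
  have T_le: "T n \<le> S" for n
    using S T_mono by (intro LIMSEQ_le_const[OF S]) auto
  have norm_diff: "L2_inner X (\<lambda>x. s i x - s j x) (\<lambda>x. s i x - s j x) = \<bar>T i - T j\<bar>" for i j
  proof -
    have "F i \<inter> F j = F (min i j)" by (auto simp: F_def)
    then have "L2_inner X (\<lambda>x. s i x - s j x) (\<lambda>x. s i x - s j x) = T i - 2 * T (min i j) + T j"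
      unfolding L2_inner_diff_self[OF sL2 sL2] by (simp add: s_def L2_inner_fsum_fsum finF T_def)
    then show ?thesis using T_mono[of i j] T_mono[of j i] by (cases "i \<le> j") (auto simp: min_def)
  qed
  have L1: "(LINT x|torus X. norm (s i x - s j x)) \<le> sqrt (\<bar>T i - T j\<bar> * torus_vol X)" for i j
  proof -
    let ?d = "\<lambda>x. \<bar>s i x - s j x\<bar>"
    have d: "?d \<in> L2 X"
      using L2_diff[OF sL2[of i] sL2[of j]]
      by (intro L2_I) (auto simp: periodic_def dest: L2_D)
    have "L2_inner X ?d ?d = \<bar>T i - T j\<bar>"
      unfolding norm_diff[symmetric] L2_inner_def by (simp flip: abs_mult)
    moreover have "L2_inner X (\<lambda>x. 1) (\<lambda>x. 1) = torus_vol X"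
      by (simp add: L2_inner_def torus_vol_eq)
    ultimately have "(L2_inner X ?d (\<lambda>x. 1))\<^sup>2 \<le> \<bar>T i - T j\<bar> * torus_vol X"
      using Cauchy_Schwarz_L2[OF d L2_const[of 1]] by simp
    then show ?thesis by (simp add: L2_inner_def real_le_rsqrt)
  qed
  have cauchy: "\<exists>N. \<forall>i\<ge>N. \<forall>j\<ge>N. (LINT x|torus X. norm (s i x - s j x)) < e" if "0 < e" for e
  proof -
    have "0 < e\<^sup>2 / torus_vol X" using that torus_vol_pos by simp
    moreover have "Cauchy T" using S LIMSEQ_imp_Cauchy by blast
    ultimately obtain N where N: "\<And>i j. i \<ge> N \<Longrightarrow> j \<ge> N \<Longrightarrow> \<bar>T i - T j\<bar> < e\<^sup>2 / torus_vol X"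
      unfolding Cauchy_def dist_real_def by blast
    have "(LINT x|torus X. norm (s i x - s j x)) < e" if "i \<ge> N" "j \<ge> N" for i j
    proof -
      have "\<bar>T i - T j\<bar> * torus_vol X < e\<^sup>2"
        using N[OF that] torus_vol_pos by (simp add: field_simps)
      then have "sqrt (\<bar>T i - T j\<bar> * torus_vol X) < e"
        using \<open>0 < e\<close> by (intro real_less_lsqrt) auto
      then show ?thesis using L1[of i j] by linarith
    qed
    then show ?thesis by blast
  qed
  obtain r where r: "strict_mono r" "AE x in torus X. Cauchy (\<lambda>i. s (r i) x)"
    using cauchy_L1_AE_cauchy_subseq[OF L2_integrable[OF sL2] cauchy] by blast
  \<comment> \<open>Taking \<open>lim\<close> at every point, convergent or not, keeps
    \<open>U\<close> exactly periodic: equal sequences have equal \<open>lim\<close>. Membership in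
    \<open>L2\<close> demands periodicity everywhere, not almost everywhere.\<close>
  define U where "U x = lim (\<lambda>i. s (r i) x)" for x
  have [measurable]: "s n \<in> borel_measurable (torus X)" for n using sL2 L2_D by auto
  have [measurable]: "U \<in> borel_measurable (torus X)"
    unfolding U_def[abs_def] by measurable
  have lim: "AE x in torus X. (\<lambda>i. s (r i) x) \<longlonglongrightarrow> U x"
    using r(2) by eventually_elim (simp add: U_def Cauchy_convergent convergent_LIMSEQ_iff[symmetric])
  have perU: "periodic X U"
    using L2_D(1)[OF sL2] unfolding periodic_def U_def by simp
  \<comment> \<open>Since \<open>i \<le> r i\<close>, for \<open>i\<close> beyond \<open>n\<close>
    the squared distance is \<open>T (r i) - T n\<close>, which is at most the tail
    \<open>S - T n\<close>.\<close>
  have Fatou: "(\<integral>\<^sup>+x. ennreal ((U x - s n x)\<^sup>2) \<partial>torus X) \<le> ennreal (S - T n)" for n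
  proof -
    have "(\<integral>\<^sup>+x. ennreal ((U x - s n x)\<^sup>2) \<partial>torus X)
        = (\<integral>\<^sup>+x. liminf (\<lambda>i. ennreal ((s (r i) x - s n x)\<^sup>2)) \<partial>torus X)"
    proof (rule nn_integral_cong_AE)
      show "AE x in torus X. ennreal ((U x - s n x)\<^sup>2) = liminf (\<lambda>i. ennreal ((s (r i) x - s n x)\<^sup>2))"
        using lim
      proof eventually_elim
        case (elim x)
        then have "(\<lambda>i. ennreal ((s (r i) x - s n x)\<^sup>2)) \<longlonglongrightarrow> ennreal ((U x - s n x)\<^sup>2)"
          by (intro tendsto_ennrealI tendsto_intros)
        then show ?case by (rule lim_imp_Liminf[OF sequentially_bot, symmetric])
      qed
    qed
    also have "\<dots> \<le> liminf (\<lambda>i. \<integral>\<^sup>+x. ennreal ((s (r i) x - s n x)\<^sup>2) \<partial>torus X)"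
      by (rule nn_integral_liminf) measurable
    also have "\<dots> \<le> ennreal (S - T n)"
    proof (rule Liminf_le)
      show "eventually (\<lambda>i. (\<integral>\<^sup>+x. ennreal ((s (r i) x - s n x)\<^sup>2) \<partial>torus X) \<le> ennreal (S - T n)) sequentially"
      proof (rule eventually_sequentiallyI[of n])
        fix i assume "n \<le> i"
        then have "n \<le> r i" using seq_suble[OF r(1), of i] by linarith
        have "(\<integral>\<^sup>+x. ennreal ((s (r i) x - s n x)\<^sup>2) \<partial>torus X) = ennreal (LINT x|torus X. (s (r i) x - s n x)\<^sup>2)"
          by (rule nn_integral_eq_integral) (use L2_D(3)[OF L2_diff[OF sL2 sL2]] in auto)
        also have "(LINT x|torus X. (s (r i) x - s n x)\<^sup>2) = \<bar>T (r i) - T n\<bar>"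
          using norm_diff[of "r i" n] by (simp add: L2_inner_def power2_eq_square)
        also have "\<dots> \<le> S - T n" using T_mono[OF \<open>n \<le> r i\<close>] T_le[of "r i"] by simp
        finally show "(\<integral>\<^sup>+x. ennreal ((s (r i) x - s n x)\<^sup>2) \<partial>torus X) \<le> ennreal (S - T n)"
          by (simp add: ennreal_leI)
      qed
    qed simp
    finally show ?thesis .
  qed
  have diffL2: "(\<lambda>x. U x - s n x) \<in> L2 X" for n
  proof (rule L2_I)
    show "periodic X (\<lambda>x. U x - s n x)" using perU L2_D(1)[OF sL2[of n]] by (simp add: periodic_def)
    show "integrable (torus X) (\<lambda>x. (U x - s n x)\<^sup>2)"
      by (rule integrableI_bounded) (use Fatou[of n] in \<open>auto simp: le_less_trans\<close>)
  qed measurable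
  have UL2: "U \<in> L2 X" using L2_add[OF diffL2[of 0] sL2[of 0]] by simp
  have tail: "L2_inner X (\<lambda>x. U x - s n x) (\<lambda>x. U x - s n x) \<le> S - T n" for n
  proof -
    have "ennreal (LINT x|torus X. (U x - s n x)\<^sup>2) = (\<integral>\<^sup>+x. ennreal ((U x - s n x)\<^sup>2) \<partial>torus X)"
      by (rule nn_integral_eq_integral[symmetric]) (use L2_D(3)[OF diffL2[of n]] in auto)
    then have "ennreal (LINT x|torus X. (U x - s n x)\<^sup>2) \<le> ennreal (S - T n)"
      using Fatou[of n] by simp
    then show ?thesis using T_le[of n] by (simp add: L2_inner_def power2_eq_square)
  qed
  have "((\<lambda>m. c m * coef v m) has_sum L2_inner X U v) UNIV" if v: "v \<in> L2 X" for v
  proof -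
    have "(\<lambda>m. norm (c m * coef v m)) summable_on UNIV"
    proof (rule summable_on_comparison_test)
      show "(\<lambda>m. (c m)\<^sup>2 + (coef v m)\<^sup>2) summable_on UNIV"
        by (intro summable_on_add c coef_sq_summable v)
      show "norm (c m * coef v m) \<le> (c m)\<^sup>2 + (coef v m)\<^sup>2" for m
        by (simp add: abs_mult_le_sum_squares)
    qed simp
    then have "(\<lambda>m. c m * coef v m) summable_on UNIV"
      by (rule Infinite_Sum.abs_summable_summable)
    then obtain L where L: "((\<lambda>m. c m * coef v m) has_sum L) UNIV" by (auto simp: summable_on_def)
    then have "(\<lambda>n. \<Sum>m\<in>F n. c m * coef v m) \<longlonglongrightarrow> L"
      unfolding has_sum_def by (rule filterlim_compose[OF _ F_lim])
    then have 1: "(\<lambda>n. L2_inner X (s n) v) \<longlonglongrightarrow> L"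
      by (simp add: s_def L2_inner_fsum finF v)
    \<comment> \<open>Cauchy-Schwarz turns the tail bound into convergence of the pairings with
      \<open>v\<close>.\<close>
    have "(\<lambda>n. L2_inner X U v - L2_inner X (s n) v) \<longlonglongrightarrow> 0"
    proof (rule Lim_null_comparison)
      show "eventually (\<lambda>n. norm (L2_inner X U v - L2_inner X (s n) v)
          \<le> sqrt ((S - T n) * L2_inner X v v)) sequentially"
      proof (rule always_eventually, rule allI)
        fix n
        have "(L2_inner X U v - L2_inner X (s n) v)\<^sup>2
            \<le> L2_inner X (\<lambda>x. U x - s n x) (\<lambda>x. U x - s n x) * L2_inner X v v"
          using Cauchy_Schwarz_L2[OF diffL2 v, of n] by (simp add: L2_inner_diff_left UL2 sL2 v)
        also have "\<dots> \<le> (S - T n) * L2_inner X v v"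
          by (intro mult_right_mono tail L2_inner_nonneg)
        finally show "norm (L2_inner X U v - L2_inner X (s n) v) \<le> sqrt ((S - T n) * L2_inner X v v)"
          by (simp add: real_le_rsqrt)
      qed
      have "(\<lambda>n. sqrt ((S - T n) * L2_inner X v v)) \<longlonglongrightarrow> sqrt ((S - S) * L2_inner X v v)"
        by (intro tendsto_intros S)
      then show "(\<lambda>n. sqrt ((S - T n) * L2_inner X v v)) \<longlonglongrightarrow> 0" by simp
    qed
    then have "(\<lambda>n. L2_inner X U v - (L2_inner X U v - L2_inner X (s n) v)) \<longlonglongrightarrow> L2_inner X U v - 0"
      by (intro tendsto_intros)
    then have "L = L2_inner X U v" using 1 LIMSEQ_unique by fastforce
    with L show ?thesis by simp
  qed
  with UL2 show ?thesis using that by blast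
qed

lemma Riesz_Fischer:
  assumes c: "(\<lambda>m. (c m)\<^sup>2) summable_on UNIV"
  obtains U where "U \<in> L2 X" "\<And>m. coef U m = c m"
    "\<And>v. v \<in> L2 X \<Longrightarrow> ((\<lambda>m. c m * coef v m) has_sum L2_inner X U v) UNIV"
proof -
  obtain U where U: "U \<in> L2 X" "\<And>v. v \<in> L2 X \<Longrightarrow> ((\<lambda>m. c m * coef v m) has_sum L2_inner X U v) UNIV"
    using Riesz_Fischer_has_sum[OF c] by blast
  have "coef U m = c m" for m
  proof -
    have "((\<lambda>m'. c m' * coef (basis m) m') has_sum coef U m) UNIV"
      using U(2)[OF basis_L2] by (simp add: coef_def)
    moreover have "((\<lambda>m'. c m' * coef (basis m) m') has_sum c m) UNIV"
      by (rule has_sum_finite_neutralI[of "{m}"]) (auto simp: coef_def basis_orthonormal)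
    ultimately show ?thesis using has_sum_unique by blast
  qed
  then show ?thesis using that U by blast
qed

corollary Riesz_Fischer_ex:
  assumes "(\<lambda>m. (c m)\<^sup>2) summable_on UNIV"
  shows "\<exists>U. U \<in> L2 X \<and> (\<forall>m. coef U m = c m)"
  by (rule Riesz_Fischer[OF assms]) blast

text \<open>The function that Riesz-Fischer builds from the coefficients of \<open>u\<close> has
  those coefficients, so completeness identifies it with \<open>u\<close> almost everywhere.\<close>

theorem Parseval:
  assumes "u \<in> L2 X" "v \<in> L2 X"
  shows "((\<lambda>m. coef u m * coef v m) has_sum L2_inner X u v) UNIV"
proof -
  obtain U where U: "U \<in> L2 X" "\<And>m. coef U m = coef u m"
    "((\<lambda>m. coef u m * coef v m) has_sum L2_inner X U v) UNIV"
    using Riesz_Fischer[OF coef_sq_summable[OF assms(1)]] assms(2) by metis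
  have "L2_inner X U v = L2_inner X u v"
    by (intro L2_inner_cong_AE AE_eq_of_coef U assms)
  with U show ?thesis by simp
qed

end

section \<open>The inverse Laplacian and weak derivatives\<close>

lemma has_sum_sum:
  fixes h :: "'i \<Rightarrow> 'a \<Rightarrow> real"
  assumes "finite I" "\<And>i. i \<in> I \<Longrightarrow> (h i has_sum s i) A"
  shows "((\<lambda>x. \<Sum>i\<in>I. h i x) has_sum (\<Sum>i\<in>I. s i)) A"
  using assms by (induction I rule: finite_induct) (simp_all add: has_sum_add)

lemma integral_mult_cmult: "(LINT x|M. u x * (c * v x)) = c * (LINT x|M. u x * v x)" for c :: real
  by (simp add: mult.left_commute[of _ c])

context periodic_box
begin

lemma coef_lincomb:
  "u \<in> L2 X \<Longrightarrow> v \<in> L2 X \<Longrightarrow> coef (\<lambda>x. a * u x + b * v x) m = a * coef u m + b * coef v m"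
  by (simp add: coef_def L2_inner_lincomb_left basis_L2)

lemma coef_diff: "u \<in> L2 X \<Longrightarrow> v \<in> L2 X \<Longrightarrow> coef (\<lambda>x. u x - v x) m = coef u m - coef v m"
  by (simp add: coef_def L2_inner_diff_left basis_L2)

lemma coef_cmult: "coef (\<lambda>x. c * u x) m = c * coef u m"
  by (simp add: coef_def L2_inner_cmult_left)

lemma integral_eq_coef: "(LINT x|torus X. u x) = sqrt (wave_sqnorm (\<lambda>_. 0)) * coef u (\<lambda>_. 0)"
proof -
  have "coef u (\<lambda>_. 0) = (LINT x|torus X. u x) / sqrt (wave_sqnorm (\<lambda>_. 0))"
    by (simp add: coef_def L2_inner_def basis_def wave_0)
  then show ?thesis using wave_sqnorm_pos[of "\<lambda>_. 0"] by simp
qed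

lemma coef_const:
  assumes "m \<noteq> (\<lambda>_. 0)"
  shows "coef (\<lambda>_. c) m = 0"
proof -
  have "coef (\<lambda>_. c) m = c * sqrt (wave_sqnorm (\<lambda>_. 0)) * coef (basis (\<lambda>_. 0)) m"
    unfolding coef_cmult[symmetric] using wave_sqnorm_pos[of "\<lambda>_. 0"]
    by (simp add: basis_def[abs_def] wave_0)
  then show ?thesis using assms by (simp add: coef_def basis_orthonormal)
qed

lemma coef_partial:
  assumes "\<psi> \<in> test_functions X"
  shows "coef (partial i \<psi>) m = freq i m * coef \<psi> (flip i m)"
proof -
  have "coef (partial i \<psi>) m = - (LINT x|torus X. \<psi> x * (- freq i m * basis (flip i m) x))"
    unfolding coef_def L2_inner_def by (simp only: integral_by_parts[OF assms basis_test] partial_basis)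
  also have "\<dots> = freq i m * coef \<psi> (flip i m)"
    unfolding coef_def L2_inner_def integral_mult_cmult by simp
  finally show ?thesis .
qed

lemma laplacian_L2: "\<psi> \<in> test_functions X \<Longrightarrow> laplacian \<psi> \<in> L2 X"
  unfolding laplacian_def[abs_def] by (intro L2_sum test_L2 test_partial) auto

lemma coef_laplacian:
  assumes "\<psi> \<in> test_functions X"
  shows "coef (laplacian \<psi>) m = - lam m * coef \<psi> m"
proof -
  have "coef (laplacian \<psi>) m = (\<Sum>i\<in>UNIV. coef (partial i (partial i \<psi>)) m)"
    unfolding coef_def laplacian_def[abs_def]
    by (rule L2_inner_sum_left) (use assms in \<open>auto intro: test_L2 test_partial basis_L2\<close>)
  also have "\<dots> = (\<Sum>i\<in>UNIV. - (freq i m)\<^sup>2 * coef \<psi> m)"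
    by (simp add: coef_partial assms test_partial power2_eq_square mult.assoc)
  finally show ?thesis by (simp add: lam_def sum_distrib_right sum_negf)
qed

lemma laplacian_basis: "laplacian (basis m) x = - lam m * basis m x"
proof -
  have "partial i (partial i (basis m)) x = - (freq i m)\<^sup>2 * basis m x" for i
  proof -
    have "partial i (basis m) = (\<lambda>x. - freq i m * basis (flip i m) x)"
      by (rule ext) (rule partial_basis)
    then have "partial i (partial i (basis m)) x = - freq i m * partial i (basis (flip i m)) x"
      by (simp only:) (rule partial_cmult, rule test_differentiable, rule basis_test)
    then show ?thesis by (simp add: partial_basis power2_eq_square)
  qed
  then show ?thesis by (simp add: laplacian_def lam_def sum_distrib_right sum_negf)
qed

lemma weak_laplacian_coef:
  assumes "has_weak_laplacian X u w"
  shows "coef w m = - lam m * coef u m"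
proof -
  have "coef w m = L2_inner X u (laplacian (basis m))"
    using assms basis_test unfolding has_weak_laplacian_def coef_def by simp
  also have "\<dots> = - lam m * coef u m"
    unfolding coef_def L2_inner_def laplacian_basis integral_mult_cmult by simp
  finally show ?thesis .
qed

text \<open>Parseval extends the identity from the basis functions to all test functions. With
  \<open>weak_laplacian_coef\<close>, having a weak Laplacian becomes a statement about
  coefficients.\<close>

lemma weak_laplacianI:
  assumes "u \<in> L2 X" "w \<in> L2 X" "\<And>m. coef w m = - lam m * coef u m"
  shows "has_weak_laplacian X u w"
  unfolding has_weak_laplacian_def
proof (intro conjI ballI assms)
  fix \<psi> assume \<psi>: "\<psi> \<in> test_functions X"
  have "((\<lambda>m. coef u m * coef (laplacian \<psi>) m) has_sum L2_inner X u (laplacian \<psi>)) UNIV"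
    by (intro Parseval assms laplacian_L2 \<psi>)
  moreover have "((\<lambda>m. coef w m * coef \<psi> m) has_sum L2_inner X w \<psi>) UNIV"
    by (intro Parseval assms test_L2 \<psi>)
  moreover have "coef u m * coef (laplacian \<psi>) m = coef w m * coef \<psi> m" for m
    by (simp add: assms(3) coef_laplacian[OF \<psi>])
  ultimately show "L2_inner X u (laplacian \<psi>) = L2_inner X w \<psi>"
    by (simp add: has_sum_unique)
qed

text \<open>A spectral gap uniform in \<open>m\<close>: some coordinate of a nonzero
  \<open>m\<close> has size at least 1, and the sum is a bound whichever coordinate that is.\<close>

lemma inverse_lam_le: "1 / lam m \<le> (\<Sum>i\<in>UNIV. (X $ i / pi)\<^sup>2)"
proof (cases "m = (\<lambda>_. 0)")
  case True
  then show ?thesis using lam_eq_0_iff[of m] by (simp add: sum_nonneg)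
next
  case False
  then obtain i where i: "m i \<noteq> 0" by auto
  have "(1::real) \<le> (of_int (m i))\<^sup>2"
    using i by (metis int_one_le_iff_zero_less of_int_1_le_iff of_int_power zero_less_power2)
  then have "(pi / X $ i)\<^sup>2 * 1 \<le> (pi / X $ i)\<^sup>2 * (of_int (m i))\<^sup>2"
    by (intro mult_left_mono) auto
  also have "\<dots> = (freq i m)\<^sup>2" by (simp add: freq_def power_mult_distrib power_divide)
  also have "\<dots> \<le> lam m" unfolding lam_def by (rule member_le_sum) auto
  finally have le: "(pi / X $ i)\<^sup>2 \<le> lam m" by simp
  have pos: "0 < (pi / X $ i)\<^sup>2" using X_pos[of i] by simp
  have "1 / lam m \<le> 1 / (pi / X $ i)\<^sup>2"
    using le pos less_le_trans[OF pos le] by (intro divide_left_mono mult_pos_pos) auto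
  also have "\<dots> = (X $ i / pi)\<^sup>2" by (simp add: power_divide)
  also have "\<dots> \<le> (\<Sum>i\<in>UNIV. (X $ i / pi)\<^sup>2)" by (rule member_le_sum) auto
  finally show ?thesis .
qed

lemma multiplier_exists:
  assumes "g \<in> L2 X" "\<And>m. (b m)\<^sup>2 \<le> C"
  shows "\<exists>U. U \<in> L2 X \<and> (\<forall>m. coef U m = b m * coef g m)"
proof -
  have "(\<lambda>m. (b m * coef g m)\<^sup>2) summable_on UNIV"
  proof (rule summable_on_comparison_test)
    show "(\<lambda>m. C * (coef g m)\<^sup>2) summable_on UNIV"
      by (intro summable_on_cmult_right coef_sq_summable assms)
    show "(b m * coef g m)\<^sup>2 \<le> C * (coef g m)\<^sup>2" for m
      unfolding power_mult_distrib by (intro mult_right_mono assms) auto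
  qed auto
  then show ?thesis by (rule Riesz_Fischer_ex)
qed

lemma inv_lap_exists:
  assumes g: "g \<in> L2 X"
  shows "\<exists>u. (LINT x|torus X. u x) = 0 \<and>
     has_weak_laplacian X u (\<lambda>x. - (g x - (LINT y|torus X. g y) / torus_vol X))"
proof -
  have "\<exists>u. u \<in> L2 X \<and> (\<forall>m. coef u m = (1 / lam m) * coef g m)"
  proof (rule multiplier_exists[OF g])
    show "(1 / lam m)\<^sup>2 \<le> (\<Sum>i\<in>UNIV. (X $ i / pi)\<^sup>2)\<^sup>2" for m
      using inverse_lam_le[of m] lam_nonneg[of m] by (intro power_mono) auto
  qed
  then obtain u where u: "u \<in> L2 X" "\<And>m. coef u m = (1 / lam m) * coef g m" by blast
  let ?a = "(LINT y|torus X. g y) / torus_vol X"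
  let ?w = "\<lambda>x. (- 1) * (g x - ?a)"
  have w: "?w \<in> L2 X" by (intro L2_cmult L2_diff g L2_const)
  have zero: "(LINT x|torus X. u x) = 0"
    using lam_eq_0_iff[of "\<lambda>_. 0"] by (simp add: integral_eq_coef u)
  \<comment> \<open>Subtracting the mean matters at the zero mode, where \<open>lam\<close> vanishes
    and the equation demands coefficient 0. At every other mode a constant has coefficient
    0.\<close>
  have "(LINT x|torus X. g x - ?a) = 0"
    using torus_vol_pos L2_integrable[OF g] L2_integrable[OF L2_const, of ?a] by (simp add: torus_vol_eq)
  then have "coef (\<lambda>x. g x - ?a) (\<lambda>_. 0) = 0"
    using integral_eq_coef[of "\<lambda>x. g x - ?a"] wave_sqnorm_pos[of "\<lambda>_. 0"] by simp
  then have "coef ?w m = - lam m * coef u m" for m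
    using lam_eq_0_iff[of m]
    by (cases "m = (\<lambda>_. 0)") (auto simp: coef_cmult coef_diff g L2_const coef_const u simp del: mult_minus1)
  then have "has_weak_laplacian X u ?w" by (intro weak_laplacianI u w)
  then show ?thesis using zero by (intro exI[of _ u]) simp
qed

text \<open>For \<open>m = 0\<close> both sides vanish, since \<open>lam m = 0\<close> and \<open>x / 0 = 0\<close>.\<close>

lemma inv_lap:
  assumes g: "g \<in> L2 X"
  shows inv_lap_L2: "inv_lap X g \<in> L2 X" and coef_inv_lap: "coef (inv_lap X g) m = coef g m / lam m"
proof -
  let ?u = "inv_lap X g" and ?a = "(LINT y|torus X. g y) / torus_vol X"
  have u: "(LINT x|torus X. ?u x) = 0" "has_weak_laplacian X ?u (\<lambda>x. - (g x - ?a))"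
    using someI_ex[OF inv_lap_exists[OF g]] unfolding inv_lap_def by auto
  show "?u \<in> L2 X" using u(2) by (simp add: has_weak_laplacian_def)
  show "coef ?u m = coef g m / lam m"
  proof (cases "m = (\<lambda>_. 0)")
    case True
    then show ?thesis
      using u(1) lam_eq_0_iff[of m] wave_sqnorm_pos[of m] by (simp add: integral_eq_coef)
  next
    case False
    have "- lam m * coef ?u m = coef (\<lambda>x. (- 1) * (g x - ?a)) m"
      using weak_laplacian_coef[OF u(2), of m] by simp
    also have "\<dots> = - coef g m"
      unfolding coef_cmult using False by (simp add: coef_diff g L2_const coef_const)
    finally show ?thesis using False lam_eq_0_iff[of m] by (simp add: field_simps)
  qed
qed

text \<open>Makes the choice in \<open>inv_sqrt_lap\<close> meaningful. The multiplier is
  \<open>1 / sqrt (lam m)\<close>, which is 0 at the constant mode because \<open>x / 0 = 0\<close>,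
  in agreement with the zero mean of the inverse Laplacian.\<close>

lemma nonneg_sqrt_exists: "\<exists>S. nonneg_sqrt_of X (inv_lap X) S"
proof -
  have "\<exists>u. u \<in> L2 X \<and> (\<forall>m. coef u m = (1 / sqrt (lam m)) * coef g m)" if "g \<in> L2 X" for g
  proof (rule multiplier_exists[OF that])
    show "(1 / sqrt (lam m))\<^sup>2 \<le> (\<Sum>i\<in>UNIV. (X $ i / pi)\<^sup>2)" for m
      using inverse_lam_le[of m] lam_nonneg[of m] by (simp add: power_divide)
  qed
  then obtain S where S: "\<And>g. g \<in> L2 X \<Longrightarrow> S g \<in> L2 X"
    and coefS: "\<And>g m. g \<in> L2 X \<Longrightarrow> coef (S g) m = (1 / sqrt (lam m)) * coef g m"
    by metis
  have "nonneg_sqrt_of X (inv_lap X) S"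
    unfolding nonneg_sqrt_of_def
  proof (intro conjI ballI allI)
    fix g h :: "real^'d \<Rightarrow> real" and a b assume g: "g \<in> L2 X" and h: "h \<in> L2 X"
    show "AE x in torus X. S (\<lambda>y. a * g y + b * h y) x = a * S g x + b * S h x"
      by (rule AE_eq_of_coef)
        (simp_all add: S coefS coef_lincomb L2_lincomb g h algebra_simps)
  next
    fix g h :: "real^'d \<Rightarrow> real" assume g: "g \<in> L2 X" and h: "h \<in> L2 X"
    have "((\<lambda>m. coef (S g) m * coef h m) has_sum L2_inner X (S g) h) UNIV"
      "((\<lambda>m. coef g m * coef (S h) m) has_sum L2_inner X g (S h)) UNIV"
      by (intro Parseval S g h)+
    then show "L2_inner X (S g) h = L2_inner X g (S h)"
      by (simp add: coefS g h has_sum_unique)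
  next
    fix g :: "real^'d \<Rightarrow> real" assume g: "g \<in> L2 X"
    have "((\<lambda>m. coef (S g) m * coef g m) has_sum L2_inner X (S g) g) UNIV"
      by (intro Parseval S g)
    then show "0 \<le> L2_inner X (S g) g"
      by (rule has_sum_nonneg) (simp add: coefS g lam_nonneg)
    show "AE x in torus X. S (S g) x = inv_lap X g x"
      by (rule AE_eq_of_coef)
        (simp_all add: S coefS g inv_lap_L2 coef_inv_lap lam_nonneg)
  qed (rule S)
  then show ?thesis by blast
qed

text \<open>Rests on symmetry and on \<open>S (S g) = inv_lap X g\<close> almost everywhere, so it
  holds for every admissible choice of the root.\<close>

lemma integral_inv_sqrt_lap:
  assumes g: "g \<in> L2 X"
  shows "(LINT x|torus X. \<bar>inv_sqrt_lap X g x\<bar>\<^sup>2) = L2_inner X (inv_lap X g) g"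
proof -
  let ?S = "inv_sqrt_lap X"
  have S: "nonneg_sqrt_of X (inv_lap X) ?S"
    unfolding inv_sqrt_lap_def by (rule someI_ex[OF nonneg_sqrt_exists])
  have Sg: "?S g \<in> L2 X" "?S (?S g) \<in> L2 X" using S g by (auto simp: nonneg_sqrt_of_def)
  have "(LINT x|torus X. \<bar>?S g x\<bar>\<^sup>2) = L2_inner X (?S g) (?S g)"
    by (simp add: L2_inner_def power2_eq_square)
  also have "\<dots> = L2_inner X g (?S (?S g))" using S g Sg by (simp add: nonneg_sqrt_of_def)
  also have "\<dots> = L2_inner X (?S (?S g)) g" by (rule L2_inner_commute)
  also have "\<dots> = L2_inner X (inv_lap X g) g"
    by (rule L2_inner_cong_AE) (use S g Sg inv_lap_L2 in \<open>auto simp: nonneg_sqrt_of_def\<close>)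
  finally show ?thesis .
qed

lemma L2_inner_inv_lap:
  assumes "g \<in> L2 X" "h \<in> L2 X"
  shows "((\<lambda>m. coef g m * coef h m / lam m) has_sum L2_inner X (inv_lap X g) h) UNIV"
  using Parseval[OF inv_lap_L2[OF assms(1)] assms(2)] by (simp add: coef_inv_lap assms)

section \<open>Weak gradients and Green's formula\<close>

lemma L2_component:
  fixes G :: "real^'d \<Rightarrow> real^'d"
  assumes "G \<in> L2 X"
  shows "(\<lambda>x. G x $ i) \<in> L2 X"
proof (rule L2_I)
  show "periodic X (\<lambda>x. G x $ i)" using assms by (simp add: L2_def periodic_def)
  have [measurable]: "G \<in> borel_measurable (torus X)" using assms by (simp add: L2_def)
  show meas: "(\<lambda>x. G x $ i) \<in> borel_measurable (torus X)"
    unfolding cart_eq_inner_axis by measurable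
  have "integrable (torus X) (\<lambda>x. (norm (G x))\<^sup>2)" using assms by (simp add: L2_def)
  then show "integrable (torus X) (\<lambda>x. (G x $ i)\<^sup>2)"
    by (rule Bochner_Integration.integrable_bound)
      (use meas in \<open>auto simp: abs_le_square_iff[symmetric] component_le_norm_cart\<close>)
qed

lemma L2_vecI:
  fixes G :: "real^'d \<Rightarrow> real^'d"
  assumes "\<And>i. (\<lambda>x. G x $ i) \<in> L2 X"
  shows "G \<in> L2 X"
proof -
  have "periodic X G" using assms[THEN L2_D(1)] by (simp add: periodic_def vec_eq_iff)
  moreover have "G \<in> borel_measurable (torus X)"
    unfolding borel_measurable_euclidean_space[of G]
    using assms[THEN L2_D(2)] by (auto simp: Basis_vec_def inner_axis)
  moreover have "(norm (G x))\<^sup>2 = (\<Sum>i\<in>UNIV. (G x $ i)\<^sup>2)" for x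
    by (simp add: norm_vec_def L2_set_def sum_nonneg)
  ultimately show ?thesis using assms[THEN L2_D(3)] by (simp add: L2_def)
qed

lemma weak_gradient_coef:
  assumes "has_weak_gradient X u G"
  shows "coef (\<lambda>x. G x $ i) m = freq i m * coef u (flip i m)"
proof -
  have "(LINT x|torus X. u x * partial i (basis m) x) = - coef (\<lambda>x. G x $ i) m"
    using assms basis_test[of m] by (simp add: has_weak_gradient_def coef_def L2_inner_def)
  moreover have "(LINT x|torus X. u x * partial i (basis m) x) = - freq i m * coef u (flip i m)"
    unfolding partial_basis coef_def L2_inner_def integral_mult_cmult by simp
  ultimately show ?thesis by simp
qed

text \<open>Puts every new iterate into \<open>H1\<close>. The terms
  \<open>(freq i m * coef v m)\<^sup>2\<close> are dominated by
  \<open>lam m * (coef v m)\<^sup>2\<close>, which equals \<open>- (coef v m * coef w m)\<close> and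
  is summable by Parseval.\<close>

lemma weak_gradient_exists:
  assumes "has_weak_laplacian X v w"
  shows "\<exists>G. has_weak_gradient X v G"
proof -
  have v: "v \<in> L2 X" and w: "w \<in> L2 X" using assms by (auto simp: has_weak_laplacian_def)
  have "\<exists>g. g \<in> L2 X \<and> (\<forall>m. coef g m = freq i m * coef v (flip i m))" for i
  proof -
    have "(\<lambda>m. (freq i m * coef v m)\<^sup>2) summable_on UNIV"
    proof (rule summable_on_comparison_test)
      show "(\<lambda>m. - (coef v m * coef w m)) summable_on UNIV"
        using has_sum_uminusI[OF Parseval[OF v w]] by (auto simp: summable_on_def)
      show "(freq i m * coef v m)\<^sup>2 \<le> - (coef v m * coef w m)" for m
      proof -
        have "(freq i m)\<^sup>2 * (coef v m)\<^sup>2 \<le> lam m * (coef v m)\<^sup>2"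
          unfolding lam_def by (intro mult_right_mono member_le_sum) auto
        also have "\<dots> = - (coef v m * coef w m)"
          unfolding weak_laplacian_coef[OF assms] by (simp add: power2_eq_square)
        finally show ?thesis by (simp only: power_mult_distrib)
      qed
    qed auto
    \<comment> \<open>\<open>flip\<close> changes only the sign of \<open>freq i\<close>, so
      reindexing moves it onto the coefficient of \<open>v\<close>, where the formula for the
      derivative has it.\<close>
    then have "(\<lambda>m. (freq i (flip i m) * coef v (flip i m))\<^sup>2) summable_on UNIV"
      by (subst summable_on_reindex_bij_betw[OF bij_flip])
    then have "(\<lambda>m. (freq i m * coef v (flip i m))\<^sup>2) summable_on UNIV" by simp
    then show ?thesis by (rule Riesz_Fischer_ex)
  qed
  then obtain g where g: "\<And>i. g i \<in> L2 X" "\<And>i m. coef (g i) m = freq i m * coef v (flip i m)"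
    by metis
  have "has_weak_gradient X v (\<lambda>x. \<chi> i. g i x)"
    unfolding has_weak_gradient_def
  proof (intro conjI ballI allI v)
    show "(\<lambda>x. \<chi> i. g i x) \<in> L2 X" by (rule L2_vecI) (simp add: g)
    fix \<psi> i assume \<psi>: "\<psi> \<in> test_functions X"
    have "((\<lambda>m. coef v m * coef (partial i \<psi>) m) has_sum L2_inner X v (partial i \<psi>)) UNIV"
      by (intro Parseval v test_L2 test_partial \<psi>)
    then have "((\<lambda>m. coef v (flip i m) * coef (partial i \<psi>) (flip i m)) has_sum L2_inner X v (partial i \<psi>)) UNIV"
      by (subst has_sum_reindex_bij_betw[OF bij_flip])
    moreover have "coef v (flip i m) * coef (partial i \<psi>) (flip i m) = - (coef (g i) m * coef \<psi> m)" for m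
      by (simp add: coef_partial[OF \<psi>] g(2) mult_ac)
    ultimately have "((\<lambda>m. - (coef (g i) m * coef \<psi> m)) has_sum L2_inner X v (partial i \<psi>)) UNIV"
      by simp
    moreover have "((\<lambda>m. - (coef (g i) m * coef \<psi> m)) has_sum - L2_inner X (g i) \<psi>) UNIV"
      by (intro has_sum_uminusI Parseval g test_L2 \<psi>)
    ultimately have "L2_inner X v (partial i \<psi>) = - L2_inner X (g i) \<psi>"
      by (rule has_sum_unique)
    then show "(LINT x|torus X. v x * partial i \<psi> x) = - (LINT x|torus X. (\<chi> i. g i x) $ i * \<psi> x)"
      by (simp add: L2_inner_def)
  qed
  then show ?thesis by blast
qed

lemma weak_grad: "u \<in> H1 X \<Longrightarrow> has_weak_gradient X u (weak_grad X u)"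
  unfolding H1_def weak_grad_def mem_Collect_eq by (rule someI_ex[of "has_weak_gradient X u"])

text \<open>Parseval for the components has the multiplier \<open>(freq i m)\<^sup>2\<close>, and
  summing over \<open>i\<close> restores \<open>lam m\<close>. Only \<open>v\<close> has to have a
  weak Laplacian, so the old iterate can enter with its gradient alone.\<close>

lemma weak_Green:
  assumes lap: "has_weak_laplacian X v w"
    and Gv: "has_weak_gradient X v Gv" and Gu: "has_weak_gradient X u Gu"
  shows "integrable (torus X) (\<lambda>x. Gv x \<bullet> Gu x)"
    and "L2_inner X w u = - (LINT x|torus X. Gv x \<bullet> Gu x)"
proof -
  have u: "u \<in> L2 X" and w: "w \<in> L2 X" and G: "Gv \<in> L2 X" "Gu \<in> L2 X"
    using assms by (auto simp: has_weak_laplacian_def has_weak_gradient_def)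
  have eq: "Gv x \<bullet> Gu x = (\<Sum>i\<in>UNIV. Gv x $ i * Gu x $ i)" for x
    by (simp add: inner_vec_def)
  have int: "integrable (torus X) (\<lambda>x. Gv x $ i * Gu x $ i)" for i
    by (intro L2_mult_integrable L2_component G)
  then show "integrable (torus X) (\<lambda>x. Gv x \<bullet> Gu x)" unfolding eq by simp
  have "((\<lambda>m. (freq i m)\<^sup>2 * (coef v m * coef u m)) has_sum (LINT x|torus X. Gv x $ i * Gu x $ i)) UNIV" for i
  proof -
    have "((\<lambda>m. coef (\<lambda>x. Gv x $ i) m * coef (\<lambda>x. Gu x $ i) m) has_sum
        (LINT x|torus X. Gv x $ i * Gu x $ i)) UNIV"
      using Parseval[OF L2_component L2_component, OF G] by (simp add: L2_inner_def)
    then have "((\<lambda>m. coef (\<lambda>x. Gv x $ i) (flip i m) * coef (\<lambda>x. Gu x $ i) (flip i m)) has_sum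
        (LINT x|torus X. Gv x $ i * Gu x $ i)) UNIV"
      by (subst has_sum_reindex_bij_betw[OF bij_flip])
    then show ?thesis
      by (simp add: weak_gradient_coef[OF Gv] weak_gradient_coef[OF Gu] power2_eq_square mult_ac)
  qed
  then have "((\<lambda>m. \<Sum>i\<in>UNIV. (freq i m)\<^sup>2 * (coef v m * coef u m)) has_sum
      (\<Sum>i\<in>UNIV. LINT x|torus X. Gv x $ i * Gu x $ i)) UNIV"
    by (intro has_sum_sum) auto
  moreover have "(\<Sum>i\<in>UNIV. LINT x|torus X. Gv x $ i * Gu x $ i) = (LINT x|torus X. Gv x \<bullet> Gu x)"
    unfolding eq by (rule Bochner_Integration.integral_sum[symmetric]) (rule int)
  moreover have "(\<Sum>i\<in>UNIV. (freq i m)\<^sup>2 * (coef v m * coef u m)) = - (coef w m * coef u m)" for m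
    unfolding sum_distrib_right[symmetric] lam_def[symmetric] weak_laplacian_coef[OF lap] by simp
  ultimately have "((\<lambda>m. - (coef w m * coef u m)) has_sum (LINT x|torus X. Gv x \<bullet> Gu x)) UNIV" by simp
  moreover have "((\<lambda>m. - (coef w m * coef u m)) has_sum - L2_inner X w u) UNIV"
    by (intro has_sum_uminusI Parseval w u)
  ultimately have "(LINT x|torus X. Gv x \<bullet> Gu x) = - L2_inner X w u" by (rule has_sum_unique)
  then show "L2_inner X w u = - (LINT x|torus X. Gv x \<bullet> Gu x)" by simp
qed

end

section \<open>Minimum principle and operator norm\<close>

text \<open>\<open>g'\<close> vanishes at the minimum point 0. A negative \<open>l\<close> would
  make \<open>g'\<close> negative just to the right of 0 and let \<open>g\<close> fall below its
  minimum.\<close>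

lemma second_deriv_nonneg_at_min:
  fixes g g' :: "real \<Rightarrow> real"
  assumes g: "\<And>s. (g has_real_derivative g' s) (at s)"
    and g': "(g' has_real_derivative l) (at 0)"
    and d: "0 < d" "\<And>s. \<bar>s\<bar> < d \<Longrightarrow> g 0 \<le> g s"
  shows "0 \<le> l"
proof (rule ccontr)
  assume "\<not> 0 \<le> l"
  then obtain e where e: "0 < e" "\<And>h. 0 < h \<Longrightarrow> h < e \<Longrightarrow> g' h < g' 0"
    using DERIV_neg_dec_right[OF g'] by auto
  have "g' 0 = 0"
    by (rule DERIV_local_min[OF g d(1)]) (use d(2) in auto)
  let ?h = "min d e / 2"
  have h: "0 < ?h" "?h < d" "?h < e" using d(1) e(1) by auto
  have "g 0 > g ?h"
  proof (rule DERIV_neg_imp_decreasing_open[OF h(1)])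
    fix s assume "0 < s" "s < ?h"
    then show "\<exists>y. DERIV g s :> y \<and> y < 0"
      using g[of s] e(2)[of s] h(3) \<open>g' 0 = 0\<close> by (intro exI[of _ "g' s"]) auto
  next
    show "continuous_on {0..?h} g"
      using g by (meson DERIV_isCont continuous_at_imp_continuous_on)
  qed
  then show False using d(2)[of ?h] h by auto
qed

lemma Linf_norm_AE: "AE x in M. ereal \<bar>u x\<bar> \<le> Linf_norm M u"
  unfolding Linf_norm_def by (rule esssup_AE)

lemma Linf_norm_leI:
  "u \<in> borel_measurable M \<Longrightarrow> AE x in M. \<bar>u x\<bar> \<le> c \<Longrightarrow> Linf_norm M u \<le> ereal c"
  unfolding Linf_norm_def by (rule esssup_I) (auto elim: eventually_mono)

context periodic_box
begin

lemma test_add: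
  assumes "\<psi> \<in> test_functions X" "\<eta> \<in> test_functions X"
  shows "(\<lambda>x. \<psi> x + \<eta> x) \<in> test_functions X"
proof -
  have D: "foldr partial is \<psi> differentiable at x" "foldr partial is \<eta> differentiable at x" for "is" x
    using assms by (simp_all add: test_functions_def)
  have "foldr partial is (\<lambda>x. \<psi> x + \<eta> x) = (\<lambda>x. foldr partial is \<psi> x + foldr partial is \<eta> x)" for "is"
  proof (induction "is")
    case (Cons i "is")
    have "partial i (\<lambda>x. foldr partial is \<psi> x + foldr partial is \<eta> x)
        = (\<lambda>x. partial i (foldr partial is \<psi>) x + partial i (foldr partial is \<eta>) x)"
      by (rule ext) (simp add: partial_add D)
    then show ?case by (simp add: Cons.IH)
  qed simp
  then show ?thesis using assms D by (simp add: test_functions_def periodic_def)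
qed

lemma laplacian_add:
  assumes "\<psi> \<in> test_functions X" "\<eta> \<in> test_functions X"
  shows "laplacian (\<lambda>x. \<psi> x + \<eta> x) x = laplacian \<psi> x + laplacian \<eta> x"
proof -
  note D = assms[THEN test_differentiable] assms[THEN test_partial, THEN test_differentiable]
  have "partial i (\<lambda>x. \<psi> x + \<eta> x) = (\<lambda>x. partial i \<psi> x + partial i \<eta> x)" for i
    by (rule ext) (simp add: partial_add D)
  then show ?thesis by (simp add: laplacian_def partial_add D sum.distrib)
qed

lemma laplacian_cmult:
  assumes "\<psi> \<in> test_functions X"
  shows "laplacian (\<lambda>x. c * \<psi> x) x = c * laplacian \<psi> x"
proof -
  note D = assms[THEN test_differentiable] assms[THEN test_partial, THEN test_differentiable]
  have "partial i (\<lambda>x. c * \<psi> x) = (\<lambda>x. c * partial i \<psi> x)" for i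
    by (rule ext) (simp add: partial_cmult D)
  then show ?thesis by (simp add: laplacian_def partial_cmult D sum_distrib_left)
qed

text \<open>The operator multiplies \<open>wave m\<close> by \<open>a + e * lam m\<close>, which is
  positive, so the equation is solved by division mode by mode, and the solution stays smooth and
  periodic.\<close>

lemma trig_poly_resolvent:
  assumes "0 < a" "0 < e" "p \<in> trig_poly"
  shows "\<exists>\<eta>\<in>test_functions X. \<forall>x. a * \<eta> x - e * laplacian \<eta> x = p x"
  using assms(3)
proof (induction rule: trig_poly.induct)
  case (wave m)
  let ?c = "a + e * lam m"
  have "0 < ?c" using assms(1,2) lam_nonneg[of m] by (simp add: add_pos_nonneg)
  have factor: "a * (k * y) - e * (k * (- lam m * y)) = (?c * k) * y" for k y
    by (simp add: algebra_simps)
  have "a * (1 / ?c * wave m x) - e * (1 / ?c * (- lam m * wave m x)) = wave m x" for x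
    unfolding factor using \<open>0 < ?c\<close> by simp
  then show ?case
    by (intro bexI[of _ "\<lambda>x. 1 / ?c * wave m x"] test_cmult wave_test)
      (simp only: laplacian_cmult[OF wave_test] laplacian_wave, blast)
next
  case (add p q)
  then obtain \<eta> \<theta> where "\<eta> \<in> test_functions X" "\<theta> \<in> test_functions X"
    "\<And>x. a * \<eta> x - e * laplacian \<eta> x = p x" "\<And>x. a * \<theta> x - e * laplacian \<theta> x = q x"
    by blast
  then show ?case
    by (intro bexI[of _ "\<lambda>x. \<eta> x + \<theta> x"] test_add) (auto simp: laplacian_add algebra_simps)
next
  case (cmult p c)
  then obtain \<eta> where \<eta>: "\<eta> \<in> test_functions X" "\<And>x. a * \<eta> x - e * laplacian \<eta> x = p x"
    by blast
  have "a * (c * \<eta> x) - e * (c * laplacian \<eta> x) = c * p x" for x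
    unfolding \<eta>(2)[symmetric] by (simp add: algebra_simps)
  then show ?case
    by (intro bexI[of _ "\<lambda>x. c * \<eta> x"] test_cmult \<eta>(1)) (simp add: laplacian_cmult[OF \<eta>(1)])
qed

text \<open>At a minimum point every second partial derivative is nonnegative, so the inequality
  bounds the minimum from below. The minimum over the closed box may lie on its boundary;
  periodicity makes it a minimum along each coordinate line all the same.\<close>

lemma classical_min_principle:
  assumes \<eta>: "\<eta> \<in> test_functions X" and "0 < a" "0 < e"
    and pos: "\<And>x. x \<in> cbox (- X) X \<Longrightarrow> 0 \<le> a * \<eta> x - e * laplacian \<eta> x"
    and x: "x \<in> cbox (- X) X"
  shows "0 \<le> \<eta> x"
proof -
  let ?B = "cbox (- X) X"
  obtain z where z: "z \<in> ?B" and min: "\<And>y. y \<in> ?B \<Longrightarrow> \<eta> z \<le> \<eta> y"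
    using continuous_attains_inf[OF compact_cbox _ test_continuous[OF \<eta>]] x by blast
  have per: "\<eta> (y + axis i (2 * X $ i)) = \<eta> y" for y i
    using \<eta> by (simp add: test_functions_def periodic_def)
  \<comment> \<open>A forward shift of at most one period stays in the box or returns to it after
    subtracting one period.\<close>
  have right: "\<eta> z \<le> \<eta> (z + s *\<^sub>R axis i 1)" if s: "0 \<le> s" "s \<le> 2 * X $ i" for s i
  proof (cases "z $ i + s \<le> X $ i")
    case True
    then have "z + s *\<^sub>R axis i 1 \<in> ?B"
      using z s by (auto simp: mem_box_cart axis_def add_increasing2)
    then show ?thesis by (rule min)
  next
    case False
    let ?y = "z + s *\<^sub>R axis i 1 - axis i (2 * X $ i)"
    have "?y $ j = (if j = i then z $ i + s - 2 * X $ i else z $ j)" for j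
      by (simp add: axis_def)
    moreover have "- X $ j \<le> z $ j" "z $ j \<le> X $ j" for j
      using z by (auto simp: mem_box_cart)
    ultimately have "?y \<in> ?B"
      using False s unfolding mem_box_cart
      by (smt (verit) uminus_vec_def vec_lambda_beta vector_uminus_component)
    then have "\<eta> z \<le> \<eta> ?y" by (rule min)
    then show ?thesis using per[of ?y i] by simp
  qed
  have "0 \<le> partial i (partial i \<eta>) z" for i
  proof (rule second_deriv_nonneg_at_min)
    show "((\<lambda>s. \<eta> (z + s *\<^sub>R axis i 1)) has_real_derivative partial i \<eta> (z + s *\<^sub>R axis i 1)) (at s)" for s
      by (rule partial_line) (rule test_differentiable[OF \<eta>])
    show "((\<lambda>s. partial i \<eta> (z + s *\<^sub>R axis i 1)) has_real_derivative partial i (partial i \<eta>) z) (at 0)"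
      using partial_line[OF test_differentiable[OF test_partial[OF \<eta>]], of i z i 0] by simp
    show "0 < 2 * X $ i" using X_pos[of i] by simp
    fix s :: real assume s: "\<bar>s\<bar> < 2 * X $ i"
    show "\<eta> (z + 0 *\<^sub>R axis i 1) \<le> \<eta> (z + s *\<^sub>R axis i 1)"
    proof (cases "0 \<le> s")
      case True
      then show ?thesis using right[of s i] s by simp
    next
      case False
      \<comment> \<open>A backward shift by less than a period agrees, modulo the period, with a
        forward one.\<close>
      have "z + (s + 2 * X $ i) *\<^sub>R axis i 1 = z + s *\<^sub>R axis i 1 + axis i (2 * X $ i)"
        by (simp add: vec_eq_iff axis_def)
      then show ?thesis using right[of "s + 2 * X $ i" i] s False per[of "z + s *\<^sub>R axis i 1" i]
        by (simp add: add.assoc)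
    qed
  qed
  then have "0 \<le> laplacian \<eta> z" unfolding laplacian_def by (rule sum_nonneg)
  then have "0 \<le> e * laplacian \<eta> z" using \<open>0 < e\<close> by simp
  then have "0 \<le> a * \<eta> z" using pos[OF z] by linarith
  then have "0 \<le> \<eta> z" using \<open>0 < a\<close> by (simp add: zero_le_mult_iff)
  then show ?thesis using min[OF x] by linarith
qed

text \<open>By duality it suffices to test \<open>v\<close> with nonnegative trigonometric polynomials, and
  the resolvent of such a polynomial is again one.\<close>

lemma weak_min_principle:
  assumes lap: "has_weak_laplacian X v w" and "0 < a" "0 < e"
    and pos: "AE x in torus X. 0 \<le> a * v x - e * w x"
  shows "AE x in torus X. 0 \<le> v x"
proof (rule AE_nonneg_of_trig_poly)
  have v: "v \<in> L2 X" and w: "w \<in> L2 X" using lap by (auto simp: has_weak_laplacian_def)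
  show "integrable (torus X) v" using v by (rule L2_integrable)
  fix p assume p: "p \<in> trig_poly" "\<And>x. x \<in> cbox (- X) X \<Longrightarrow> 0 \<le> p x"
  obtain \<eta> where \<eta>: "\<eta> \<in> test_functions X" "\<And>x. a * \<eta> x - e * laplacian \<eta> x = p x"
    using trig_poly_resolvent[OF assms(2,3) p(1)] by blast
  have \<eta>pos: "0 \<le> \<eta> x" if "x \<in> cbox (- X) X" for x
    using classical_min_principle[OF \<eta>(1) assms(2,3) _ that] \<eta>(2) p(2) by simp
  have "(LINT x|torus X. v x * p x) = L2_inner X (\<lambda>x. a * \<eta> x + (- e) * laplacian \<eta> x) v"
    unfolding L2_inner_def by (simp add: \<eta>(2)[symmetric] mult.commute)
  also have "\<dots> = a * L2_inner X v \<eta> - e * L2_inner X v (laplacian \<eta>)"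
    by (subst L2_inner_lincomb_left) (simp_all add: v \<eta>(1) test_L2 laplacian_L2 L2_inner_commute[of _ v])
  also have "L2_inner X v (laplacian \<eta>) = L2_inner X w \<eta>"
    using lap \<eta>(1) by (simp add: has_weak_laplacian_def)
  also have "a * L2_inner X v \<eta> - e * L2_inner X w \<eta> = L2_inner X (\<lambda>x. a * v x + (- e) * w x) \<eta>"
    by (subst L2_inner_lincomb_left) (simp_all add: v w \<eta>(1) test_L2)
  also have "0 \<le> \<dots>"
    unfolding L2_inner_def
  proof (rule integral_nonneg_AE)
    show "AE x in torus X. 0 \<le> (a * v x + - e * w x) * \<eta> x"
      using pos AE_space by eventually_elim (simp add: \<eta>pos space_torus)
  qed
  finally show "0 \<le> (LINT x|torus X. v x * p x)" .
qed

section \<open>The inverse Laplacian on bounded functions\<close>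

lemma inv_lap_cmult_AE:
  assumes "g \<in> L2 X"
  shows "AE x in torus X. inv_lap X (\<lambda>x. c * g x) x = c * inv_lap X g x"
  by (rule AE_eq_of_coef) (simp_all add: assms inv_lap_L2 coef_inv_lap L2_cmult coef_cmult)

text \<open>Reduction to the unit ball over which \<open>inv_lap_opnorm\<close> takes its supremum.
  Homogeneity of \<open>inv_lap\<close> is available only almost everywhere, because the solution is
  chosen anew for each right-hand side.\<close>

lemma inv_lap_AE_bound:
  assumes L: "inv_lap_opnorm X \<le> ereal L" and g: "g \<in> L2 X"
    and C: "0 < C" "AE x in torus X. \<bar>g x\<bar> \<le> C"
  shows "AE x in torus X. \<bar>inv_lap X g x\<bar> \<le> L * C"
proof -
  let ?g = "\<lambda>x. 1 / C * g x"
  have g': "?g \<in> L2 X" by (rule L2_cmult[OF g])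
  have "AE x in torus X. \<bar>?g x\<bar> \<le> 1"
    using C(2) by eventually_elim (use C(1) in \<open>simp add: abs_mult\<close>)
  then have "Linf_norm (torus X) ?g \<le> ereal 1"
    by (intro Linf_norm_leI L2_D(2) g')
  then have "Linf_norm (torus X) (inv_lap X ?g) \<le> inv_lap_opnorm X"
    unfolding inv_lap_opnorm_def using L2_D[OF g'] by (intro SUP_upper) (simp add: one_ereal_def)
  also note L
  finally have le: "Linf_norm (torus X) (inv_lap X ?g) \<le> ereal L" .
  show ?thesis
    using Linf_norm_AE[of "inv_lap X ?g" "torus X"] inv_lap_cmult_AE[OF g, of "1 / C"]
  proof eventually_elim
    case (elim x)
    from elim(1) le have "ereal \<bar>inv_lap X ?g x\<bar> \<le> ereal L" by (rule order_trans)
    then have "\<bar>1 / C * inv_lap X g x\<bar> \<le> L" unfolding elim(2) by simp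
    then show ?case using C(1) by (simp add: abs_mult field_simps)
  qed
qed

text \<open>The wave is a bounded eigenfunction with eigenvalue \<open>1 / lam m\<close>.\<close>

lemma inverse_lam_le_opnorm:
  assumes L: "inv_lap_opnorm X \<le> ereal L" and m: "m \<noteq> (\<lambda>_. 0)"
  shows "1 / lam m \<le> L"
proof -
  have lam: "0 < lam m" using lam_nonneg[of m] lam_eq_0_iff[of m] m by simp
  have wave: "wave m \<in> L2 X" by (intro test_L2 wave_test)
  have "coef (wave m) m' = 0" if "m' \<noteq> m" for m'
    using wave_orthogonal[of m m'] that
    by (simp add: coef_def L2_inner_def basis_def mult.left_commute)
  then have "coef (wave m) m' / lam m' = 1 / lam m * coef (wave m) m'" for m' by (cases "m' = m") auto
  then have eig: "AE x in torus X. inv_lap X (wave m) x = 1 / lam m * wave m x"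
    by (intro AE_eq_of_coef) (simp_all only: inv_lap_L2 coef_inv_lap wave L2_cmult coef_cmult)
  \<comment> \<open>The sup norm \<open>q\<close> of the wave enters only as a finite positive
    number. Bounding the image of the wave by \<open>L * q\<close> and inserting the eigenvalue
    gives \<open>q \<le> lam m * L * q\<close>, from which \<open>q\<close> cancels.\<close>
  define q where "q = real_of_ereal (Linf_norm (torus X) (wave m))"
  have le1: "Linf_norm (torus X) (wave m) \<le> ereal 1"
    by (intro Linf_norm_leI L2_D(2) wave) (simp add: wave_le_1)
  have ae: "AE x in torus X. ereal \<bar>wave m x\<bar> \<le> Linf_norm (torus X) (wave m)"
    by (rule Linf_norm_AE)
  have not0: "\<not> (AE x in torus X. wave m x = 0)"
  proof
    assume "AE x in torus X. wave m x = 0"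
    then have "AE x in torus X. wave m x * wave m x = 0" by eventually_elim simp
    then have "wave_sqnorm m = 0"
      unfolding wave_sqnorm_def by (rule integral_eq_zero_AE)
    then show False using wave_sqnorm_pos[of m] by simp
  qed
  have "Linf_norm (torus X) (wave m) > 0"
  proof (rule ccontr)
    assume n: "\<not> Linf_norm (torus X) (wave m) > 0"
    have "AE x in torus X. wave m x = 0"
      using ae
    proof eventually_elim
      case (elim x)
      then have "ereal \<bar>wave m x\<bar> \<le> 0" using n by (meson leI order_trans)
      then show ?case by simp
    qed
    then show False using not0 by simp
  qed
  then have q: "Linf_norm (torus X) (wave m) = ereal q" "0 < q"
    using le1 unfolding q_def by (cases "Linf_norm (torus X) (wave m)"; simp)+
  have "AE x in torus X. \<bar>wave m x\<bar> \<le> q" using ae unfolding q(1) by simp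
  then have "AE x in torus X. \<bar>inv_lap X (wave m) x\<bar> \<le> L * q"
    by (rule inv_lap_AE_bound[OF L wave q(2)])
  then have "AE x in torus X. \<bar>wave m x\<bar> \<le> lam m * (L * q)"
    using eig
  proof eventually_elim
    case (elim x)
    from elim(1) have "1 / lam m * \<bar>wave m x\<bar> \<le> L * q"
      unfolding elim(2) abs_mult using lam by simp
    then show ?case using lam by (simp add: field_simps)
  qed
  then have "Linf_norm (torus X) (wave m) \<le> ereal (lam m * (L * q))"
    by (intro Linf_norm_leI L2_D(2) wave)
  then have "1 * q \<le> (lam m * L) * q" unfolding q(1) by simp
  then have "1 \<le> lam m * L" using q(2) by (rule mult_right_le_imp_le)
  then show ?thesis using lam by (simp add: field_simps)
qed

lemma opnorm_bound_nonneg: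
  assumes "inv_lap_opnorm X \<le> ereal L"
  shows "0 \<le> L"
proof -
  have "0 \<le> 1 / lam (\<lambda>_. 1)" using lam_nonneg by simp
  also have "\<dots> \<le> L" by (rule inverse_lam_le_opnorm[OF assms]) (simp add: fun_eq_iff)
  finally show ?thesis .
qed

lemma opnorm_nonneg: "0 \<le> inv_lap_opnorm X"
proof (rule ccontr)
  assume "\<not> 0 \<le> inv_lap_opnorm X"
  \<comment> \<open>A norm of \<open>-\<infinity>\<close> has no real value to which the bound could
    be applied; it is excluded because it would lie below \<open>- 1\<close>.\<close>
  then show False
    using opnorm_bound_nonneg[of "real_of_ereal (inv_lap_opnorm X)"] opnorm_bound_nonneg[of "- 1"]
    by (cases "inv_lap_opnorm X") auto
qed

text \<open>The passage from the sup-norm operator bound to the quadratic form: the two series are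
  compared mode by mode. At the constant mode \<open>1 / lam m\<close> is 0, and
  \<open>0 \<le> L\<close> takes over.\<close>

lemma L2_inner_inv_lap_le:
  assumes L: "inv_lap_opnorm X \<le> ereal L" and g: "g \<in> L2 X"
  shows "L2_inner X (inv_lap X g) g \<le> L * L2_inner X g g"
proof (rule has_sum_mono)
  show "((\<lambda>m. coef g m * coef g m / lam m) has_sum L2_inner X (inv_lap X g) g) UNIV"
    by (rule L2_inner_inv_lap[OF g g])
  show "((\<lambda>m. L * (coef g m * coef g m)) has_sum L * L2_inner X g g) UNIV"
    by (intro has_sum_cmult_right Parseval g)
  fix m
  have "1 / lam m \<le> L"
    using inverse_lam_le_opnorm[OF L, of m] lam_eq_0_iff[of m] opnorm_bound_nonneg[OF L]
    by (cases "m = (\<lambda>_. 0)") auto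
  then have "1 / lam m * (coef g m * coef g m) \<le> L * (coef g m * coef g m)"
    by (intro mult_right_mono) auto
  then show "coef g m * coef g m / lam m \<le> L * (coef g m * coef g m)" by simp
qed

lemma inv_lap_symmetric:
  assumes "g \<in> L2 X" "h \<in> L2 X"
  shows "L2_inner X (inv_lap X g) h = L2_inner X (inv_lap X h) g"
  using L2_inner_inv_lap[OF assms] L2_inner_inv_lap[OF assms(2,1)] by (simp add: mult.commute has_sum_unique)

end

section \<open>Stability of the scheme\<close>

lemma deriv_W: "deriv W = (\<lambda>s. 36 * (s\<^sup>2 - s) * (2 * s - 1))"
proof
  fix s
  have "(W has_real_derivative 36 * (s\<^sup>2 - s) * (2 * s - 1)) (at s)"
    unfolding W_def[abs_def] by (auto intro!: derivative_eq_intros simp: algebra_simps)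
  then show "deriv W s = 36 * (s\<^sup>2 - s) * (2 * s - 1)" by (rule DERIV_imp_deriv)
qed

lemma deriv_deriv_W: "deriv (deriv W) = (\<lambda>s. 36 * (6 * s\<^sup>2 - 6 * s + 1))"
proof
  fix s
  have "((\<lambda>s. 36 * (s\<^sup>2 - s) * (2 * s - 1)) has_real_derivative 36 * (6 * s\<^sup>2 - 6 * s + 1)) (at s)"
    by (auto intro!: derivative_eq_intros simp: algebra_simps power2_eq_square)
  then show "deriv (deriv W) s = 36 * (6 * s\<^sup>2 - 6 * s + 1)"
    unfolding deriv_W by (rule DERIV_imp_deriv)
qed

lemma deriv_f: "deriv Defs.f = (\<lambda>s. 6 * s - 6 * s\<^sup>2)"
proof
  fix s
  have "(Defs.f has_real_derivative 6 * s - 6 * s\<^sup>2) (at s)"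
    unfolding f_def[abs_def] by (auto intro!: derivative_eq_intros simp: algebra_simps power2_eq_square)
  then show "deriv Defs.f s = 6 * s - 6 * s\<^sup>2" by (rule DERIV_imp_deriv)
qed

lemma deriv_deriv_f: "deriv (deriv Defs.f) = (\<lambda>s. 6 - 12 * s)"
proof
  fix s :: real
  have "((\<lambda>s. 6 * s - 6 * s\<^sup>2) has_real_derivative 6 - 12 * s) (at s)"
    by (auto intro!: derivative_eq_intros)
  then show "deriv (deriv Defs.f) s = 6 - 12 * s"
    unfolding deriv_f by (rule DERIV_imp_deriv)
qed

text \<open>The set where the bound holds is closed and contains almost all of the open interval,
  hence all of it and its endpoints. The endpoints matter, as \<open>W''\<close> and
  \<open>f''\<close> are evaluated at 0.\<close>

lemma Linf_norm_ge:
  fixes g :: "real \<Rightarrow> real"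
  assumes cont: "continuous_on UNIV g" and s: "s \<in> {0..1}"
  shows "ereal \<bar>g s\<bar> \<le> Linf_norm (lebesgue_on {0..1}) g"
proof -
  let ?C = "{s. ereal \<bar>g s\<bar> \<le> Linf_norm (lebesgue_on {0..1}) g}"
  have "AE s in lebesgue_on {0..1}. s \<in> ?C"
    using Linf_norm_AE[of g "lebesgue_on {0..1}"] by simp
  then have ae: "AE s \<in> {0<..<1} in lebesgue. s \<in> ?C"
    by (subst (asm) AE_restrict_space_iff) (simp, erule eventually_mono, simp)
  have "continuous_on UNIV (\<lambda>s. ereal \<bar>g s\<bar>)"
    by (intro continuous_on_ereal continuous_intros cont)
  then have closed: "closed ?C" by (rule closed_Collect_le[OF _ continuous_on_const])
  have "{0<..<1} \<subseteq> ?C"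
    using mem_closed_if_AE_lebesgue_open[OF open_greaterThanLessThan closed ae] by blast
  then have "closure {0<..<1} \<subseteq> ?C" using closed by (rule closure_minimal)
  then show ?thesis using s by (auto simp: closure_greaterThanLessThan)
qed

text \<open>The three norms stand on the smaller side of the stability condition, so lower bounds
  are enough. The points 0, 1/2 and 0 maximize the absolute values of \<open>W''\<close>,
  \<open>f'\<close> and \<open>f''\<close> on the unit interval, so nothing is lost. The numbers 36,
  3/2 and 6 of the later estimates are these maxima.\<close>

lemma L_W''_ge: "36 \<le> L_W''"
proof -
  have "continuous_on UNIV (deriv (deriv W))"
    unfolding deriv_deriv_W by (intro continuous_intros)
  from Linf_norm_ge[OF this, of 0] show ?thesis by (simp add: L_W''_def deriv_deriv_W)
qed

lemma L_f'_ge: "ereal (3 / 2) \<le> L_f'"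
proof -
  have "continuous_on UNIV (deriv Defs.f)"
    unfolding deriv_f by (intro continuous_intros)
  from Linf_norm_ge[OF this, of "1 / 2"] show ?thesis by (simp add: L_f'_def deriv_f power2_eq_square)
qed

lemma L_f''_ge: "6 \<le> L_f''"
proof -
  have "continuous_on UNIV (deriv (deriv Defs.f))"
    unfolding deriv_deriv_f by (intro continuous_intros)
  from Linf_norm_ge[OF this, of 0] show ?thesis by (simp add: L_f''_def deriv_deriv_f)
qed

text \<open>18 is half of the maximum 36 of \<open>|W''|\<close>. The gap between the two sides is
  exactly \<open>18 * (b - a)\<^sup>2\<close> times a combination, with positive weights, of
  products of \<open>a\<close>, \<open>b\<close>, \<open>1 - a\<close> and
  \<open>1 - b\<close>.\<close>

lemma W_Taylor:
  assumes "0 \<le> a" "a \<le> 1" "0 \<le> b" "b \<le> 1"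
  shows "W b - W a \<le> deriv W a * (b - a) + 18 * (b - a)\<^sup>2"
proof -
  have "0 \<le> b * (1 - b)" "0 \<le> a * (1 - a)" "0 \<le> a * (1 - b)" "0 \<le> b * (1 - a)"
    using assms by auto
  then have "0 \<le> b * (1 - b) + 3 * (a * (1 - a)) + a * (1 - b) + b * (1 - a)" by simp
  then have "0 \<le> 18 * (b - a)\<^sup>2 * (b * (1 - b) + 3 * (a * (1 - a)) + a * (1 - b) + b * (1 - a))"
    by (intro mult_nonneg_nonneg) auto
  also have "\<dots> = deriv W a * (b - a) + 18 * (b - a)\<^sup>2 - (W b - W a)"
    unfolding deriv_W W_def by (simp add: power2_eq_square) algebra
  finally show ?thesis by simp
qed

text \<open>3 is half of the maximum 6 of \<open>|f''|\<close>. The remainder is exactly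
  \<open>(b - a)\<^sup>2\<close> times an affine factor with values between -3 and 3.\<close>

lemma f_Taylor:
  assumes "0 \<le> a" "a \<le> 1" "0 \<le> b" "b \<le> 1"
  shows "\<bar>Defs.f b - Defs.f a - deriv Defs.f a * (b - a)\<bar> \<le> 3 * (b - a)\<^sup>2"
proof -
  have "Defs.f b - Defs.f a - deriv Defs.f a * (b - a) = (b - a)\<^sup>2 * (3 - 2 * b - 4 * a)"
    unfolding deriv_f f_def by (simp add: power2_eq_square power3_eq_cube algebra_simps)
  moreover have "\<bar>3 - 2 * b - 4 * a\<bar> \<le> 3" using assms by (simp add: abs_le_iff)
  then have "(b - a)\<^sup>2 * \<bar>3 - 2 * b - 4 * a\<bar> \<le> (b - a)\<^sup>2 * 3" by (intro mult_left_mono) auto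
  ultimately show ?thesis by (simp add: abs_mult mult.commute)
qed

lemma f_Lipschitz:
  assumes "0 \<le> a" "a \<le> 1" "0 \<le> b" "b \<le> 1"
  shows "(Defs.f b - Defs.f a)\<^sup>2 \<le> 9 / 4 * (b - a)\<^sup>2"
proof -
  let ?q = "3 * (a + b) - 2 * (a\<^sup>2 + a * b + b\<^sup>2)"
  have "Defs.f b - Defs.f a = ?q * (b - a)"
    unfolding f_def by (simp add: power2_eq_square power3_eq_cube algebra_simps)
  moreover have "0 \<le> ?q"
  proof -
    have "0 \<le> a * (1 - a)" "0 \<le> b * (1 - b)" "0 \<le> a * (1 - b)" "0 \<le> b * (1 - a)"
      using assms by auto
    then have "0 \<le> 2 * (a * (1 - a)) + 2 * (b * (1 - b)) + a * (1 - b) + b * (1 - a)" by simp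
    also have "\<dots> = ?q" by (simp add: algebra_simps power2_eq_square)
    finally show ?thesis .
  qed
  moreover have "?q \<le> 3 / 2"
  proof -
    \<comment> \<open>A sum of squares that vanishes at \<open>a = b = 1 / 2\<close>, where
      \<open>f'\<close> attains its maximum 3/2.\<close>
    have "3 / 2 - ?q = 3 / 2 * (a + b - 1)\<^sup>2 + 1 / 2 * (a - b)\<^sup>2"
      by (simp add: power2_eq_square field_simps)
    moreover have "0 \<le> 3 / 2 * (a + b - 1)\<^sup>2 + 1 / 2 * (a - b)\<^sup>2" by simp
    ultimately show ?thesis by linarith
  qed
  ultimately have "?q\<^sup>2 \<le> (3 / 2)\<^sup>2" by (intro power_mono)
  then have "?q\<^sup>2 * (b - a)\<^sup>2 \<le> (3 / 2)\<^sup>2 * (b - a)\<^sup>2" by (intro mult_right_mono) auto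
  with \<open>Defs.f b - Defs.f a = ?q * (b - a)\<close> show ?thesis
    by (simp only: power_mult_distrib) (simp add: power2_eq_square)
qed

lemma f_range:
  assumes "0 \<le> s" "s \<le> 1"
  shows "0 \<le> Defs.f s" "Defs.f s \<le> 1"
proof -
  have "Defs.f s = s\<^sup>2 * (3 - 2 * s)" "1 - Defs.f s = (1 - s)\<^sup>2 * (1 + 2 * s)"
    by (simp_all add: f_def power2_eq_square power3_eq_cube algebra_simps)
  moreover have "0 \<le> s\<^sup>2 * (3 - 2 * s)" "0 \<le> (1 - s)\<^sup>2 * (1 + 2 * s)" using assms by auto
  ultimately show "0 \<le> Defs.f s" "Defs.f s \<le> 1" by linarith+
qed

section \<open>Invariance of the unit interval under the scheme\<close>

locale pOK_scheme = periodic_box X for X :: "real^'d" +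
  fixes \<epsilon> \<gamma> M \<kappa> \<omega> \<omega>' \<tau> L :: real
  assumes pos: "0 < \<epsilon>" "0 < \<gamma>" "0 < M" "0 < \<omega>" "\<omega> < 1" "0 < \<tau>"
    and \<omega>': "\<omega>' = max \<omega> (1 - \<omega>)"
    and L: "inv_lap_opnorm X \<le> ereal L"
    and stab: "36 / \<epsilon> + (9 / 4 + 6 * \<omega>') * (\<gamma> * L + M * torus_vol X) \<le> \<kappa> / \<epsilon>"
begin

text \<open>The invariant of the time stepping. The range is required almost everywhere, as the
  scheme is. It asks for no derivative: the initial function may have infinite energy, and its
  successor gains a weak gradient from the scheme.\<close>

definition unit_valued :: "(real^'d \<Rightarrow> real) \<Rightarrow> bool" where
  "unit_valued u \<longleftrightarrow> periodic X u \<and> u \<in> borel_measurable (torus X)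
     \<and> (AE x in torus X. 0 \<le> u x \<and> u x \<le> 1)"

lemma L2_compose:
  assumes u: "unit_valued u" and v: "unit_valued v"
    and H: "continuous_on UNIV (\<lambda>p. H (fst p) (snd p) :: real)"
  shows "(\<lambda>x. H (u x) (v x)) \<in> L2 X"
proof -
  have "compact ((\<lambda>p. H (fst p) (snd p)) ` ({0..1} \<times> {0..1}))"
    by (intro compact_continuous_image continuous_on_subset[OF H] compact_Times) auto
  then obtain C where C: "\<forall>y\<in>(\<lambda>p. H (fst p) (snd p)) ` ({0..1} \<times> {0..1}). norm y \<le> C"
    using compact_imp_bounded bounded_iff by metis
  have C: "\<bar>H a b\<bar> \<le> C" if "0 \<le> a" "a \<le> 1" "0 \<le> b" "b \<le> 1" for a b
    using bspec[OF C, OF imageI[of "(a, b)"]] that by simp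
  show ?thesis
  proof (rule L2_bounded[where C = C])
    show "periodic X (\<lambda>x. H (u x) (v x))" using u v by (simp add: unit_valued_def periodic_def)
    show "(\<lambda>x. H (u x) (v x)) \<in> borel_measurable (torus X)"
      by (rule borel_measurable_continuous_Pair[OF _ _ H]) (use u v in \<open>auto simp: unit_valued_def\<close>)
    have "AE x in torus X. 0 \<le> u x \<and> u x \<le> 1" "AE x in torus X. 0 \<le> v x \<and> v x \<le> 1"
      using u v by (auto simp: unit_valued_def)
    then show "AE x in torus X. \<bar>H (u x) (v x)\<bar> \<le> C"
      by eventually_elim (auto intro: C)
  qed
qed

abbreviation phase :: "(real^'d \<Rightarrow> real) \<Rightarrow> real^'d \<Rightarrow> real" where
  "phase u \<equiv> (\<lambda>x. Defs.f (u x) - \<omega>)"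

abbreviation K :: real where
  "K \<equiv> \<gamma> * L + M * torus_vol X"

lemma phase_L2:
  assumes "unit_valued u"
  shows "phase u \<in> L2 X"
proof -
  have "continuous_on UNIV (\<lambda>p :: real \<times> real. Defs.f (fst p) - \<omega>)"
    unfolding f_def by (intro continuous_intros)
  from L2_compose[OF assms assms this] show ?thesis .
qed

lemma phase_bound:
  assumes "unit_valued u"
  shows "AE x in torus X. \<bar>phase u x\<bar> \<le> \<omega>'"
proof -
  have "AE x in torus X. 0 \<le> u x \<and> u x \<le> 1" using assms by (simp add: unit_valued_def)
  then show ?thesis
    by eventually_elim (use f_range pos in \<open>force simp: \<omega>' abs_le_iff max_def\<close>)
qed

lemma \<omega>'_pos: "0 < \<omega>'" "\<omega>' \<le> 1"
  using pos by (auto simp: \<omega>')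

lemma inv_lap_phase_bound:
  assumes "unit_valued u"
  shows "AE x in torus X. \<bar>inv_lap X (phase u) x\<bar> \<le> L * \<omega>'"
  by (intro inv_lap_AE_bound[OF L] phase_L2 phase_bound \<omega>'_pos assms)

lemma integral_phase_bound:
  assumes "unit_valued u"
  shows "\<bar>LINT x|torus X. phase u x\<bar> \<le> \<omega>' * torus_vol X"
proof -
  interpret finite_measure "torus X" by (rule torus_finite_measure)
  have int: "integrable (torus X) (phase u)" by (intro L2_integrable phase_L2 assms)
  have "\<bar>LINT x|torus X. phase u x\<bar> \<le> (LINT x|torus X. \<bar>phase u x\<bar>)"
    using integral_norm_bound[of "torus X" "phase u"] by simp
  also have "\<dots> \<le> (LINT x|torus X. \<omega>')"
    by (rule integral_mono_AE) (use int phase_bound[OF assms] in auto)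
  also have "\<dots> = \<omega>' * torus_vol X" by (simp add: torus_vol_eq)
  finally show ?thesis .
qed

lemma K_nonneg: "0 \<le> K"
  using opnorm_bound_nonneg[OF L] pos torus_vol_pos by (intro add_nonneg_nonneg) auto

lemma forcing_bound:
  assumes "unit_valued u"
  shows "AE x in torus X.
    \<bar>\<gamma> * inv_lap X (phase u) x + M * (LINT y|torus X. phase u y)\<bar> \<le> \<omega>' * K"
  using inv_lap_phase_bound[OF assms]
proof eventually_elim
  case (elim x)
  have "\<bar>\<gamma> * inv_lap X (phase u) x\<bar> \<le> \<gamma> * (L * \<omega>')"
    using elim pos by (simp add: abs_mult)
  moreover have "\<bar>M * (LINT y|torus X. phase u y)\<bar> \<le> M * (\<omega>' * torus_vol X)"
    using integral_phase_bound[OF assms] pos by (simp add: abs_mult)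
  moreover have "\<omega>' * K = \<gamma> * (L * \<omega>') + M * (\<omega>' * torus_vol X)" by (simp add: algebra_simps)
  ultimately show ?case by linarith
qed

text \<open>The stabilization makes the explicit right-hand side, as a function of \<open>u x\<close>, map
  \<open>[0, 1]\<close> into \<open>[0, c]\<close> with \<open>c = 1 / \<tau> + \<kappa> / \<epsilon>\<close>.\<close>

lemma reaction_bounds:
  assumes s: "0 \<le> s" "s \<le> 1" and B: "\<bar>B\<bar> \<le> \<omega>' * K"
  defines "r \<equiv> (1 / \<tau> + \<kappa> / \<epsilon>) * s - 1 / \<epsilon> * deriv W s - B * deriv Defs.f s"
  shows "0 \<le> r" "r \<le> 1 / \<tau> + \<kappa> / \<epsilon>"
proof -
  let ?c = "1 / \<tau> + \<kappa> / \<epsilon>"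
  \<comment> \<open>What is left of the slope \<open>?c\<close> after the slopes of the other two
    terms: \<open>36 / \<epsilon>\<close> for the potential and \<open>6 * (\<omega>' * K)\<close>
    for the nonlocal part.\<close>
  let ?D = "?c - 36 / \<epsilon> - 6 * (\<omega>' * K)"
  have "0 \<le> 9 / 4 * K" using K_nonneg by simp
  moreover have "(9 / 4 + 6 * \<omega>') * K = 9 / 4 * K + 6 * (\<omega>' * K)" by (simp add: algebra_simps)
  moreover have "0 < 1 / \<tau>" using pos by simp
  ultimately have D: "0 \<le> ?D" using stab by linarith
  \<comment> \<open>\<open>deriv W\<close> and \<open>deriv f\<close> vanish at both ends of the
    unit interval, so each is compared with a line through 0, for the lower bound on
    \<open>r\<close>, and with a line through 1, for the upper one.\<close>
  have W: "deriv W s \<le> 36 * s" "- (36 * (1 - s)) \<le> deriv W s"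
  proof -
    have "36 * s - deriv W s = 36 * (s * (s * (3 - 2 * s)))"
      "deriv W s + 36 * (1 - s) = 36 * ((1 - s) * ((1 - s) * (1 + 2 * s)))"
      by (simp_all add: deriv_W algebra_simps power2_eq_square)
    moreover have "0 \<le> 36 * (s * (s * (3 - 2 * s)))" "0 \<le> 36 * ((1 - s) * ((1 - s) * (1 + 2 * s)))"
      using s by auto
    ultimately have "0 \<le> 36 * s - deriv W s" "0 \<le> deriv W s + 36 * (1 - s)" by simp_all
    then show "deriv W s \<le> 36 * s" "- (36 * (1 - s)) \<le> deriv W s" by simp_all
  qed
  have We: "1 / \<epsilon> * deriv W s \<le> 36 / \<epsilon> * s" "- (36 / \<epsilon> * (1 - s)) \<le> 1 / \<epsilon> * deriv W s"
    using W[THEN divide_right_mono, of \<epsilon>] pos by (simp_all add: minus_divide_left)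
  have F: "\<bar>B * deriv Defs.f s\<bar> \<le> 6 * (\<omega>' * K) * s" "\<bar>B * deriv Defs.f s\<bar> \<le> 6 * (\<omega>' * K) * (1 - s)"
  proof -
    have comm: "b * (6 * t) = 6 * b * t" for b t :: real by simp
    have f': "deriv Defs.f s = 6 * (s * (1 - s))" by (simp add: deriv_f algebra_simps power2_eq_square)
    have "0 \<le> s * (1 - s)" "s * (1 - s) \<le> s" "s * (1 - s) \<le> 1 - s"
      using s mult_right_le_one_le[of s "1 - s"] mult_left_le_one_le[of "1 - s" s] by simp_all
    then have "\<bar>deriv Defs.f s\<bar> \<le> 6 * s" "\<bar>deriv Defs.f s\<bar> \<le> 6 * (1 - s)" unfolding f' by auto
    then have "\<bar>B\<bar> * \<bar>deriv Defs.f s\<bar> \<le> (\<omega>' * K) * (6 * s)"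
      "\<bar>B\<bar> * \<bar>deriv Defs.f s\<bar> \<le> (\<omega>' * K) * (6 * (1 - s))"
      using B s by (auto intro!: mult_mono order_trans[OF abs_ge_zero B])
    then show "\<bar>B * deriv Defs.f s\<bar> \<le> 6 * (\<omega>' * K) * s" "\<bar>B * deriv Defs.f s\<bar> \<le> 6 * (\<omega>' * K) * (1 - s)"
      unfolding abs_mult comm by blast+
  qed
  have "0 \<le> ?D * s" "0 \<le> ?D * (1 - s)" using D s by auto
  moreover have "?D * s = ?c * s - 36 / \<epsilon> * s - 6 * (\<omega>' * K) * s"
    "?D * (1 - s) = ?c - ?c * s - 36 / \<epsilon> * (1 - s) - 6 * (\<omega>' * K) * (1 - s)"
    by (simp_all only: left_diff_distrib right_diff_distrib mult_1_right)
  ultimately show "0 \<le> r" "r \<le> ?c" using We F unfolding r_def abs_le_iff by linarith+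
qed

lemma scheme_unit_valued:
  assumes u: "unit_valued u" and step: "scheme_step X \<epsilon> \<gamma> M \<kappa> \<omega> \<tau> u v"
  shows "unit_valued v"
proof -
  let ?c = "1 / \<tau> + \<kappa> / \<epsilon>"
  let ?B = "\<lambda>x. \<gamma> * inv_lap X (phase u) x + M * (LINT y|torus X. phase u y)"
  let ?r = "\<lambda>x. ?c * u x - 1 / \<epsilon> * deriv W (u x) - ?B x * deriv Defs.f (u x)"
  obtain w where w: "has_weak_laplacian X v w" and
    eq: "AE x in torus X. ?c * (v x - u x) = \<epsilon> * w x - 1 / \<epsilon> * deriv W (u x)
            - \<gamma> * inv_lap X (phase u) x * deriv Defs.f (u x)
            - M * (LINT y|torus X. phase u y) * deriv Defs.f (u x)"
    using step unfolding scheme_step_def by blast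
  have v: "v \<in> L2 X" and wL2: "w \<in> L2 X" using w by (auto simp: has_weak_laplacian_def)
  have "AE x in torus X. 0 \<le> u x \<and> u x \<le> 1" using u by (simp add: unit_valued_def)
  \<comment> \<open>Moving the implicit terms to one side leaves \<open>?r x\<close>, which depends
    only on \<open>u x\<close> and on the nonlocal coefficient \<open>?B x\<close>.\<close>
  with eq forcing_bound[OF u]
  have bounds: "AE x in torus X. 0 \<le> ?c * v x - \<epsilon> * w x \<and> ?c * v x - \<epsilon> * w x \<le> ?c"
  proof eventually_elim
    case (elim x)
    have "?c * v x - \<epsilon> * w x = ?r x" using elim(1) by (simp add: algebra_simps)
    then show ?case using reaction_bounds[of "u x" "?B x"] elim(2,3) by simp
  qed
  have "0 \<le> 9 / 4 * K" "0 \<le> 6 * (\<omega>' * K)" "0 \<le> 36 / \<epsilon>"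
    using K_nonneg \<omega>'_pos pos mult_nonneg_nonneg[of \<omega>' K] by simp_all
  moreover have "(9 / 4 + 6 * \<omega>') * K = 9 / 4 * K + 6 * (\<omega>' * K)" by (simp add: algebra_simps)
  moreover have "0 < 1 / \<tau>" using pos by simp
  ultimately have c: "0 < ?c" using stab by linarith
  have "AE x in torus X. 0 \<le> v x"
    by (rule weak_min_principle[OF w c pos(1)]) (use bounds in eventually_elim, simp)
  moreover have "AE x in torus X. 0 \<le> 1 - v x"
  proof (rule weak_min_principle[OF _ c pos(1)])
    \<comment> \<open>The constant 1 has coefficients only at the zero mode, where
      \<open>lam\<close> vanishes, so \<open>1 - v\<close> has weak Laplacian \<open>- w\<close>.
      The lower bound for it is the upper bound for \<open>v\<close>, reflected at
      \<open>?c\<close>.\<close>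
    show "has_weak_laplacian X (\<lambda>x. 1 - v x) (\<lambda>x. (- 1) * w x)"
    proof (rule weak_laplacianI)
      show "coef (\<lambda>x. (- 1) * w x) m = - lam m * coef (\<lambda>x. 1 - v x) m" for m
        unfolding coef_cmult coef_diff[OF L2_const v] weak_laplacian_coef[OF w]
        using lam_eq_0_iff[of m] coef_const[of m 1] by (cases "m = (\<lambda>_. 0)") auto
    qed (intro L2_diff L2_cmult L2_const v wL2)+
    show "AE x in torus X. 0 \<le> ?c * (1 - v x) - \<epsilon> * (- 1 * w x)"
      using bounds by eventually_elim (simp add: algebra_simps)
  qed
  ultimately have "AE x in torus X. 0 \<le> v x \<and> v x \<le> 1"
    by eventually_elim simp
  then show ?thesis using L2_D[OF v] by (simp add: unit_valued_def)
qed

section \<open>Energy dissipation in one step\<close>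

definition energy :: "(real^'d \<Rightarrow> real) \<Rightarrow> (real^'d \<Rightarrow> real^'d) \<Rightarrow> real" where
  "energy u G = \<epsilon> / 2 * (LINT x|torus X. (norm (G x))\<^sup>2) + 1 / \<epsilon> * (LINT x|torus X. W (u x))
     + \<gamma> / 2 * L2_inner X (inv_lap X (phase u)) (phase u) + M / 2 * (LINT x|torus X. phase u x)\<^sup>2"

lemma W_integrable:
  assumes "unit_valued u"
  shows "integrable (torus X) (\<lambda>x. W (u x))"
proof -
  have "continuous_on UNIV (\<lambda>p :: real \<times> real. W (fst p))"
    unfolding W_def by (intro continuous_intros)
  from L2_compose[OF assms assms this] show ?thesis by (rule L2_integrable)
qed

text \<open>\<open>energy\<close> takes the weak gradient as an argument because Green's formula
  holds for any admissible one, and it expresses the nonlocal term by \<open>inv_lap\<close>, whose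
  symmetric form can be expanded.\<close>

lemma energy_pOK_eq:
  assumes u: "unit_valued u" "u \<in> H1 X"
  shows "energy_pOK X \<epsilon> \<gamma> M \<omega> u = ereal (energy u (weak_grad X u))"
proof -
  have "has_weak_gradient X u (weak_grad X u)" by (rule weak_grad[OF assms(2)])
  then have "integrable (torus X) (\<lambda>x. (norm (weak_grad X u x))\<^sup>2)"
    by (simp add: has_weak_gradient_def L2_def)
  then show ?thesis
    unfolding energy_pOK_def energy_def integral_inv_sqrt_lap[OF phase_L2[OF u(1)]]
    using u W_integrable[OF u(1)] by simp
qed

text \<open>The change of each energy term is bounded by a part linear in \<open>v - u\<close> plus,
  except for the gradient term, a multiple of \<open>D\<close>. The linear parts add up to the
  scheme tested with \<open>v - u\<close>.\<close>

lemma energy_decreases: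
  assumes u: "unit_valued u" and step: "scheme_step X \<epsilon> \<gamma> M \<kappa> \<omega> \<tau> u v"
    and Gu: "has_weak_gradient X u Gu" and Gv: "has_weak_gradient X v Gv"
  shows "energy v Gv \<le> energy u Gu"
proof -
  interpret finite_measure "torus X" by (rule torus_finite_measure)
  have v: "unit_valued v" by (rule scheme_unit_valued[OF u step])
  let ?c = "1 / \<tau> + \<kappa> / \<epsilon>"
  let ?I = "LINT x|torus X. phase u x"
  let ?z = "\<lambda>x. v x - u x" and ?d = "\<lambda>x. phase v x - phase u x" and ?\<psi> = "inv_lap X (phase u)"
  \<comment> \<open>\<open>?g\<close> and \<open>?h\<close> are the linearizations of
    \<open>f\<close> and \<open>W\<close> at \<open>u\<close>, and \<open>?r\<close> is the
    second-order remainder of \<open>f\<close>.\<close>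
  let ?g = "\<lambda>x. deriv Defs.f (u x) * (v x - u x)"
  let ?r = "\<lambda>x. phase v x - phase u x - deriv Defs.f (u x) * (v x - u x)"
  let ?h = "\<lambda>x. deriv W (u x) * (v x - u x)"
  define D where "D = (LINT x|torus X. (?z x)\<^sup>2)"
  obtain w where w: "has_weak_laplacian X v w" and
    eq: "AE x in torus X. ?c * (v x - u x) = \<epsilon> * w x - 1 / \<epsilon> * deriv W (u x)
            - \<gamma> * inv_lap X (phase u) x * deriv Defs.f (u x)
            - M * (LINT y|torus X. phase u y) * deriv Defs.f (u x)"
    using step unfolding scheme_step_def by blast
  have uv: "AE x in torus X. 0 \<le> u x \<and> u x \<le> 1 \<and> 0 \<le> v x \<and> v x \<le> 1"
    using u v by (auto simp: unit_valued_def)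
  have L2: "u \<in> L2 X" "v \<in> L2 X" "w \<in> L2 X" "?\<psi> \<in> L2 X" "phase u \<in> L2 X" "phase v \<in> L2 X"
    using Gu Gv w by (auto simp: has_weak_gradient_def has_weak_laplacian_def inv_lap_L2 phase_L2 u v)
  have zL2: "?z \<in> L2 X" and dL2: "?d \<in> L2 X" by (intro L2_diff L2)+
  have gL2: "?g \<in> L2 X"
  proof -
    have "continuous_on UNIV (\<lambda>p :: real \<times> real. deriv Defs.f (fst p) * (snd p - fst p))"
      unfolding deriv_f by (intro continuous_intros)
    from L2_compose[OF u v this] show ?thesis .
  qed
  have hL2: "?h \<in> L2 X"
  proof -
    have "continuous_on UNIV (\<lambda>p :: real \<times> real. deriv W (fst p) * (snd p - fst p))"
      unfolding deriv_W by (intro continuous_intros)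
    from L2_compose[OF u v this] show ?thesis .
  qed
  have rL2: "?r \<in> L2 X" by (intro L2_diff[OF dL2 gL2])
  have zint: "integrable (torus X) (\<lambda>x. (?z x)\<^sup>2)" by (rule L2_D(3)[OF zL2])
  have D_nonneg: "0 \<le> D" unfolding D_def by (rule integral_nonneg_AE) simp
  have L_nonneg: "0 \<le> L" by (rule opnorm_bound_nonneg[OF L])
  have V_pos: "0 < torus_vol X" by (rule torus_vol_pos)

  \<comment> \<open>The squared norm is convex and the scheme takes the Laplacian at the new
    iterate: \<open>|Gv|^2 - |Gu|^2\<close> is at most twice the inner product of \<open>Gv\<close>
    and \<open>Gv - Gu\<close>. Green's formula turns this into the Laplacian tested with
    \<open>v - u\<close>.\<close>
  have gradient: "\<epsilon> / 2 * (LINT x|torus X. (norm (Gv x))\<^sup>2) - \<epsilon> / 2 * (LINT x|torus X. (norm (Gu x))\<^sup>2)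
      \<le> - \<epsilon> * L2_inner X w ?z"
  proof -
    have int: "integrable (torus X) (\<lambda>x. (norm (Gv x))\<^sup>2)" "integrable (torus X) (\<lambda>x. (norm (Gu x))\<^sup>2)"
      using Gu Gv by (auto simp: has_weak_gradient_def L2_def)
    note Green_u = weak_Green[OF w Gv Gu] and Green_v = weak_Green[OF w Gv Gv]
    have "(LINT x|torus X. (norm (Gv x))\<^sup>2 - (norm (Gu x))\<^sup>2)
        \<le> (LINT x|torus X. 2 * (Gv x \<bullet> Gv x) - 2 * (Gv x \<bullet> Gu x))"
    proof (rule integral_mono)
      fix x
      have "0 \<le> (Gv x - Gu x) \<bullet> (Gv x - Gu x)" by simp
      also have "\<dots> = Gv x \<bullet> Gv x - 2 * (Gv x \<bullet> Gu x) + Gu x \<bullet> Gu x"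
        by (simp add: inner_diff_left inner_diff_right inner_commute)
      finally show "(norm (Gv x))\<^sup>2 - (norm (Gu x))\<^sup>2 \<le> 2 * (Gv x \<bullet> Gv x) - 2 * (Gv x \<bullet> Gu x)"
        unfolding power2_norm_eq_inner by linarith
    qed (use int Green_u(1) Green_v(1) in auto)
    then have "(LINT x|torus X. (norm (Gv x))\<^sup>2) - (LINT x|torus X. (norm (Gu x))\<^sup>2)
        \<le> - 2 * (L2_inner X w v - L2_inner X w u)"
      using int Green_u Green_v by simp
    also have "L2_inner X w v - L2_inner X w u = L2_inner X w ?z"
      using L2_inner_diff_left[OF L2(2,1,3)] by (simp add: L2_inner_commute[of w])
    finally have "\<epsilon> / 2 * ((LINT x|torus X. (norm (Gv x))\<^sup>2) - (LINT x|torus X. (norm (Gu x))\<^sup>2))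
        \<le> \<epsilon> / 2 * (- 2 * L2_inner X w ?z)"
      using pos by (intro mult_left_mono) auto
    then show ?thesis by (simp add: right_diff_distrib)
  qed

  have potential: "(LINT x|torus X. W (v x)) - (LINT x|torus X. W (u x)) \<le> (LINT x|torus X. ?h x) + 18 * D"
  proof -
    have "(LINT x|torus X. W (v x) - W (u x)) \<le> (LINT x|torus X. ?h x + 18 * (?z x)\<^sup>2)"
    proof (rule integral_mono_AE)
      show "AE x in torus X. W (v x) - W (u x) \<le> ?h x + 18 * (?z x)\<^sup>2"
        using uv by eventually_elim (intro W_Taylor, auto)
    qed (use W_integrable u v L2_integrable[OF hL2] zint in auto)
    then show ?thesis
      using W_integrable[OF u] W_integrable[OF v] L2_integrable[OF hL2] zint by (simp add: D_def)
  qed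

  have r_le: "AE x in torus X. \<bar>?r x\<bar> \<le> 3 * (?z x)\<^sup>2"
    using uv
  proof eventually_elim
    case (elim x)
    then show ?case using f_Taylor[of "u x" "v x"] by simp
  qed
  have d_sq: "(LINT x|torus X. (?d x)\<^sup>2) \<le> 9 / 4 * D"
  proof -
    have "(LINT x|torus X. (?d x)\<^sup>2) \<le> (LINT x|torus X. 9 / 4 * (?z x)\<^sup>2)"
    proof (rule integral_mono_AE)
      show "AE x in torus X. (?d x)\<^sup>2 \<le> 9 / 4 * (?z x)\<^sup>2"
        using uv
      proof eventually_elim
        case (elim x)
        then show ?case using f_Lipschitz[of "u x" "v x"] by simp
      qed
    qed (use L2_D(3)[OF dL2] zint in auto)
    then show ?thesis by (simp add: D_def)
  qed

  \<comment> \<open>For the symmetric form \<open>A\<close> of the inverse Laplacian, the difference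
    of the two quadratic terms is \<open>2 * A (phase u) d + A d d\<close>. Splitting
    \<open>d\<close> into \<open>?g\<close> and \<open>?r\<close> isolates the linear part. The
    constant 3 comes from \<open>f_Taylor\<close>, and 9/8 is half of the squared Lipschitz constant
    9/4.\<close>
  have nonlocal: "\<gamma> / 2 * L2_inner X (inv_lap X (phase v)) (phase v)
      - \<gamma> / 2 * L2_inner X (inv_lap X (phase u)) (phase u)
      \<le> \<gamma> * (L2_inner X ?\<psi> ?g + 3 * (L * \<omega>') * D + 9 / 8 * (L * D))"
  proof -
    let ?A = "\<lambda>g h. L2_inner X (inv_lap X g) h"
    have split: "?A ?d ?d = ?A (phase v) (phase v) - ?A (phase u) (phase u) - 2 * ?A (phase u) ?d"
    proof -
      have 1: "?A ?d h = ?A (phase v) h - ?A (phase u) h" if "h \<in> L2 X" for h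
      proof -
        have swap: "?A g h = L2_inner X g (inv_lap X h)" if "g \<in> L2 X" for g
          using inv_lap_symmetric[OF that \<open>h \<in> L2 X\<close>] L2_inner_commute by metis
        show ?thesis
          unfolding swap[OF dL2] swap[OF L2(6)] swap[OF L2(5)]
          by (rule L2_inner_diff_left[OF L2(6,5) inv_lap_L2[OF that]])
      qed
      have 2: "?A (phase u) ?d = ?A (phase u) (phase v) - ?A (phase u) (phase u)"
        using 1[OF L2(5)] inv_lap_symmetric[OF dL2 L2(5)] inv_lap_symmetric[OF L2(6) L2(5)] by simp
      have 3: "?A (phase v) ?d = ?A (phase v) (phase v) - ?A (phase u) (phase v)"
        using 1[OF L2(6)] inv_lap_symmetric[OF dL2 L2(6)] by simp
      show ?thesis using 1[OF dL2] 2 3 by simp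
    qed
    have "?A ?d ?d \<le> L * L2_inner X ?d ?d" by (rule L2_inner_inv_lap_le[OF L dL2])
    also have "\<dots> \<le> L * (9 / 4 * D)"
      using d_sq L_nonneg by (intro mult_left_mono) (simp_all add: L2_inner_def power2_eq_square)
    finally have dd: "?A ?d ?d \<le> L * (9 / 4 * D)" .
    have "L2_inner X ?\<psi> ?r \<le> (LINT x|torus X. 3 * (L * \<omega>') * (?z x)\<^sup>2)"
      unfolding L2_inner_def
    proof (rule integral_mono_AE)
      show "AE x in torus X. ?\<psi> x * ?r x \<le> 3 * (L * \<omega>') * (?z x)\<^sup>2"
        using inv_lap_phase_bound[OF u] r_le
      proof eventually_elim
        case (elim x)
        have "?\<psi> x * ?r x \<le> \<bar>?\<psi> x\<bar> * \<bar>?r x\<bar>" by (simp flip: abs_mult)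
        also have "\<dots> \<le> (L * \<omega>') * (3 * (?z x)\<^sup>2)"
          by (rule mult_mono[OF elim]) (use L_nonneg \<omega>'_pos in auto)
        finally show ?case by (simp add: mult_ac)
      qed
    qed (use L2_mult_integrable[OF L2(4) rL2] zint in auto)
    then have r: "L2_inner X ?\<psi> ?r \<le> 3 * (L * \<omega>') * D" by (simp add: D_def)
    have "L2_inner X ?\<psi> ?r = L2_inner X ?\<psi> ?d - L2_inner X ?\<psi> ?g"
      using L2_inner_diff_left[OF dL2 gL2 L2(4)] by (simp add: L2_inner_commute[of ?\<psi>])
    with split dd r have "?A (phase v) (phase v) / 2 - ?A (phase u) (phase u) / 2
        \<le> L2_inner X ?\<psi> ?g + 3 * (L * \<omega>') * D + 9 / 8 * (L * D)" by simp
    then have "\<gamma> * (?A (phase v) (phase v) / 2 - ?A (phase u) (phase u) / 2)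
        \<le> \<gamma> * (L2_inner X ?\<psi> ?g + 3 * (L * \<omega>') * D + 9 / 8 * (L * D))"
      using pos by (intro mult_left_mono) auto
    then show ?thesis by (simp add: right_diff_distrib)
  qed

  \<comment> \<open>The same expansion for the squared integral, a rank-one form: by Cauchy-Schwarz
    the volume takes the place of \<open>L\<close>.\<close>
  have mass: "M / 2 * (LINT x|torus X. phase v x)\<^sup>2 - M / 2 * ?I\<^sup>2
      \<le> M * (?I * (LINT x|torus X. ?g x) + 3 * (\<omega>' * torus_vol X) * D + 9 / 8 * (torus_vol X * D))"
  proof -
    define J where "J = (LINT x|torus X. ?d x)"
    have J: "(LINT x|torus X. phase v x) = ?I + J"
      unfolding J_def
      using Bochner_Integration.integral_diff[OF L2_integrable[OF L2(6)] L2_integrable[OF L2(5)]] by linarith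
    have "J\<^sup>2 \<le> L2_inner X ?d ?d * L2_inner X (\<lambda>_. 1) (\<lambda>_. 1)"
      using Cauchy_Schwarz_L2[OF dL2 L2_const[of 1]] by (simp add: J_def L2_inner_def)
    also have "\<dots> = (LINT x|torus X. (?d x)\<^sup>2) * torus_vol X"
      by (simp add: L2_inner_def torus_vol_eq power2_eq_square)
    also have "\<dots> \<le> 9 / 4 * D * torus_vol X" using d_sq V_pos by (intro mult_right_mono) auto
    finally have J2: "J\<^sup>2 \<le> 9 / 4 * (torus_vol X * D)" by (simp add: mult_ac)
    have rint: "\<bar>LINT x|torus X. ?r x\<bar> \<le> 3 * D"
    proof -
      have "\<bar>LINT x|torus X. ?r x\<bar> \<le> (LINT x|torus X. \<bar>?r x\<bar>)"
        using integral_norm_bound[of "torus X" ?r] by simp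
      also have "\<dots> \<le> (LINT x|torus X. 3 * (?z x)\<^sup>2)"
        by (rule integral_mono_AE) (use r_le L2_integrable[OF rL2] zint in auto)
      finally show ?thesis by (simp add: D_def)
    qed
    have "?I * (LINT x|torus X. ?r x) \<le> \<bar>?I\<bar> * \<bar>LINT x|torus X. ?r x\<bar>" by (simp flip: abs_mult)
    also have "\<dots> \<le> (\<omega>' * torus_vol X) * (3 * D)"
      by (rule mult_mono[OF integral_phase_bound[OF u] rint]) (use \<omega>'_pos V_pos in auto)
    finally have Ir: "?I * (LINT x|torus X. ?r x) \<le> 3 * (\<omega>' * torus_vol X) * D" by (simp add: mult_ac)
    have "(LINT x|torus X. ?r x) = J - (LINT x|torus X. ?g x)"
      unfolding J_def using L2_integrable[OF dL2] L2_integrable[OF gL2]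
      by (rule Bochner_Integration.integral_diff)
    then have "J = (LINT x|torus X. ?g x) + (LINT x|torus X. ?r x)" by simp
    then have "?I * J = ?I * (LINT x|torus X. ?g x) + ?I * (LINT x|torus X. ?r x)"
      by (simp only: distrib_left)
    with J2 Ir have "?I * J + J\<^sup>2 / 2
        \<le> ?I * (LINT x|torus X. ?g x) + 3 * (\<omega>' * torus_vol X) * D + 9 / 8 * (torus_vol X * D)" by simp
    then have "M * (?I * J + J\<^sup>2 / 2)
        \<le> M * (?I * (LINT x|torus X. ?g x) + 3 * (\<omega>' * torus_vol X) * D + 9 / 8 * (torus_vol X * D))"
      using pos by (intro mult_left_mono) auto
    moreover have "M / 2 * (?I + J)\<^sup>2 - M / 2 * ?I\<^sup>2 = M * (?I * J + J\<^sup>2 / 2)"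
      by (simp add: power2_eq_square algebra_simps)
    ultimately show ?thesis unfolding J by simp
  qed

  \<comment> \<open>The scheme multiplied by \<open>v - u\<close> and integrated. Its terms are
    exactly the linear parts of the preceding estimates, so these sum to
    \<open>- ?c * D\<close>.\<close>
  have tested: "- \<epsilon> * L2_inner X w ?z + 1 / \<epsilon> * (LINT x|torus X. ?h x) + \<gamma> * L2_inner X ?\<psi> ?g
      + M * (?I * (LINT x|torus X. ?g x)) = - ?c * D"
  proof -
    have "- \<epsilon> * L2_inner X w ?z + 1 / \<epsilon> * (LINT x|torus X. ?h x) + \<gamma> * L2_inner X ?\<psi> ?g
        + M * (?I * (LINT x|torus X. ?g x))
        = (LINT x|torus X. (- \<epsilon>) * (w x * ?z x) + 1 / \<epsilon> * ?h x + \<gamma> * (?\<psi> x * ?g x) + M * ?I * ?g x)"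
      unfolding L2_inner_def
      using L2_mult_integrable[OF L2(3) zL2] L2_integrable[OF hL2] L2_mult_integrable[OF L2(4) gL2]
        L2_integrable[OF gL2] by (simp add: mult.assoc)
    also have "\<dots> = (LINT x|torus X. (- ?c) * (?z x)\<^sup>2)"
    proof (rule integral_cong_AE)
      show "AE x in torus X. (- \<epsilon>) * (w x * ?z x) + 1 / \<epsilon> * ?h x + \<gamma> * (?\<psi> x * ?g x) + M * ?I * ?g x
          = (- ?c) * (?z x)\<^sup>2"
        using eq
      proof eventually_elim
        case (elim x)
        have "(- ?c) * (?z x)\<^sup>2 = - (?c * ?z x) * ?z x"
          by (simp only: power2_eq_square mult_minus_left mult.assoc)
        also have "\<dots> = (- \<epsilon>) * (w x * ?z x) + 1 / \<epsilon> * ?h x + \<gamma> * (?\<psi> x * ?g x) + M * ?I * ?g x"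
          unfolding elim by (simp add: algebra_simps diff_divide_distrib add_divide_distrib)
        finally show ?case by simp
      qed
    qed (use L2_mult_integrable[OF L2(3) zL2] L2_integrable[OF hL2] L2_mult_integrable[OF L2(4) gL2]
        L2_integrable[OF gL2] zint in \<open>auto intro!: borel_measurable_add borel_measurable_times\<close>)
    also have "\<dots> = - ?c * D" by (simp add: D_def)
    finally show ?thesis .
  qed

  have pot: "1 / \<epsilon> * (LINT x|torus X. W (v x)) - 1 / \<epsilon> * (LINT x|torus X. W (u x))
      \<le> 1 / \<epsilon> * (LINT x|torus X. ?h x) + 18 / \<epsilon> * D"
    using mult_left_mono[OF potential, of "1 / \<epsilon>"] pos by (simp add: algebra_simps add_divide_distrib diff_divide_distrib)
  have "energy v Gv - energy u Gu
      \<le> - ?c * D + 18 / \<epsilon> * D + \<gamma> * (3 * (L * \<omega>') * D + 9 / 8 * (L * D))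
        + M * (3 * (\<omega>' * torus_vol X) * D + 9 / 8 * (torus_vol X * D))"
    using gradient pot nonlocal mass tested unfolding energy_def distrib_left by linarith
  \<comment> \<open>All remainders together are half of the left-hand side of \<open>stab\<close>:
    18, 3 and 9/8 are the halves of 36, 6 and 9/4.\<close>
  also have "\<dots> = (1 / 2 * (36 / \<epsilon> + (9 / 4 + 6 * \<omega>') * K) - ?c) * D"
    by (simp add: algebra_simps)
  also have "\<dots> \<le> 0"
  proof (rule mult_nonpos_nonneg[OF _ D_nonneg])
    have "0 \<le> 36 / \<epsilon>" "0 \<le> (9 / 4 + 6 * \<omega>') * K"
      using K_nonneg \<omega>'_pos pos mult_nonneg_nonneg[of "9 / 4 + 6 * \<omega>'" K] by simp_all
    then have "0 \<le> 36 / \<epsilon> + (9 / 4 + 6 * \<omega>') * K" by (rule add_nonneg_nonneg)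
    moreover have "0 < 1 / \<tau>" using pos by simp
    moreover have "1 / 2 * S - (a + b) \<le> 0" if "0 \<le> S" "0 < a" "S \<le> b" for S a b :: real
      using that by linarith
    ultimately show "1 / 2 * (36 / \<epsilon> + (9 / 4 + 6 * \<omega>') * K) - ?c \<le> 0" using stab by blast
  qed
  finally show ?thesis by simp
qed

text \<open>A function outside \<open>H1\<close> has infinite energy and nothing is to be shown;
  this covers a rough initial function.\<close>

lemma energy_stable:
  assumes u: "unit_valued u" and step: "scheme_step X \<epsilon> \<gamma> M \<kappa> \<omega> \<tau> u v"
  shows "energy_pOK X \<epsilon> \<gamma> M \<omega> v \<le> energy_pOK X \<epsilon> \<gamma> M \<omega> u"
proof (cases "u \<in> H1 X")
  case True
  obtain w where "has_weak_laplacian X v w" using step unfolding scheme_step_def by blast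
  then have "v \<in> H1 X" using weak_gradient_exists by (auto simp: H1_def)
  show ?thesis
    using energy_decreases[OF u step weak_grad[OF True] weak_grad[OF \<open>v \<in> H1 X\<close>]]
    by (simp add: energy_pOK_eq u scheme_unit_valued[OF u step] True \<open>v \<in> H1 X\<close>)
qed (simp add: energy_pOK_def)

end

theorem theorem3p2:
  fixes X :: "real^'d"
    and \<epsilon> \<gamma> M \<kappa> \<omega> \<omega>' T \<tau> :: real
    and N :: nat
    and \<phi> :: "nat \<Rightarrow> real^'d \<Rightarrow> real"
  assumes "CARD('d) = 2 \<or> CARD('d) = 3"
    and "\<And>i. 0 < X $ i"
    and "0 < \<epsilon>" and "0 < \<gamma>" and "0 < M" and "0 < \<kappa>"
    and "0 < \<omega>" and "\<omega> < 1" and "\<omega>' = max \<omega> (1 - \<omega>)"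
    and "0 < T" and "0 < N" and "\<tau> = T / real N"
    and "periodic X (\<phi> 0)" and "\<phi> 0 \<in> borel_measurable (torus X)"
    and "AE x in torus X. 0 \<le> \<phi> 0 x \<and> \<phi> 0 x \<le> 1"
    and "\<And>n. n < N \<Longrightarrow> scheme_step X \<epsilon> \<gamma> M \<kappa> \<omega> \<tau> (\<phi> n) (\<phi> (Suc n))"
    and "ereal (\<kappa> / \<epsilon>) \<ge> L_W'' / ereal \<epsilon>
           + (L_f'\<^sup>2 + ereal \<omega>' * L_f'')
             * (ereal \<gamma> * inv_lap_opnorm X + ereal (M * torus_vol X))"
  shows "\<forall>n<N. energy_pOK X \<epsilon> \<gamma> M \<omega> (\<phi> (Suc n)) \<le> energy_pOK X \<epsilon> \<gamma> M \<omega> (\<phi> n)"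
proof -
  interpret periodic_box X by unfold_locales (rule assms(2))
  have \<omega>'_pos: "0 < \<omega>'" using assms(7-9) by simp
  have V: "0 < M * torus_vol X" using torus_vol_pos assms(5) by simp
  let ?O = "ereal \<gamma> * inv_lap_opnorm X + ereal (M * torus_vol X)"
  \<comment> \<open>Multiplication of extended reals is monotone only for nonnegative factors, so
    the sign is settled before the norms are replaced by numbers.\<close>
  have O: "0 \<le> ?O"
    using opnorm_nonneg assms(4) V by (intro add_nonneg_nonneg ereal_0_le_mult) auto
  have "ereal (36 / \<epsilon>) \<le> L_W'' / ereal \<epsilon>"
    using ereal_divide_right_mono[OF L_W''_ge, of "ereal \<epsilon>"] assms(3) by simp
  moreover have coeff: "ereal (9 / 4 + 6 * \<omega>') \<le> L_f'\<^sup>2 + ereal \<omega>' * L_f''"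
  proof -
    have "ereal (3 / 2) * ereal (3 / 2) \<le> L_f' * L_f'"
      by (intro ereal_mult_mono L_f'_ge order_trans[OF _ L_f'_ge]) auto
    then have "ereal (9 / 4) \<le> L_f'\<^sup>2" by (simp add: power2_eq_square)
    moreover have "ereal \<omega>' * 6 \<le> ereal \<omega>' * L_f''"
      using \<omega>'_pos L_f''_ge by (intro ereal_mult_left_mono) auto
    ultimately show ?thesis
      using add_mono[of "ereal (9 / 4)" "L_f'\<^sup>2" "ereal \<omega>' * 6" "ereal \<omega>' * L_f''"]
      by (simp add: mult.commute)
  qed
  then have "ereal (9 / 4 + 6 * \<omega>') * ?O \<le> (L_f'\<^sup>2 + ereal \<omega>' * L_f'') * ?O"
    by (rule ereal_mult_right_mono[OF _ O])
  ultimately have le: "ereal (36 / \<epsilon>) + ereal (9 / 4 + 6 * \<omega>') * ?O \<le> ereal (\<kappa> / \<epsilon>)"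
    using assms(17) by (meson add_mono order_trans)
  \<comment> \<open>Finiteness is read off the stability condition: an infinite norm, multiplied by
    positive coefficients, would have to lie below the real number
    \<open>\<kappa> / \<epsilon>\<close>.\<close>
  have "inv_lap_opnorm X \<noteq> \<infinity>"
  proof
    assume "inv_lap_opnorm X = \<infinity>"
    then have "?O = \<infinity>" using assms(4) by simp
    then have "ereal (36 / \<epsilon>) + ereal (9 / 4 + 6 * \<omega>') * \<infinity> \<le> ereal (\<kappa> / \<epsilon>)" using le by (simp only:)
    then show False using \<omega>'_pos by simp
  qed
  then obtain L where L: "inv_lap_opnorm X = ereal L"
    using opnorm_nonneg by (cases "inv_lap_opnorm X") auto
  interpret pOK_scheme X \<epsilon> \<gamma> M \<kappa> \<omega> \<omega>' \<tau> L
  proof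
    show "0 < \<tau>" using assms(10-12) by simp
    show "36 / \<epsilon> + (9 / 4 + 6 * \<omega>') * (\<gamma> * L + M * torus_vol X) \<le> \<kappa> / \<epsilon>"
      using le unfolding L by simp
  qed (use assms L in auto)
  have "n \<le> N \<Longrightarrow> unit_valued (\<phi> n)" for n
  proof (induction n)
    case 0
    show ?case using assms(13-15) by (simp add: unit_valued_def)
  next
    case (Suc n)
    then show ?case using scheme_unit_valued assms(16)[of n] by simp
  qed
  then show ?thesis using energy_stable assms(16) by simp
qed

end
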